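(* Let $k$ be an algebraically closed field of characteristic $p \ge 3$ and let $q \ge 5$ be a power of $p$. Let $C_2 \subset \mathbb{P}^2$ be the plane curve of degree $q$ over $k$ which is the image of the morphism $$\varphi_2: \mathbb{P}^1 \rightarrow \mathbb{P}^2; \quad (s:t) \mapsto \left(s^{\frac{q+1}{2}}t^{\frac{q-1}{2}} : (s-t)^{\frac{q+1}{2}}t^{\frac{q-1}{2}} : s^q-st^{q-1}\right).$$ Then: (a) The point $P_1:=(0:1:0)=\varphi_2(0:1)$ is an inner Galois point for $C_2$ with $G_{P_1} \cong D_{q-1}$. (b) The point $P_2:=(1:0:0)=\varphi_2(1:1)$ is an inner Galois point for $C_2$ with $G_{P_2} \cong D_{q-1}$. (c) The number of inner Galois points for $C_2$ is exactly two.
   Context: Let $C \subset \mathbb{P}^2$ be an irreducible plane curve over an algebraically closed field $k$, with function field $k(C)$. For a point $P \in \mathbb{P}^2$, let $\pi_P: C \dashrightarrow \mathbb{P}^1$ denote the projection from $P$ (the restriction to $C$ of the linear projection $\mathbb{P}^2 \dashrightarrow \mathbb{P}^1$ with center $P$). The point $P$ is called a Galois point for $C$ if the function field extension $k(C)/\pi_P^*k(\mathbb{P}^1)$ induced by $\pi_P$ is Galois; in that case $G_P$ denotes the Galois group of this extension. A Galois point $P$ is called inner if $P$ is a smooth point of $C$, and outer if $P \in \mathbb{P}^2 \setminus C$. For an even integer $2m$, $D_{2m}$ denotes the dihedral group of order $2m$, i.e. $\langle a,b \mid a^m=b^2=(ab)^2=1\rangle$ (so $D_4$ is the Klein four-group).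 *)

theory Defs
  imports
    "HOL-Library.Poly_Mapping"
    "HOL-Analysis.Cartesian_Space"
    "HOL-Computational_Algebra.Computational_Algebra"
    "HOL-Algebra.Algebra"
begin

unbundle no fps_syntax

section \<open>Projective space\<close>

text \<open>
  A point of projective space is the set of all its homogeneous coordinate vectors. The coordinates
  are indexed by the finite type \<open>'n\<close>; the projective line and plane over \<open>'k\<close> use the
  index types \<open>2\<close> and \<open>3\<close>.
\<close>

type_synonym ('k, 'n) proj_pt = "('k ^ 'n) set"

definition proj_pt :: "'k::field ^ 'n::finite \<Rightarrow> ('k, 'n) proj_pt" where
  "proj_pt v = {c *s v | c. c \<noteq> 0}"

definition proj_space :: "('k::field, 'n::finite) proj_pt set" where
  "proj_space = proj_pt ` {v. v \<noteq> 0}"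

text \<open>
  The map induced by a map on coordinate vectors. It is meant for \<open>f\<close> given by forms of the same
  degree without a common zero, so that all members of the union are the same point.
\<close>

definition proj_map ::
    "('k::field ^ 'm::finite \<Rightarrow> 'k ^ 'n::finite) \<Rightarrow> ('k, 'm) proj_pt \<Rightarrow> ('k, 'n) proj_pt" where
  "proj_map f P = (\<Union>v\<in>P. proj_pt (f v))"

section \<open>Polynomials in the homogeneous coordinates\<close>

type_synonym ('k, 'n) mpoly = "('n \<Rightarrow>\<^sub>0 nat) \<Rightarrow>\<^sub>0 'k"

text \<open>
  Evaluation at \<open>x\<close> in an arbitrary commutative ring, the coefficients being mapped by \<open>h\<close>.
\<close>

definition mp_eval ::
    "('k::field \<Rightarrow> 'r::comm_ring_1) \<Rightarrow> ('n::finite \<Rightarrow> 'r) \<Rightarrow> ('k, 'n) mpoly \<Rightarrow> 'r" where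
  "mp_eval h x F =
     (\<Sum>m\<in>Poly_Mapping.keys F. h (Poly_Mapping.lookup F m) *
        (\<Prod>i\<in>UNIV. x i ^ Poly_Mapping.lookup m i))"

definition mp_subst ::
    "('n::finite \<Rightarrow> ('k::field, 'm) mpoly) \<Rightarrow> ('k, 'n) mpoly \<Rightarrow> ('k, 'm) mpoly" where
  "mp_subst = mp_eval (Poly_Mapping.single 0)"

definition homogeneous :: "nat \<Rightarrow> ('k::field, 'n::finite) mpoly \<Rightarrow> bool" where
  "homogeneous d F \<longleftrightarrow> (\<forall>m\<in>Poly_Mapping.keys F. (\<Sum>i\<in>UNIV. Poly_Mapping.lookup m i) = d)"

definition mp_pderiv :: "'n \<Rightarrow> ('k::field, 'n) mpoly \<Rightarrow> ('k, 'n) mpoly" where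
  "mp_pderiv i F = (\<Sum>m\<in>Poly_Mapping.keys F.
     Poly_Mapping.single (m - Poly_Mapping.single i 1)
       (of_nat (Poly_Mapping.lookup m i) * Poly_Mapping.lookup F m))"

definition vanishes_at :: "('k::field, 'n::finite) mpoly \<Rightarrow> ('k, 'n) proj_pt \<Rightarrow> bool" where
  "vanishes_at F P \<longleftrightarrow> (\<forall>v\<in>P. mp_eval id (($) v) F = 0)"

definition zero_locus :: "('k::field, 'n::finite) mpoly \<Rightarrow> ('k, 'n) proj_pt set" where
  "zero_locus F = {P \<in> proj_space. vanishes_at F P}"

section \<open>Plane curves\<close>

text \<open>
  The ground field is algebraically closed wherever these notions are used, so an irreducible curve
  is identified with its set of points and determines its equation up to a scalar.
\<close>

definition curve_equation ::
    "nat \<Rightarrow> ('k::field, 3) mpoly \<Rightarrow> ('k, 3) proj_pt set \<Rightarrow> bool" where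
  "curve_equation d F C \<longleftrightarrow>
     homogeneous d F \<and> Factorial_Ring.irreducible F \<and> C = zero_locus F"

definition irreducible_plane_curve :: "nat \<Rightarrow> ('k::field, 3) proj_pt set \<Rightarrow> bool" where
  "irreducible_plane_curve d C \<longleftrightarrow> (\<exists>F. curve_equation d F C)"

definition smooth_point :: "('k::field, 3) proj_pt set \<Rightarrow> ('k, 3) proj_pt \<Rightarrow> bool" where
  "smooth_point C P \<longleftrightarrow> P \<in> C \<and>
     (\<exists>d F. curve_equation d F C \<and> (\<exists>i. \<not> vanishes_at (mp_pderiv i F) P))"

section \<open>Function fields\<close>

text \<open>
  The function field of an irreducible projective variety \<open>V\<close>: fractions of forms of the same
  degree whose denominator does not vanish identically on \<open>V\<close>, two fractions being identified
  when they agree on \<open>V\<close>.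
\<close>

definition fractions ::
    "('k::field, 'n::finite) proj_pt set \<Rightarrow> (('k, 'n) mpoly \<times> ('k, 'n) mpoly) set" where
  "fractions V = {(A, B). (\<exists>d. homogeneous d A \<and> homogeneous d B) \<and>
                          (\<exists>P\<in>V. \<not> vanishes_at B P)}"

definition frac_rel ::
    "('k::field, 'n::finite) proj_pt set \<Rightarrow>
     ((('k, 'n) mpoly \<times> ('k, 'n) mpoly) \<times> (('k, 'n) mpoly \<times> ('k, 'n) mpoly)) set" where
  "frac_rel V = {((A, B), (A', B')). (A, B) \<in> fractions V \<and> (A', B') \<in> fractions V \<and>
                   (\<forall>P\<in>V. vanishes_at (A * B' - A' * B) P)}"

type_synonym ('k, 'n) rat_fun = "(('k, 'n) mpoly \<times> ('k, 'n) mpoly) set"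

definition rat_fun ::
    "('k::field, 'n::finite) proj_pt set \<Rightarrow> ('k, 'n) mpoly \<Rightarrow> ('k, 'n) mpoly \<Rightarrow>
     ('k, 'n) rat_fun" where
  "rat_fun V A B = frac_rel V `` {(A, B)}"

definition function_field ::
    "('k::field, 'n::finite) proj_pt set \<Rightarrow> ('k, 'n) rat_fun ring" where
  "function_field V =
    \<lparr>carrier = fractions V // frac_rel V,
     mult = (\<lambda>f g. \<Union>(A, B)\<in>f. \<Union>(A', B')\<in>g. rat_fun V (A * A') (B * B')),
     one = rat_fun V 1 1,
     ring.zero = rat_fun V 0 1,
     add = (\<lambda>f g. \<Union>(A, B)\<in>f. \<Union>(A', B')\<in>g. rat_fun V (A * B' + A' * B) (B * B'))\<rparr>"

section \<open>Projection from a point\<close>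

text \<open>
  A linear projection with center \<open>P\<close> is given by two linear forms whose only common zero is
  \<open>P\<close>. Two such pairs differ by an automorphism of the projective line, so the subfield below
  does not depend on the choice made in \<open>projection_from\<close>.
\<close>

definition is_projection_from ::
    "(2 \<Rightarrow> ('k::field, 3) mpoly) \<Rightarrow> ('k, 3) proj_pt \<Rightarrow> bool" where
  "is_projection_from L P \<longleftrightarrow>
     (\<forall>i. homogeneous 1 (L i)) \<and> (\<Inter>i. zero_locus (L i)) = {P}"

definition projection_from :: "('k::field, 3) proj_pt \<Rightarrow> 2 \<Rightarrow> ('k, 3) mpoly" where
  "projection_from P = (SOME L. is_projection_from L P)"

text \<open>
  Pullback of rational functions along the rational map from \<open>V\<close> given by the forms \<open>L\<close>. It is
  meaningful when that map is dominant, which for the projection of an irreducible plane curve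
  \<open>C\<close> from \<open>P\<close> only excludes the lines through \<open>P\<close>.
\<close>

definition pullback ::
    "('k::field, 'm::finite) proj_pt set \<Rightarrow> ('n::finite \<Rightarrow> ('k, 'm) mpoly) \<Rightarrow>
     ('k, 'n) rat_fun \<Rightarrow> ('k, 'm) rat_fun" where
  "pullback V L f = (\<Union>(A, B)\<in>f. rat_fun V (mp_subst L A) (mp_subst L B))"

definition projection_subfield ::
    "('k::field, 3) proj_pt set \<Rightarrow> ('k, 3) proj_pt \<Rightarrow> ('k, 3) rat_fun set" where
  "projection_subfield C P =
     pullback C (projection_from P) ` carrier (function_field (proj_space :: ('k, 2) proj_pt set))"

section \<open>Galois extensions and Galois points\<close>

definition Gal :: "('a, 'b) ring_scheme \<Rightarrow> 'a set \<Rightarrow> ('a \<Rightarrow> 'a) monoid" where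
  "Gal L K = BijGroup (carrier L)
     \<lparr>carrier := {\<sigma> \<in> Bij (carrier L). \<sigma> \<in> ring_hom L L \<and> (\<forall>x\<in>K. \<sigma> x = x)}\<rparr>"

definition galois_extension :: "('a, 'b) ring_scheme \<Rightarrow> 'a set \<Rightarrow> bool" where
  "galois_extension L K \<longleftrightarrow>
     field L \<and> subfield K L \<and> (\<forall>x\<in>carrier L. ring.algebraic L K x) \<and>
     {x \<in> carrier L. \<forall>\<sigma>\<in>carrier (Gal L K). \<sigma> x = x} = K"

definition galois_point :: "('k::field, 3) proj_pt set \<Rightarrow> ('k, 3) proj_pt \<Rightarrow> bool" where
  "galois_point C P \<longleftrightarrow>
     P \<in> proj_space \<and> galois_extension (function_field C) (projection_subfield C P)"

definition galois_point_group ::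
    "('k::field, 3) proj_pt set \<Rightarrow> ('k, 3) proj_pt \<Rightarrow>
     (('k, 3) rat_fun \<Rightarrow> ('k, 3) rat_fun) monoid" where
  "galois_point_group C P = Gal (function_field C) (projection_subfield C P)"

definition inner_galois_point :: "('k::field, 3) proj_pt set \<Rightarrow> ('k, 3) proj_pt \<Rightarrow> bool" where
  "inner_galois_point C P \<longleftrightarrow> galois_point C P \<and> smooth_point C P"

section \<open>Dihedral groups\<close>

text \<open>
  Groups given by generators and relators. In a word, \<open>(x, True)\<close> stands for the generator
  \<open>x\<close> and \<open>(x, False)\<close> for its inverse; every element of the type \<open>'g\<close> is a generator.
\<close>

type_synonym 'g word = "('g \<times> bool) list"

inductive word_eq :: "'g word set \<Rightarrow> 'g word \<Rightarrow> 'g word \<Rightarrow> bool" for R where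
  refl: "word_eq R u u"
| sym: "word_eq R u v \<Longrightarrow> word_eq R v u"
| trans: "word_eq R u v \<Longrightarrow> word_eq R v w \<Longrightarrow> word_eq R u w"
| cancel: "word_eq R (u @ [(x, e), (x, \<not> e)] @ v) (u @ v)"
| relator: "r \<in> R \<Longrightarrow> word_eq R (u @ r @ v) (u @ v)"

definition presented_group :: "'g word set \<Rightarrow> 'g word set monoid" where
  "presented_group R =
    \<lparr>carrier = UNIV // {(u, v). word_eq R u v},
     mult = (\<lambda>x y. \<Union>u\<in>x. \<Union>v\<in>y. {w. word_eq R (u @ v) w}),
     one = {w. word_eq R [] w}\<rparr>"

datatype dihedral_gen = gen_a | gen_b

text \<open>The argument of \<open>dihedral_group\<close> is the order of the group, an even number.\<close>

definition dihedral_group :: "nat \<Rightarrow> dihedral_gen word set monoid" where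
  "dihedral_group n = presented_group
     {replicate (n div 2) (gen_a, True),
      [(gen_b, True), (gen_b, True)],
      [(gen_a, True), (gen_b, True), (gen_a, True), (gen_b, True)]}"

section \<open>The curve\<close>

definition phi2 :: "nat \<Rightarrow> ('k::field, 2) proj_pt \<Rightarrow> ('k, 3) proj_pt" where
  "phi2 q = proj_map (\<lambda>v. let s = v $ 1; t = v $ 2 in
     vector [s ^ ((q + 1) div 2) * t ^ ((q - 1) div 2),
             (s - t) ^ ((q + 1) div 2) * t ^ ((q - 1) div 2),
             s ^ q - s * t ^ (q - 1)])"

definition C2 :: "nat \<Rightarrow> ('k::field, 3) proj_pt set" where
  "C2 q = phi2 q ` proj_space"

end

theory Submission
  imports Defs "HOL-Algebra.Algebraic_Closure_Type"
begin

text \<open>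
  Put \<open>m = (q - 1)/2\<close> and \<open>n = (q + 1)/2\<close>, so that \<open>n = m + 1\<close> and \<open>q = m + n\<close>. In the coordinate
  \<open>s\<close> of the line, with \<open>t = 1\<close>, the curve is the image of \<open>s \<mapsto> (s\<^sup>n : (s - 1)\<^sup>n : s\<^sup>q - s)\<close>,
  together with the point \<open>(0:0:1)\<close> at \<open>s = \<infinity>\<close>. This parametrization is birational (\<open>ratios_aff_par\<close>),
  hence the function field of the curve is \<open>k(s)\<close> (\<open>rat_cls_ring_iso\<close>), and the subfield belonging to
  the projection from \<open>P\<close> is \<open>k(f)\<close>, where \<open>f\<close> is the quotient of two independent linear forms
  vanishing at \<open>P\<close> (\<open>projection_subfield_finite_point\<close>, \<open>projection_subfield_P1\<close>). All questions about
  Galois points become questions about the extensions \<open>k(s)/k(f)\<close>.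

  For \<open>P\<^sub>1\<close> one may take \<open>f = z/x = s\<^sup>m - s\<^sup>-\<^sup>m\<close>. This function is invariant under \<open>s \<mapsto> \<zeta> s\<close> with
  \<open>\<zeta>\<^sup>m = 1\<close> and under \<open>s \<mapsto> \<eta>/s\<close> with \<open>\<eta>\<^sup>m = -1\<close>. These substitutions form a dihedral group of order
  \<open>2m = q - 1\<close> whose field of invariants is exactly \<open>k(f)\<close> (\<open>dih_fixed_field\<close>, \<open>dih_Gal_iso\<close>). Since
  \<open>q\<close> is a power of the characteristic, \<open>s\<^sup>q - s = (s - 1)\<^sup>q - (s - 1)\<close>; so the translation
  \<open>s \<mapsto> s - 1\<close> carries the extension for \<open>P\<^sub>1\<close> to that for \<open>P\<^sub>2\<close>.

  No other smooth point \<open>P\<close> is a Galois point. The point at \<open>s = \<infinity>\<close> is singular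
  (\<open>not_smooth_Pinf\<close>). Let \<open>P\<close> be the image of \<open>s\<^sub>0 \<noteq> 0, 1\<close>, and let \<open>r = y/x\<close> at \<open>P\<close>. The line
  \<open>y = r x\<close> through \<open>P\<close> pulls back to a polynomial in \<open>s\<close> with simple zeros and of degree at most \<open>n\<close>,
  and another line through \<open>P\<close> to one of degree \<open>q\<close>; after cancelling common zeros, \<open>f = g/D\<close> where \<open>g\<close>
  has simple zeros only and \<open>deg D \<ge> deg g + 2\<close>. If \<open>g\<close> is not constant, every \<open>k\<close>-embedding of
  \<open>k(s)\<close> into itself that fixes \<open>g/D\<close> multiplies \<open>g\<close> by a root of unity of exponent \<open>deg D - deg g\<close>, so
  a power of \<open>g\<close> outside \<open>k(g/D)\<close> is fixed as well and the extension is not Galois (\<open>not_galois_quotient\<close>). If \<open>g\<close>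
  is constant, all the affine parameters at which the line \<open>y = r x\<close> meets the curve are mapped to \<open>P\<close>,
  and the tangent line at the smooth point \<open>P\<close> has a double zero at each of them. For \<open>r \<noteq> 1\<close> there are
  \<open>n\<close> of them, but \<open>2n > q\<close>; for \<open>r = 1\<close> two of them already lead to a contradiction
  (\<open>no_common_tangent\<close>).

  The equation of the curve is found by elimination. With \<open>w = 1 - 1/s\<close> one has \<open>y/x = w\<^sup>n\<close>, and \<open>z/x\<close>
  is a rational function of \<open>w\<close>. So the equation is the norm of a linear polynomial in \<open>Z\<close> over
  \<open>k[w]\<close> for the group \<open>w \<mapsto> \<xi> w\<close>, \<open>\<xi>\<^sup>n = 1\<close>. From it one reads off that the curve is irreducible of
  degree \<open>q\<close> and smooth at \<open>P\<^sub>1\<close> and \<open>P\<^sub>2\<close>.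
\<close>

hide_const (open) UnivPoly.coeff UnivPoly.monom Polynomials.degree Polynomials.lead_coeff
  Module.smult Coset.order Divisibility.irreducible Divisibility.prime

unbundle no fps_syntax

section \<open>Polynomials over an algebraically closed field\<close>

text \<open>
  Over an algebraically closed field, absence of common roots is coprimality: a root of \<open>p\<close> can be
  cancelled from \<open>p\<close> and from \<open>q\<close>.
\<close>

lemma dvd_of_no_common_root:
  fixes p q r :: "'k::alg_closed_field poly"
  assumes "p \<noteq> 0" "p dvd q * r" "\<And>x. poly p x = 0 \<Longrightarrow> poly r x \<noteq> 0"
  shows "p dvd q"
  using assms
proof (induction "degree p" arbitrary: p q)
  case 0
  then show ?case
    by (metis is_unit_iff_degree unit_imp_dvd)
next
  case (Suc d)
  then obtain c where c: "poly p c = 0"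
    using alg_closed_imp_poly_has_root[of p] by auto
  then obtain p' where p': "p = [:-c, 1:] * p'"
    by (metis dvdE poly_eq_0_iff_dvd)
  have "p' \<noteq> 0" using Suc.prems(1) p' by auto
  have "degree p = Suc (degree p')"
    unfolding p' using \<open>p' \<noteq> 0\<close> by (subst degree_mult_eq) auto
  then have d: "d = degree p'" using Suc.hyps(2) by simp
  obtain t where t: "q * r = p * t" using Suc.prems(2) by (elim dvdE)
  have "poly q c * poly r c = 0"
    using c t by (metis mult_zero_left poly_mult)
  then have "poly q c = 0" using Suc.prems(3)[OF c] by simp
  then obtain q' where q': "q = [:-c, 1:] * q'"
    by (metis dvdE poly_eq_0_iff_dvd)
  have "[:-c, 1:] * (q' * r) = [:-c, 1:] * (p' * t)"
    using t unfolding p' q' by (simp only: mult.assoc)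
  then have "q' * r = p' * t"
    by (subst (asm) mult_cancel_left) simp
  then have "p' dvd q' * r" by simp
  moreover have "\<And>x. poly p' x = 0 \<Longrightarrow> poly r x \<noteq> 0"
    using Suc.prems(3) unfolding p' by simp
  ultimately have "p' dvd q'"
    using Suc.hyps(1)[OF d \<open>p' \<noteq> 0\<close>] by blast
  then show ?case unfolding p' q' by (rule mult_dvd_mono[OF dvd_refl])
qed

text \<open>
  A representation whose denominator has the least possible degree is reduced.
\<close>

lemma fract_reduced:
  fixes x :: "'k::field poly fract"
  obtains a b where "b \<noteq> 0" "x = to_fract a / to_fract b"
    "\<And>c. poly a c = 0 \<Longrightarrow> poly b c \<noteq> 0"
proof -
  define Q where "Q = (\<lambda>d. \<exists>a b. b \<noteq> 0 \<and> x = to_fract a / to_fract b \<and> degree b = d)"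
  have "\<exists>d. Q d"
    by (cases x) (auto simp: Q_def Fract_conv_to_fract)
  then have "Q (LEAST d. Q d)" by (rule LeastI_ex)
  then obtain a b where ab: "b \<noteq> 0" "x = to_fract a / to_fract b" "degree b = (LEAST d. Q d)"
    by (auto simp: Q_def)
  have "poly b c \<noteq> 0" if a0: "poly a c = 0" for c
  proof
    assume b0: "poly b c = 0"
    obtain a' b' where a': "a = [:-c, 1:] * a'" and b': "b = [:-c, 1:] * b'"
      using a0 b0 unfolding poly_eq_0_iff_dvd dvd_def by blast
    have "b' \<noteq> 0" using ab(1) b' by auto
    then have "degree b = Suc (degree b')"
      unfolding b' by (subst degree_mult_eq) auto
    moreover have "x = to_fract a' / to_fract b'"
      unfolding ab(2) a' b' to_fract_mult
      by (rule nonzero_mult_divide_mult_cancel_left) simp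
    then have "Q (degree b')" using \<open>b' \<noteq> 0\<close> by (auto simp: Q_def)
    ultimately show False
      using Least_le[of Q "degree b'"] ab(3) by simp
  qed
  then show ?thesis using that[OF ab(1,2)] by blast
qed

lemma card_proots_squarefree:
  fixes p :: "'k::alg_closed_field poly"
  assumes "p \<noteq> 0" "\<And>x. poly p x = 0 \<Longrightarrow> poly (pderiv p) x \<noteq> 0"
  shows "card {x. poly p x = 0} = degree p"
  using assms
proof (induction "degree p" arbitrary: p)
  case 0
  then obtain c where "p = [:c:]" "c \<noteq> 0"
    by (metis degree_eq_zeroE pCons_0_0)
  then show ?case by simp
next
  case (Suc d)
  then obtain c where c: "poly p c = 0"
    using alg_closed_imp_poly_has_root[of p] by auto
  then obtain p' where p': "p = [:-c, 1:] * p'"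
    by (metis dvdE poly_eq_0_iff_dvd)
  have "p' \<noteq> 0" using Suc.prems(1) p' by auto
  have d: "degree p = Suc (degree p')"
    unfolding p' using \<open>p' \<noteq> 0\<close> by (subst degree_mult_eq) auto
  have pd: "poly (pderiv p) x = poly p' x + (x - c) * poly (pderiv p') x" for x
    unfolding p' pderiv_mult by (simp add: pderiv_pCons algebra_simps)
  have nc: "poly p' c \<noteq> 0" using Suc.prems(2)[OF c] pd[of c] by simp
  have "card {x. poly p' x = 0} = degree p'"
  proof (rule Suc.hyps(1))
    show "d = degree p'" using d Suc.hyps(2) by simp
    show "poly (pderiv p') x \<noteq> 0" if "poly p' x = 0" for x
      using Suc.prems(2)[of x] pd[of x] that unfolding p' by auto
  qed fact
  moreover have "{x. poly p x = 0} = insert c {x. poly p' x = 0}"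
    unfolding p' by auto
  moreover have "finite {x. poly p' x = 0}" using \<open>p' \<noteq> 0\<close> by (rule poly_roots_finite)
  ultimately show ?case using nc d by simp
qed

lemma card_nth_roots_alg_closed:
  fixes c :: "'k::alg_closed_field"
  assumes "of_nat n \<noteq> (0::'k)" "c \<noteq> 0"
  shows "card {x. x ^ n = c} = n"
proof -
  have n: "n > 0" using assms(1) by (cases n) auto
  define p where "p = Polynomial.monom 1 n - [:c:]"
  have deg: "degree p = n"
  proof (rule antisym)
    show "degree p \<le> n" unfolding p_def
      by (rule degree_diff_le) (auto simp: degree_monom_le)
    show "n \<le> degree p" using n
      by (intro le_degree) (auto simp: p_def coeff_pCons split: nat.split)
  qed
  have p: "poly p x = x ^ n - c" for x by (simp add: p_def poly_monom)
  have "card {x. poly p x = 0} = degree p"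
  proof (rule card_proots_squarefree)
    show "p \<noteq> 0" using deg n by auto
    fix x assume "poly p x = 0"
    then have "x ^ n = c" by (simp add: p)
    then have "x \<noteq> 0" using assms(2) n by (auto simp: zero_power)
    then show "poly (pderiv p) x \<noteq> 0"
      using assms(1) by (simp add: p_def pderiv_diff pderiv_monom pderiv_pCons poly_monom)
  qed
  then show ?thesis by (simp add: p deg)
qed

lemma finite_nth_roots_field:
  fixes c :: "'k::field"
  assumes "n > 0"
  shows "finite {x. x ^ n = c}"
proof -
  have "Polynomial.monom 1 n - [:c:] \<noteq> 0"
    using assms by (auto simp: poly_eq_iff coeff_pCons split: nat.splits intro!: exI[of _ n])
  from poly_roots_finite[OF this] show ?thesis by (simp add: poly_monom)
qed

lemma infinite_UNIV_alg_closed: "infinite (UNIV :: 'k::alg_closed_field set)"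
proof
  assume fin: "finite (UNIV :: 'k set)"
  define p where "p = (\<Prod>a\<in>(UNIV::'k set). [:-a, 1:]) + 1"
  have "poly p x = 1" for x
    using fin by (simp add: p_def poly_prod)
  moreover have "degree (\<Prod>a\<in>(UNIV::'k set). [:-a, 1:]) = card (UNIV::'k set)"
    by (subst degree_prod_eq_sum_degree) auto
  moreover have "card (UNIV::'k set) > 0" using fin by (simp add: card_gt_0_iff)
  ultimately have "degree p > 0"
    unfolding p_def by (subst degree_add_eq_left) auto
  then show False
    using alg_closed_imp_poly_has_root[of p] \<open>\<And>x. poly p x = 1\<close> by auto
qed

text \<open>
  The field is infinite, so a polynomial identity may be checked away from finitely many points.
\<close>

lemma poly_eq_0_of_cofinite:
  fixes p :: "'k::alg_closed_field poly"
  assumes "finite A" "\<And>x. x \<notin> A \<Longrightarrow> poly p x = 0"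
  shows "p = 0"
proof (rule ccontr)
  assume "p \<noteq> 0"
  then have "finite ({x. poly p x = 0} \<union> A)" using assms(1) poly_roots_finite by blast
  moreover have "{x. poly p x = 0} \<union> A = UNIV" using assms(2) by auto
  ultimately show False using infinite_UNIV_alg_closed by metis
qed

lemma poly_eqI_cofinite:
  fixes p q :: "'k::alg_closed_field poly"
  assumes "finite A" "\<And>x. x \<notin> A \<Longrightarrow> poly p x = poly q x"
  shows "p = q"
  using poly_eq_0_of_cofinite[of A "p - q"] assms by simp

section \<open>The rational function field\<close>

text \<open>
  The field \<open>k(s)\<close> is the type of fractions of polynomials over \<open>k\<close>. Its coordinate \<open>s\<close> is called
  \<open>gen\<close>.
\<close>

definition cst :: "'k::field \<Rightarrow> 'k poly fract" where
  "cst c = to_fract [:c:]"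

definition gen :: "'k::field poly fract" where
  "gen = to_fract [:0, 1:]"

lemma cst_simps [simp]:
  fixes a b :: "'k::field"
  shows "cst (0::'k) = 0" "cst (1::'k) = 1" "cst (a + b) = cst a + cst b" "cst (a * b) = cst a * cst b"
  "cst (- a) = - cst a" "cst (a - b) = cst a - cst b"
  "cst a = cst b \<longleftrightarrow> a = b" "cst a = 0 \<longleftrightarrow> a = 0" "cst a = 1 \<longleftrightarrow> a = 1"
proof -
  have [simp]: "[:1:] = (1::'k poly)" by simp
  show "cst 1 = (1::'k poly fract)" by (simp add: cst_def)
  show "cst a = 1 \<longleftrightarrow> a = 1" 
    unfolding cst_def by (metis pCons_one to_fract_1 to_fract_eq_iff pCons_eq_iff)
qed (simp_all add: cst_def flip: to_fract_add to_fract_mult to_fract_diff to_fract_uminus)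

lemma cst_power [simp]: "cst (a ^ n) = cst a ^ n"
  by (induction n) auto

lemma cst_of_nat [simp]: "cst (of_nat n) = of_nat n"
  by (induction n) auto

lemma cst_inverse [simp]: "cst (inverse a) = inverse (cst a)"
proof (cases "a = 0")
  case False
  then have "cst a * cst (inverse a) = 1" by (simp flip: cst_simps(4))
  then show ?thesis by (metis inverse_unique)
qed simp

lemma cst_divide [simp]: "cst (a / b) = cst a / cst b"
  by (simp add: field_class.field_divide_inverse)

definition ev :: "'k::field poly \<Rightarrow> 'k poly fract \<Rightarrow> 'k poly fract" where
  "ev p x = poly (map_poly cst p) x"

lemma ev_0 [simp]: "ev 0 x = 0" by (simp add: ev_def)
lemma ev_pCons [simp]: "ev (pCons a p) x = cst a + x * ev p x"
  by (simp add: ev_def map_poly_pCons)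
lemma ev_1 [simp]: "ev 1 x = 1" by (simp add: one_pCons)
lemma ev_add [simp]: "ev (p + q) x = ev p x + ev q x"
proof -
  have "map_poly cst (p + q) = map_poly cst p + map_poly cst q"
    by (intro poly_eqI) (simp add: coeff_map_poly)
  then show ?thesis by (simp add: ev_def)
qed
lemma ev_smult [simp]: "ev (smult c p) x = cst c * ev p x"
  by (induction p) (auto simp: algebra_simps)
lemma ev_mult [simp]: "ev (p * q) x = ev p x * ev q x"
  by (induction p) (auto simp: algebra_simps)
lemma ev_uminus [simp]: "ev (- p) x = - ev p x"
  using ev_smult[of "-1" p x] by simp
lemma ev_diff [simp]: "ev (p - q) x = ev p x - ev q x"
  using ev_add[of p "- q" x] by simp
lemma ev_power [simp]: "ev (p ^ n) x = ev p x ^ n"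
  by (induction n) auto
lemma ev_sum: "ev (sum f A) x = (\<Sum>a\<in>A. ev (f a) x)"
  by (induction A rule: infinite_finite_induct) auto
lemma ev_monom [simp]: "ev (Polynomial.monom c n) x = cst c * x ^ n"
  by (induction n) (auto simp: monom_Suc monom_0)
lemma ev_pcompose: "ev (p \<circ>\<^sub>p q) x = ev p (ev q x)"
  by (induction p) (auto simp: pcompose_pCons)
lemma ev_gen [simp]: "ev p gen = to_fract p"
proof (induction p)
  case (pCons a p)
  have "ev (pCons a p) gen = to_fract ([:a:] + [:0, 1:] * p)"
    by (simp only: ev_pCons pCons.IH to_fract_add to_fract_mult) (simp only: cst_def gen_def)
  also have "[:a:] + [:0, 1:] * p = pCons a p" by simp
  finally show ?case .
qed simp

lemma ev_altdef: "ev p x = (\<Sum>i\<le>degree p. cst (coeff p i) * x ^ i)"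
  by (subst poly_as_sum_of_monoms[of p, symmetric]) (simp only: ev_sum ev_monom)

lemma gen_not_cst [simp]: "gen \<noteq> cst c" "cst c \<noteq> gen"
  by (auto simp: gen_def cst_def)

lemma gen_nz [simp]: "gen \<noteq> 0" by (simp add: gen_def)

lemma fract_cases:
  fixes x :: "'k::field poly fract"
  obtains a b where "b \<noteq> 0" "x = ev a gen / ev b gen"
  by (cases x) (auto simp: Fract_conv_to_fract)

text \<open>
  A polynomial over \<open>k\<close> splits into linear factors, so an element algebraic over \<open>k\<close> already lies in
  \<open>k\<close>.
\<close>

lemma ev_eq_0_imp:
  fixes p :: "'k::alg_closed_field poly"
  assumes "ev p x = 0" "p \<noteq> 0"
  shows "x \<in> range cst"
  using assms
proof (induction "degree p" arbitrary: p)
  case 0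
  then obtain c where "p = [:c:]" "c \<noteq> 0"
    by (metis degree_eq_zeroE pCons_0_0)
  then show ?case using 0 by simp
next
  case (Suc d)
  then obtain c where c: "poly p c = 0"
    using alg_closed_imp_poly_has_root[of p] by auto
  then obtain p' where p': "p = [:-c, 1:] * p'"
    by (metis dvdE poly_eq_0_iff_dvd)
  have "p' \<noteq> 0" using Suc.prems p' by auto
  then have "degree p = Suc (degree p')"
    unfolding p' by (subst degree_mult_eq) auto
  moreover have "(x - cst c) * ev p' x = 0"
    using Suc.prems(1) unfolding p' ev_mult by simp
  then have "x = cst c \<or> ev p' x = 0" by simp
  ultimately show ?case using Suc.hyps \<open>p' \<noteq> 0\<close> by auto
qed

subsection \<open>Intermediate fields and endomorphisms\<close>

text \<open>
  Fields between \<open>k\<close> and \<open>k(s)\<close>, in terms of the operations of the type.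
\<close>

definition subfld :: "'k::field poly fract set \<Rightarrow> bool" where
  "subfld T \<longleftrightarrow> range cst \<subseteq> T \<and>
     (\<forall>x\<in>T. \<forall>y\<in>T. x + y \<in> T \<and> x * y \<in> T) \<and> (\<forall>x\<in>T. inverse x \<in> T)"

context
  fixes T :: "'k::field poly fract set"
  assumes T: "subfld T"
begin

lemma subfld_cst: "cst c \<in> T" using T by (auto simp: subfld_def)
lemma subfld_01: "0 \<in> T" "1 \<in> T" using subfld_cst[of 0] subfld_cst[of 1] by simp_all
lemma subfld_add: "x \<in> T \<Longrightarrow> y \<in> T \<Longrightarrow> x + y \<in> T" using T by (auto simp: subfld_def)
lemma subfld_mult: "x \<in> T \<Longrightarrow> y \<in> T \<Longrightarrow> x * y \<in> T" using T by (auto simp: subfld_def)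
lemma subfld_inverse: "x \<in> T \<Longrightarrow> inverse x \<in> T" using T by (auto simp: subfld_def)
lemma subfld_uminus: "x \<in> T \<Longrightarrow> - x \<in> T"
  using subfld_mult[of "cst (-1)" x] subfld_cst[of "-1"] by simp
lemma subfld_diff: "x \<in> T \<Longrightarrow> y \<in> T \<Longrightarrow> x - y \<in> T"
  using subfld_add[of x "- y"] subfld_uminus by simp
lemma subfld_divide: "x \<in> T \<Longrightarrow> y \<in> T \<Longrightarrow> x / y \<in> T"
  using subfld_mult[of x "inverse y"] subfld_inverse by (simp add: divide_inverse)
lemma subfld_power: "x \<in> T \<Longrightarrow> x ^ n \<in> T"
  by (induction n) (auto intro: subfld_01 subfld_mult)
lemma subfld_sum: "(\<And>i. i \<in> I \<Longrightarrow> f i \<in> T) \<Longrightarrow> sum f I \<in> T"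
  by (induction I rule: infinite_finite_induct) (auto intro: subfld_01 subfld_add)
lemma subfld_prod: "(\<And>i. i \<in> I \<Longrightarrow> f i \<in> T) \<Longrightarrow> prod f I \<in> T"
  by (induction I rule: infinite_finite_induct) (auto intro: subfld_01 subfld_mult)
lemma subfld_ev: "x \<in> T \<Longrightarrow> ev p x \<in> T"
  by (induction p) (auto intro: subfld_01 subfld_add subfld_mult subfld_cst)

end

text \<open>
  The field \<open>k(f)\<close>.
\<close>

definition kgen :: "'k::field poly fract \<Rightarrow> 'k poly fract set" where
  "kgen f = {ev N f / ev D f | N D. ev D f \<noteq> 0}"

lemma kgen_self: "f \<in> kgen f"
  unfolding kgen_def by (rule CollectI, rule exI[of _ "[:0,1:]"], rule exI[of _ 1]) simp

lemma kgen_evI: "ev D f \<noteq> 0 \<Longrightarrow> ev N f / ev D f \<in> kgen f"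
  by (auto simp: kgen_def)

lemma subfld_kgen: "subfld (kgen f)"
  unfolding subfld_def
proof (intro conjI ballI)
  show "range cst \<subseteq> kgen f"
  proof (rule image_subsetI)
    fix c show "cst c \<in> kgen f" using kgen_evI[of 1 f "[:c:]"] by simp
  qed
next
  fix x y assume "x \<in> kgen f" "y \<in> kgen f"
  then obtain a b c d where x: "x = ev a f / ev b f" "ev b f \<noteq> 0"
    and y: "y = ev c f / ev d f" "ev d f \<noteq> 0"
    by (auto simp: kgen_def)
  have "x + y = ev (a * d + c * b) f / ev (b * d) f"
    unfolding x(1) y(1) ev_add ev_mult using x(2) y(2) by (rule add_frac_eq)
  then show "x + y \<in> kgen f" using x y kgen_evI[of "b * d" f "a * d + c * b"] by simp
  have "x * y = ev (a * c) f / ev (b * d) f"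
    unfolding x(1) y(1) by simp
  then show "x * y \<in> kgen f" using x y kgen_evI[of "b * d" f "a * c"] by simp
next
  fix x assume "x \<in> kgen f"
  then obtain a b where x: "x = ev a f / ev b f" "ev b f \<noteq> 0"
    by (auto simp: kgen_def)
  show "inverse x \<in> kgen f"
  proof (cases "ev a f = 0")
    case True
    then show ?thesis using x kgen_evI[of 1 f 0] by simp
  next
    case False
    then show ?thesis using x kgen_evI[of a f b] by simp
  qed
qed

lemma kgen_least: "subfld T \<Longrightarrow> f \<in> T \<Longrightarrow> kgen f \<subseteq> T"
  by (auto simp: kgen_def intro!: subfld_divide subfld_ev)

lemma kgen_mono: "f \<in> kgen g \<Longrightarrow> kgen f \<subseteq> kgen g"
  by (rule kgen_least[OF subfld_kgen])

lemma kgen_gen: "kgen gen = UNIV"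
proof -
  have "x \<in> kgen gen" for x :: "'a poly fract"
    by (rule fract_cases[of x]) (auto intro!: kgen_evI simp del: ev_gen, simp)
  then show ?thesis by auto
qed

lemma subfld_gen_UNIV: "subfld T \<Longrightarrow> gen \<in> T \<Longrightarrow> T = UNIV"
  using kgen_least[of T gen] by (auto simp: kgen_gen)

text \<open>
  Field embeddings of \<open>k(s)\<close> into itself over \<open>k\<close>.
\<close>

definition k_endo :: "('k::field poly fract \<Rightarrow> 'k poly fract) \<Rightarrow> bool" where
  "k_endo \<sigma> \<longleftrightarrow> (\<forall>x y. \<sigma> (x + y) = \<sigma> x + \<sigma> y) \<and> (\<forall>x y. \<sigma> (x * y) = \<sigma> x * \<sigma> y) \<and>
     (\<forall>c. \<sigma> (cst c) = cst c)"

context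
  fixes \<sigma> :: "'k::field poly fract \<Rightarrow> 'k poly fract"
  assumes \<sigma>: "k_endo \<sigma>"
begin

lemma k_endo_cst: "\<sigma> (cst c) = cst c" using \<sigma> by (auto simp: k_endo_def)
lemma k_endo_01: "\<sigma> 0 = 0" "\<sigma> 1 = 1" using k_endo_cst[of 0] k_endo_cst[of 1] by simp_all
lemma k_endo_add: "\<sigma> (x + y) = \<sigma> x + \<sigma> y" using \<sigma> by (auto simp: k_endo_def)
lemma k_endo_mult: "\<sigma> (x * y) = \<sigma> x * \<sigma> y" using \<sigma> by (auto simp: k_endo_def)
lemma k_endo_uminus: "\<sigma> (- x) = - \<sigma> x"
  using k_endo_mult[of "cst (-1)" x] k_endo_cst[of "-1"] by simp
lemma k_endo_diff: "\<sigma> (x - y) = \<sigma> x - \<sigma> y"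
  using k_endo_add[of x "- y"] k_endo_uminus by simp
lemma k_endo_power: "\<sigma> (x ^ n) = \<sigma> x ^ n"
  by (induction n) (auto simp: k_endo_01 k_endo_mult)
lemma k_endo_inverse: "\<sigma> (inverse x) = inverse (\<sigma> x)"
proof (cases "x = 0")
  case False
  then have "\<sigma> x * \<sigma> (inverse x) = 1"
    using k_endo_mult[of x "inverse x"] by (simp add: k_endo_01)
  then show ?thesis by (metis inverse_unique)
qed (simp add: k_endo_01)
lemma k_endo_divide: "\<sigma> (x / y) = \<sigma> x / \<sigma> y"
  by (simp add: divide_inverse k_endo_mult k_endo_inverse)
lemma k_endo_ev: "\<sigma> (ev p x) = ev p (\<sigma> x)"
  by (induction p) (auto simp: k_endo_01 k_endo_add k_endo_mult k_endo_cst)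
lemma k_endo_to_fract: "\<sigma> (to_fract p) = ev p (\<sigma> gen)"
  using k_endo_ev[of p gen] by simp
lemma k_endo_eq_0: "\<sigma> x = 0 \<longleftrightarrow> x = 0"
proof
  assume "\<sigma> x = 0"
  show "x = 0"
  proof (rule ccontr)
    assume "x \<noteq> 0"
    then have "\<sigma> x * \<sigma> (inverse x) = 1"
      using k_endo_mult[of x "inverse x"] by (simp add: k_endo_01)
    then show False using \<open>\<sigma> x = 0\<close> by simp
  qed
qed (simp add: k_endo_01)
lemma k_endo_inj: "\<sigma> x = \<sigma> y \<longleftrightarrow> x = y"
  using k_endo_eq_0[of "x - y"] by (simp add: k_endo_diff)
lemma subfld_fixed: "subfld {x. \<sigma> x = x}"
  by (auto simp: subfld_def k_endo_cst k_endo_add k_endo_mult k_endo_inverse)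

end

lemma k_endo_comp: "k_endo \<sigma> \<Longrightarrow> k_endo \<tau> \<Longrightarrow> k_endo (\<sigma> \<circ> \<tau>)"
  by (auto simp: k_endo_def)

lemma k_endo_id: "k_endo id" by (auto simp: k_endo_def)

lemma k_endo_eqI:
  fixes \<sigma> \<tau> :: "'a::field poly fract \<Rightarrow> 'a poly fract"
  assumes "k_endo \<sigma>" "k_endo \<tau>" "\<sigma> gen = \<tau> gen"
  shows "\<sigma> = \<tau>"
proof
  fix x :: "'a poly fract"
  obtain a b where x: "x = ev a gen / ev b gen" by (rule fract_cases)
  show "\<sigma> x = \<tau> x"
    unfolding x k_endo_divide[OF assms(1)] k_endo_divide[OF assms(2)]
      k_endo_ev[OF assms(1)] k_endo_ev[OF assms(2)] assms(3) ..
qed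

lemma k_endo_fixes_kgen: "k_endo \<sigma> \<Longrightarrow> (\<forall>x\<in>kgen f. \<sigma> x = x) \<longleftrightarrow> \<sigma> f = f"
  using kgen_least[OF subfld_fixed, of \<sigma> f] kgen_self[of f] by blast

text \<open>
  The substitution of \<open>r\<close> for \<open>s\<close>. For \<open>r\<close> outside \<open>k\<close> it is well defined, because then no nonzero
  polynomial over \<open>k\<close> vanishes at \<open>r\<close>.
\<close>

definition subst_gen :: "'k::field poly fract \<Rightarrow> 'k poly fract \<Rightarrow> 'k poly fract" where
  "subst_gen r x =
     (THE y. \<exists>a b. b \<noteq> 0 \<and> x = ev a gen / ev b gen \<and> y = ev a r / ev b r)"

context
  fixes r :: "'k::alg_closed_field poly fract"
  assumes r: "r \<notin> range cst"
begin

lemma subst_gen_quot: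
  assumes "b \<noteq> 0"
  shows "subst_gen r (ev a gen / ev b gen) = ev a r / ev b r"
  unfolding subst_gen_def
proof (rule the_equality)
  show "\<exists>a' b'. b' \<noteq> 0 \<and> ev a gen / ev b gen = ev a' gen / ev b' gen \<and>
          ev a r / ev b r = ev a' r / ev b' r"
    using assms by blast
next
  have nz: "ev p r \<noteq> 0" if "p \<noteq> 0" for p using ev_eq_0_imp[of p r] r that by blast
  fix y assume "\<exists>a' b'. b' \<noteq> 0 \<and> ev a gen / ev b gen = ev a' gen / ev b' gen \<and> y = ev a' r / ev b' r"
  then obtain a' b' where *: "b' \<noteq> 0" "to_fract a / to_fract b = to_fract a' / to_fract b'"
    "y = ev a' r / ev b' r" by auto
  then have "to_fract (a * b') = to_fract (a' * b)"
    using assms by (simp add: field_simps)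
  then have "a * b' = a' * b" by (simp only: to_fract_eq_iff)
  then have "ev a r * ev b' r = ev a' r * ev b r" by (metis ev_mult)
  then show "y = ev a r / ev b r"
    unfolding *(3) using nz[OF assms] nz[OF *(1)] by (simp add: frac_eq_eq)
qed

lemma subst_gen_gen: "subst_gen r gen = r"
  using subst_gen_quot[of 1 "[:0,1:]"] by (simp add: gen_def)

lemma k_endo_subst_gen: "k_endo (subst_gen r)"
  unfolding k_endo_def
proof (intro conjI allI)
  have nz: "ev p r \<noteq> 0" if "p \<noteq> 0" for p using ev_eq_0_imp[of p r] r that by blast
  fix x y :: "'k poly fract"
  obtain a b where x: "b \<noteq> 0" "x = ev a gen / ev b gen" by (rule fract_cases)
  obtain c d where y: "d \<noteq> 0" "y = ev c gen / ev d gen" by (rule fract_cases)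
  have "x + y = ev (a * d + c * b) gen / ev (b * d) gen"
    unfolding x(2) y(2) ev_add ev_mult by (rule add_frac_eq) (use x(1) y(1) in auto)
  then have "subst_gen r (x + y) = ev (a * d + c * b) r / ev (b * d) r"
    using x(1) y(1) by (simp only: subst_gen_quot mult_eq_0_iff de_Morgan_disj simp_thms)
  also have "\<dots> = ev a r / ev b r + ev c r / ev d r"
    unfolding ev_add ev_mult using nz[OF x(1)] nz[OF y(1)] by (rule add_frac_eq[symmetric])
  finally show "subst_gen r (x + y) = subst_gen r x + subst_gen r y"
    unfolding x(2) y(2) subst_gen_quot[OF x(1)] subst_gen_quot[OF y(1)] .
  have "x * y = ev (a * c) gen / ev (b * d) gen"
    unfolding x(2) y(2) by simp
  then have "subst_gen r (x * y) = ev (a * c) r / ev (b * d) r"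
    using x(1) y(1) by (simp only: subst_gen_quot mult_eq_0_iff de_Morgan_disj simp_thms)
  also have "\<dots> = ev a r / ev b r * (ev c r / ev d r)"
    by simp
  finally show "subst_gen r (x * y) = subst_gen r x * subst_gen r y"
    unfolding x(2) y(2) subst_gen_quot[OF x(1)] subst_gen_quot[OF y(1)] .
next
  fix c show "subst_gen r (cst c) = cst c"
    using subst_gen_quot[of 1 "[:c:]"] by (simp add: cst_def)
qed

end

section \<open>Polynomials in several variables\<close>

lemma mpoly_sum_monomials:
  "(\<Sum>m\<in>Poly_Mapping.keys F. Poly_Mapping.single m (Poly_Mapping.lookup F m)) = F"
proof (rule poly_mapping_eqI)
  fix m
  have "Poly_Mapping.lookup (\<Sum>m\<in>Poly_Mapping.keys F. Poly_Mapping.single m (Poly_Mapping.lookup F m)) m =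
    (\<Sum>m'\<in>Poly_Mapping.keys F. if m' = m then Poly_Mapping.lookup F m else 0)"
    by (auto simp: lookup_sum lookup_single when_def intro!: sum.cong)
  then show "Poly_Mapping.lookup (\<Sum>m\<in>Poly_Mapping.keys F. Poly_Mapping.single m (Poly_Mapping.lookup F m)) m = Poly_Mapping.lookup F m"
    by (auto simp: in_keys_iff)
qed

text \<open>
  The same rules are used for four coefficient maps: into \<open>k\<close> for the values at points, into \<open>k[s]\<close>
  and \<open>k(s)\<close> for the values along a parametrized curve, and into forms for linear substitutions.
\<close>

locale coeff_hom =
  fixes h :: "'k::field \<Rightarrow> 'r::comm_ring_1"
  assumes hom_0: "h 0 = 0" and hom_1: "h 1 = 1"
    and hom_add: "h (a + b) = h a + h b" and hom_mult: "h (a * b) = h a * h b"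
begin

lemma hom_uminus: "h (- a) = - h a"
  using hom_add[of a "- a"] hom_0 by (simp add: eq_neg_iff_add_eq_0 add.commute)

lemma mp_eval_superset:
  assumes "finite A" "Poly_Mapping.keys F \<subseteq> A"
  shows "mp_eval h x F = (\<Sum>m\<in>A. h (Poly_Mapping.lookup F m) *
           (\<Prod>i\<in>UNIV. x i ^ Poly_Mapping.lookup m i))"
  unfolding mp_eval_def using assms
  by (intro sum.mono_neutral_left) (auto simp: in_keys_iff hom_0)

lemma mp_eval_0 [simp]: "mp_eval h x 0 = 0" by (simp add: mp_eval_def)

lemma mp_eval_single: "mp_eval h x (Poly_Mapping.single m c) = h c * (\<Prod>i\<in>UNIV. x i ^ Poly_Mapping.lookup m i)"
  by (subst mp_eval_superset[of "{m}"]) auto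

lemma mp_eval_const: "mp_eval h x (Poly_Mapping.single 0 c) = h c"
  by (simp add: mp_eval_single)

lemma mp_eval_1 [simp]: "mp_eval h x 1 = 1"
  using mp_eval_const[of x 1] hom_1 by simp

lemma mp_eval_var: "mp_eval h x (Poly_Mapping.single (Poly_Mapping.single i 1) c) = h c * x i"
proof -
  have "(\<Prod>j\<in>UNIV. x j ^ Poly_Mapping.lookup (Poly_Mapping.single i (1::nat)) j) =
        (\<Prod>j\<in>UNIV. if j = i then x i else 1)"
    by (intro prod.cong) (auto simp: lookup_single when_def)
  then show ?thesis by (simp add: mp_eval_single)
qed

lemma mp_eval_add: "mp_eval h x (F + G) = mp_eval h x F + mp_eval h x G"
proof -
  let ?A = "Poly_Mapping.keys F \<union> Poly_Mapping.keys G"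
  have "Poly_Mapping.keys (F + G) \<subseteq> ?A" by (rule Poly_Mapping.keys_add)
  then show ?thesis
    using mp_eval_superset[of ?A "F + G"] mp_eval_superset[of ?A F] mp_eval_superset[of ?A G]
    by (simp add: lookup_add hom_add sum.distrib algebra_simps)
qed

lemma mp_eval_uminus: "mp_eval h x (- F) = - mp_eval h x F"
  by (simp add: mp_eval_def keys_minus hom_uminus sum_negf)

lemma mp_eval_diff: "mp_eval h x (F - G) = mp_eval h x F - mp_eval h x G"
  using mp_eval_add[of x F "- G"] mp_eval_uminus[of x G] by simp

lemma mp_eval_sum: "mp_eval h x (sum f A) = (\<Sum>a\<in>A. mp_eval h x (f a))"
  by (induction A rule: infinite_finite_induct) (auto simp: mp_eval_add)

lemma mp_eval_mult: "mp_eval h x (F * G) = mp_eval h x F * mp_eval h x G"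
proof -
  let ?s = "\<lambda>F m. Poly_Mapping.single m (Poly_Mapping.lookup F m)"
  have F: "F = (\<Sum>m\<in>Poly_Mapping.keys F. ?s F m)" and G: "G = (\<Sum>m\<in>Poly_Mapping.keys G. ?s G m)"
    by (simp_all only: mpoly_sum_monomials)
  have ss: "mp_eval h x (Poly_Mapping.single m a * Poly_Mapping.single m' b) =
     mp_eval h x (Poly_Mapping.single m a) * mp_eval h x (Poly_Mapping.single m' b)" for m m' a b
    by (simp add: mult_single mp_eval_single hom_mult lookup_add power_add prod.distrib)
  have "mp_eval h x (F * G) = mp_eval h x ((\<Sum>m\<in>Poly_Mapping.keys F. ?s F m) * (\<Sum>m\<in>Poly_Mapping.keys G. ?s G m))"
    using F G by simp
  also have "\<dots> = mp_eval h x (\<Sum>m\<in>Poly_Mapping.keys F. ?s F m) * mp_eval h x (\<Sum>m\<in>Poly_Mapping.keys G. ?s G m)"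
    by (simp add: sum_product mp_eval_sum ss)
  finally show ?thesis using F G by simp
qed

lemma hom_mp_eval:
  fixes g :: "'r \<Rightarrow> 's::comm_ring_1"
  assumes g: "g 0 = 0" "g 1 = 1" "\<And>a b. g (a + b) = g a + g b" "\<And>a b. g (a * b) = g a * g b"
  shows "g (mp_eval h x F) = mp_eval (\<lambda>c. g (h c)) (\<lambda>i. g (x i)) F"
proof -
  have s: "g (sum f A) = (\<Sum>a\<in>A. g (f a))" for f :: "'z \<Rightarrow> 'r" and A
    by (induction A rule: infinite_finite_induct) (auto simp: g)
  have p: "g (prod f A) = (\<Prod>a\<in>A. g (f a))" for f :: "'z \<Rightarrow> 'r" and A
    by (induction A rule: infinite_finite_induct) (auto simp: g)
  have w: "g (a ^ n) = g a ^ n" for a n by (induction n) (auto simp: g)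
  show ?thesis by (simp add: mp_eval_def s p w g)
qed

lemma mp_eval_homogeneous:
  assumes "homogeneous d F"
  shows "mp_eval h (\<lambda>i. t * x i) F = t ^ d * mp_eval h x F"
proof -
  have "(\<Prod>i\<in>UNIV. (t * x i) ^ Poly_Mapping.lookup m i) =
        t ^ d * (\<Prod>i\<in>UNIV. x i ^ Poly_Mapping.lookup m i)" if "m \<in> Poly_Mapping.keys F" for m
  proof -
    have "(\<Sum>i\<in>UNIV. Poly_Mapping.lookup m i) = d"
      using assms that by (auto simp: homogeneous_def)
    then show ?thesis
      by (simp add: power_mult_distrib prod.distrib flip: power_sum)
  qed
  then show ?thesis
    unfolding mp_eval_def sum_distrib_left by (intro sum.cong) (auto simp: algebra_simps)
qed

lemma mp_eval_linear:
  assumes "homogeneous 1 F"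
  shows "mp_eval h x F = (\<Sum>i\<in>UNIV. h (Poly_Mapping.lookup F (Poly_Mapping.single i 1)) * x i)"
proof -
  let ?S = "\<lambda>i. Poly_Mapping.single i (1::nat)"
  have "Poly_Mapping.keys F \<subseteq> range ?S"
  proof
    fix m assume "m \<in> Poly_Mapping.keys F"
    then have s: "(\<Sum>i\<in>UNIV. Poly_Mapping.lookup m i) = 1"
      using assms by (auto simp: homogeneous_def)
    then obtain i where i: "Poly_Mapping.lookup m i \<noteq> 0"
      by (metis sum.neutral zero_neq_one)
    have "Poly_Mapping.lookup m i + (\<Sum>j\<in>UNIV - {i}. Poly_Mapping.lookup m j) = 1"
      using s sum.remove[of UNIV i "Poly_Mapping.lookup m"] by simp
    then have "Poly_Mapping.lookup m i = 1" and z: "(\<Sum>j\<in>UNIV - {i}. Poly_Mapping.lookup m j) = 0"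
      using i by linarith+
    then have "m = ?S i"
      by (intro poly_mapping_eqI) (auto simp: lookup_single when_def)
    then show "m \<in> range ?S" by simp
  qed
  then have "mp_eval h x F = (\<Sum>m\<in>range ?S. h (Poly_Mapping.lookup F m) * (\<Prod>i\<in>UNIV. x i ^ Poly_Mapping.lookup m i))"
    by (intro mp_eval_superset) auto
  also have "\<dots> = (\<Sum>i\<in>UNIV. h (Poly_Mapping.lookup F (?S i)) * (\<Prod>j\<in>UNIV. x j ^ Poly_Mapping.lookup (?S i) j))"
    by (subst sum.reindex) (auto simp: inj_on_def dest!: arg_cong[where f = "\<lambda>m. Poly_Mapping.lookup m _"]
        simp: lookup_single when_def split: if_splits)
  also have "\<dots> = (\<Sum>i\<in>UNIV. h (Poly_Mapping.lookup F (?S i)) * x i)"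
  proof (rule sum.cong[OF HOL.refl])
    fix i
    have "(\<Prod>j\<in>UNIV. x j ^ Poly_Mapping.lookup (?S i) j) = (\<Prod>j\<in>UNIV. if j = i then x i else 1)"
      by (intro prod.cong) (auto simp: lookup_single when_def)
    then show "h (Poly_Mapping.lookup F (?S i)) * (\<Prod>j\<in>UNIV. x j ^ Poly_Mapping.lookup (?S i) j) =
       h (Poly_Mapping.lookup F (?S i)) * x i" by simp
  qed
  finally show ?thesis .
qed

end

interpretation id_hom: coeff_hom "id :: 'k::field \<Rightarrow> 'k" by unfold_locales auto
interpretation cst_hom: coeff_hom "cst :: 'k::field \<Rightarrow> 'k poly fract" by unfold_locales auto
interpretation pc_hom: coeff_hom "\<lambda>c::'k::field. [:c:]" by unfold_locales auto
interpretation mc_hom: coeff_hom "Poly_Mapping.single 0 :: 'k::field \<Rightarrow> ('k, 'n::finite) mpoly"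
  by unfold_locales (auto simp: single_add mult_single)

lemma (in coeff_hom) mp_eval_subst:
  "mp_eval h x (mp_subst L A) = mp_eval h (\<lambda>i. mp_eval h x (L i)) A"
  unfolding mp_subst_def
  by (subst mc_hom.hom_mp_eval) (auto simp: mp_eval_add mp_eval_mult mp_eval_const)

abbreviation mp_poly :: "('n::finite \<Rightarrow> 'k::field poly) \<Rightarrow> ('k, 'n) mpoly \<Rightarrow> 'k poly" where
  "mp_poly \<equiv> mp_eval (\<lambda>c. [:c:])"

lemma poly_mp_poly: "poly (mp_poly l F) a = mp_eval id (\<lambda>i. poly (l i) a) F"
  by (subst pc_hom.hom_mp_eval) (auto simp: id_def)

lemma to_fract_mp_poly: "to_fract (mp_poly l F) = mp_eval cst (\<lambda>i. to_fract (l i)) F"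
proof -
  have "cst = (\<lambda>c::'a. to_fract [:c:])" by (simp add: cst_def fun_eq_iff)
  then show ?thesis by (subst pc_hom.hom_mp_eval) auto
qed

subsection \<open>Forms\<close>

lemma homogeneous_0 [simp]: "homogeneous d 0" by (simp add: homogeneous_def)

lemma homogeneous_add: "homogeneous d F \<Longrightarrow> homogeneous d G \<Longrightarrow> homogeneous d (F + G)"
  using Poly_Mapping.keys_add[of F G] by (auto simp: homogeneous_def)

lemma homogeneous_diff: "homogeneous d F \<Longrightarrow> homogeneous d G \<Longrightarrow> homogeneous d (F - G)"
  using keys_diff[of F G] by (auto simp: homogeneous_def)

lemma homogeneous_sum: "(\<And>a. a \<in> A \<Longrightarrow> homogeneous d (f a)) \<Longrightarrow> homogeneous d (sum f A)"
  by (induction A rule: infinite_finite_induct) (auto intro: homogeneous_add)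

lemma homogeneous_mult: "homogeneous d F \<Longrightarrow> homogeneous e G \<Longrightarrow> homogeneous (d + e) (F * G)"
  using keys_mult[of F G] by (fastforce simp: homogeneous_def lookup_add sum.distrib)

lemma homogeneous_single: "(\<Sum>i\<in>UNIV. Poly_Mapping.lookup m i) = d \<Longrightarrow> homogeneous d (Poly_Mapping.single m c)"
  by (cases "c = 0") (auto simp: homogeneous_def)

lemma homogeneous_const: "homogeneous 0 (Poly_Mapping.single 0 c)"
  by (rule homogeneous_single) simp

lemma homogeneous_1: "homogeneous 0 1"
  using homogeneous_const[of 1] by simp

lemma homogeneous_power: "homogeneous d F \<Longrightarrow> homogeneous (n * d) (F ^ n)"
  by (induction n) (auto intro: homogeneous_1 homogeneous_mult)

lemma homogeneous_prod:
  "(\<And>a. a \<in> A \<Longrightarrow> homogeneous (d a) (f a)) \<Longrightarrow> homogeneous (\<Sum>a\<in>A. d a) (prod f A)"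
  by (induction A rule: infinite_finite_induct) (auto intro: homogeneous_1 homogeneous_mult)

lemma homogeneous_var: "homogeneous 1 (Poly_Mapping.single (Poly_Mapping.single i 1) c)"
proof (rule homogeneous_single)
  have "(\<Sum>j\<in>UNIV. Poly_Mapping.lookup (Poly_Mapping.single i (1::nat)) j) = (\<Sum>j\<in>UNIV. if j = i then 1 else 0)"
    by (intro sum.cong) (auto simp: lookup_single when_def)
  then show "(\<Sum>j\<in>UNIV. Poly_Mapping.lookup (Poly_Mapping.single i (1::nat)) j) = 1" by simp
qed

lemma homogeneous_subst:
  assumes "homogeneous d A" "\<And>i. homogeneous 1 (L i)"
  shows "homogeneous d (mp_subst L A)"
  unfolding mp_subst_def mp_eval_def
proof (rule homogeneous_sum)
  fix m assume m: "m \<in> Poly_Mapping.keys A"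
  have "homogeneous (\<Sum>i\<in>UNIV. Poly_Mapping.lookup m i) (\<Prod>i\<in>UNIV. L i ^ Poly_Mapping.lookup m i)"
    using homogeneous_power[OF assms(2)] by (intro homogeneous_prod) simp
  then have "homogeneous d (\<Prod>i\<in>UNIV. L i ^ Poly_Mapping.lookup m i)"
    using assms(1) m by (simp add: homogeneous_def)
  then show "homogeneous d (Poly_Mapping.single 0 (Poly_Mapping.lookup A m) * (\<Prod>i\<in>UNIV. L i ^ Poly_Mapping.lookup m i))"
    using homogeneous_mult[OF homogeneous_const] by fastforce
qed

lemma homogeneous_0_imp_const:
  assumes "homogeneous 0 F"
  shows "F = Poly_Mapping.single 0 (Poly_Mapping.lookup F 0)"
proof (rule poly_mapping_eqI)
  fix m
  have "m = 0" if "m \<in> Poly_Mapping.keys F"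
    using assms that by (intro poly_mapping_eqI) (auto simp: homogeneous_def)
  then show "Poly_Mapping.lookup F m = Poly_Mapping.lookup (Poly_Mapping.single 0 (Poly_Mapping.lookup F 0)) m"
    by (auto simp: lookup_single when_def in_keys_iff)
qed

lemma proj_pt_self: "v \<in> proj_pt v"
  unfolding proj_pt_def by (rule CollectI, rule exI[of _ 1]) simp

lemma vanishes_at_proj_pt:
  assumes "homogeneous d F"
  shows "vanishes_at F (proj_pt v) \<longleftrightarrow> mp_eval id (vec_nth v) F = 0"
proof -
  have "mp_eval id (vec_nth (c *s v)) F = c ^ d * mp_eval id (vec_nth v) F" for c
  proof -
    have "vec_nth (c *s v) = (\<lambda>i. c * vec_nth v i)" by (simp add: fun_eq_iff vector_scalar_mult_def)
    then show ?thesis using id_hom.mp_eval_homogeneous[OF assms, of c "vec_nth v"] by simp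
  qed
  then show ?thesis
    using proj_pt_self[of v] unfolding vanishes_at_def by (auto simp: proj_pt_def)
qed

subsection \<open>Partial derivatives\<close>

lemma (in coeff_hom) mp_eval_pderiv:
  "mp_eval h x (mp_pderiv i F) =
    (\<Sum>m\<in>Poly_Mapping.keys F. h (of_nat (Poly_Mapping.lookup m i) * Poly_Mapping.lookup F m) *
       (x i ^ (Poly_Mapping.lookup m i - 1) * (\<Prod>j\<in>UNIV - {i}. x j ^ Poly_Mapping.lookup m j)))"
proof -
  have "(\<Prod>j\<in>UNIV. x j ^ Poly_Mapping.lookup (m - Poly_Mapping.single i 1) j) =
     x i ^ (Poly_Mapping.lookup m i - 1) * (\<Prod>j\<in>UNIV - {i}. x j ^ Poly_Mapping.lookup m j)" for m
    by (subst prod.remove[of UNIV i]) (auto simp: lookup_minus lookup_single when_def intro!: prod.cong)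
  then show ?thesis by (simp add: mp_pderiv_def mp_eval_sum mp_eval_single)
qed

text \<open>
  The chain rule, from which all statements about tangents follow.
\<close>

lemma pderiv_mp_poly:
  fixes F :: "('a::field, 'n::finite) mpoly"
  shows "pderiv (mp_poly l F) = (\<Sum>i\<in>UNIV. mp_poly l (mp_pderiv i F) * pderiv (l i))"
proof -
  have m: "pderiv ([:a:] * (\<Prod>i\<in>UNIV. l i ^ Poly_Mapping.lookup m i)) =
     (\<Sum>i\<in>UNIV. [:of_nat (Poly_Mapping.lookup m i) * a:] *
       (l i ^ (Poly_Mapping.lookup m i - 1) * (\<Prod>j\<in>UNIV - {i}. l j ^ Poly_Mapping.lookup m j)) * pderiv (l i))" for a m
  proof -
    have "pderiv ([:a:] * (\<Prod>i\<in>UNIV. l i ^ Poly_Mapping.lookup m i)) =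
        [:a:] * pderiv (\<Prod>i\<in>UNIV. l i ^ Poly_Mapping.lookup m i)"
      by (simp add: pderiv_smult)
    also have "\<dots> = (\<Sum>i\<in>UNIV. [:a:] * ((\<Prod>j\<in>UNIV - {i}. l j ^ Poly_Mapping.lookup m j) *
        pderiv (l i ^ Poly_Mapping.lookup m i)))"
      by (simp only: pderiv_prod sum_distrib_left)
    finally show ?thesis by (simp add: pderiv_power algebra_simps)
  qed
  have pd: "pderiv (sum f A) = (\<Sum>a\<in>A. pderiv (f a))" for f :: "'z \<Rightarrow> 'a poly" and A
    by (induction A rule: infinite_finite_induct) (auto simp: pderiv_add)
  show ?thesis
    unfolding pc_hom.mp_eval_pderiv sum_distrib_right
    by (subst sum.swap) (simp only: mp_eval_def m pd)
qed

text \<open>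
  Euler's identity: differentiate \<open>F (T v) = T\<^sup>d F v\<close> with respect to \<open>T\<close> and put \<open>T = 1\<close>.
\<close>

lemma euler_homogeneous:
  fixes F :: "('a::field, 'n::finite) mpoly"
  assumes "homogeneous d F"
  shows "(\<Sum>i\<in>UNIV. mp_eval id v (mp_pderiv i F) * v i) = of_nat d * mp_eval id v F"
proof -
  define T :: "'a poly" where "T = [:0, 1:]"
  have e: "mp_poly (\<lambda>i. T * [:v i:]) F = T ^ d * mp_poly (\<lambda>i. [:v i:]) F"
    by (rule pc_hom.mp_eval_homogeneous[OF assms])
  have c: "mp_poly (\<lambda>i. [:v i:]) F = [:mp_eval id v F:]"
    by (subst id_hom.hom_mp_eval[where g = "\<lambda>c. [:c:]"]) auto
  have "poly (pderiv (mp_poly (\<lambda>i. T * [:v i:]) F)) 1 = of_nat d * mp_eval id v F"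
    unfolding e c by (simp add: T_def pderiv_mult pderiv_power pderiv_pCons pderiv_smult)
  moreover have "poly (pderiv (mp_poly (\<lambda>i. T * [:v i:]) F)) 1 =
      (\<Sum>i\<in>UNIV. mp_eval id v (mp_pderiv i F) * v i)"
    unfolding pderiv_mp_poly by (simp add: poly_sum poly_mp_poly T_def pderiv_pCons mult.commute)
  ultimately show ?thesis by simp
qed

subsection \<open>Factors of forms\<close>

lemma monom_factor:
  fixes p r :: "'a::idom poly"
  assumes "p * r = Polynomial.monom c d" "c \<noteq> 0"
  shows "\<exists>a i. p = Polynomial.monom a i"
proof -
  have nz: "p \<noteq> 0" "r \<noteq> 0" using assms by auto
  have mo: "Polynomial.order 0 (Polynomial.monom c d) = d" using assms(2) by (simp add: order_0_monom)
  have le: "Polynomial.order 0 p \<le> degree p" "Polynomial.order 0 r \<le> degree r"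
    using nz by (simp_all add: order_degree)
  have "Polynomial.order 0 p + Polynomial.order 0 r = d"
    using order_mult[of p r 0] nz assms mo by simp
  moreover have "degree p + degree r = d"
    using degree_mult_eq[OF nz] assms by (simp add: degree_monom_eq)
  ultimately have o: "Polynomial.order 0 p = degree p" using le by linarith
  obtain s where s: "p = [:- 0, 1:] ^ degree p * s"
    using order_decomp[OF nz(1), of 0] o by metis
  have "s \<noteq> 0" using nz s by auto
  then have "degree p = degree p + degree s"
    by (subst s) (simp add: degree_mult_eq degree_power_eq)
  then obtain a where "s = [:a:]" by (metis add_cancel_right_right degree_eq_zeroE)
  then have "p = Polynomial.monom a (degree p)"
    using s by (simp add: monom_altdef mult.commute)
  then show ?thesis by blast
qed

text \<open>
  Replace every variable \<open>X\<^sub>i\<close> by \<open>T X\<^sub>i\<close>. The image of a form is a monomial in \<open>T\<close>, and over a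
  domain the factors of a monomial are monomials.
\<close>

lemma homogeneous_factor:
  fixes A B :: "('k::field, 'n::{finite, linorder}) mpoly"
  assumes "homogeneous d (A * B)" "A * B \<noteq> 0"
  shows "\<exists>i. homogeneous i A"
proof -
  define h :: "'k \<Rightarrow> ('k, 'n) mpoly poly" where "h = (\<lambda>c. [:Poly_Mapping.single 0 c:])"
  interpret h: coeff_hom h
    by unfold_locales (simp_all add: h_def one_pCons mc_hom.hom_add mc_hom.hom_mult)
  define var :: "'n \<Rightarrow> ('k, 'n) mpoly poly" where
    "var = (\<lambda>i. [:Poly_Mapping.single (Poly_Mapping.single i 1) 1:])"
  define T :: "('k, 'n) mpoly poly" where "T = [:0, 1:]"
  have mon: "h a * (\<Prod>i\<in>UNIV. var i ^ Poly_Mapping.lookup m i) = [:Poly_Mapping.single m a:]" for a m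
  proof -
    have pw: "var i ^ n = [:Poly_Mapping.single (Poly_Mapping.single i n) 1:]" for i n
      by (induction n) (auto simp: var_def one_pCons mult_single single_add[symmetric] add.commute)
    have pr: "(\<Prod>i\<in>I. var i ^ f i) = [:Poly_Mapping.single (\<Sum>i\<in>I. Poly_Mapping.single i (f i)) 1:]" if "finite I" for I f
      using that by (induction I rule: finite_induct) (auto simp: pw mult_single one_pCons add.commute)
    have "(\<Sum>i\<in>UNIV. Poly_Mapping.single i (Poly_Mapping.lookup m i)) = m"
      by (rule poly_mapping_eqI) (simp add: lookup_sum lookup_single when_def)
    then show ?thesis by (simp add: pr h_def mult_single)
  qed
  define E where "E = (\<lambda>F. mp_eval h (\<lambda>i. T * var i) F)"
  have ET: "E F = (\<Sum>m\<in>Poly_Mapping.keys F. Polynomial.monom (Poly_Mapping.single m (Poly_Mapping.lookup F m)) (\<Sum>i\<in>UNIV. Poly_Mapping.lookup m i))" for F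
    unfolding E_def mp_eval_def
  proof (rule sum.cong[OF HOL.refl])
    fix m
    have "h (Poly_Mapping.lookup F m) * (\<Prod>i\<in>UNIV. (T * var i) ^ Poly_Mapping.lookup m i) =
      T ^ (\<Sum>i\<in>UNIV. Poly_Mapping.lookup m i) * (h (Poly_Mapping.lookup F m) * (\<Prod>i\<in>UNIV. var i ^ Poly_Mapping.lookup m i))"
      by (simp add: power_mult_distrib prod.distrib power_sum algebra_simps)
    also have "\<dots> = Polynomial.monom (Poly_Mapping.single m (Poly_Mapping.lookup F m)) (\<Sum>i\<in>UNIV. Poly_Mapping.lookup m i)"
      unfolding mon by (simp add: T_def monom_altdef mult.commute)
    finally show "h (Poly_Mapping.lookup F m) * (\<Prod>i\<in>UNIV. (T * var i) ^ Poly_Mapping.lookup m i) =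
      Polynomial.monom (Poly_Mapping.single m (Poly_Mapping.lookup F m)) (\<Sum>i\<in>UNIV. Poly_Mapping.lookup m i)" .
  qed
  have "E (A * B) = (\<Sum>m\<in>Poly_Mapping.keys (A * B). Polynomial.monom (Poly_Mapping.single m (Poly_Mapping.lookup (A * B) m)) d)"
    unfolding ET using assms(1) by (intro sum.cong) (auto simp: homogeneous_def)
  also have "\<dots> = Polynomial.monom (\<Sum>m\<in>Poly_Mapping.keys (A * B). Poly_Mapping.single m (Poly_Mapping.lookup (A * B) m)) d"
    by (intro poly_eqI) (simp add: coeff_sum)
  also have "(\<Sum>m\<in>Poly_Mapping.keys (A * B). Poly_Mapping.single m (Poly_Mapping.lookup (A * B) m)) = A * B"
    by (rule mpoly_sum_monomials)
  finally have "E A * E B = Polynomial.monom (A * B) d"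
    by (simp add: E_def h.mp_eval_mult)
  from monom_factor[OF this assms(2)] obtain c i where c: "E A = Polynomial.monom c i" by blast
  have "homogeneous i A"
    unfolding homogeneous_def
  proof (rule ballI, rule ccontr)
    fix m assume m: "m \<in> Poly_Mapping.keys A" and ne: "(\<Sum>i\<in>UNIV. Poly_Mapping.lookup m i) \<noteq> i"
    let ?j = "\<Sum>i\<in>UNIV. Poly_Mapping.lookup m i"
    have "0 = Poly_Mapping.lookup (coeff (E A) ?j) m"
      unfolding c using ne by simp
    also have "\<dots> = (\<Sum>m'\<in>Poly_Mapping.keys A. if m' = m then Poly_Mapping.lookup A m else 0)"
      unfolding ET coeff_sum lookup_sum by (intro sum.cong) (auto simp: lookup_single when_def)
    also have "\<dots> = Poly_Mapping.lookup A m" using m by simp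
    finally show False using m by (simp add: in_keys_iff)
  qed
  then show ?thesis by blast
qed

section \<open>Transport of Galois extensions along isomorphisms\<close>

lemma Gal_mem_iff:
  "\<sigma> \<in> carrier (Gal L K) \<longleftrightarrow> \<sigma> \<in> Bij (carrier L) \<and> \<sigma> \<in> ring_hom L L \<and> (\<forall>x\<in>K. \<sigma> x = x)"
  by (auto simp: Gal_def)

lemma Gal_mult:
  assumes "\<sigma> \<in> Bij (carrier L)" "\<tau> \<in> Bij (carrier L)"
  shows "\<sigma> \<otimes>\<^bsub>Gal L K\<^esub> \<tau> = compose (carrier L) \<sigma> \<tau>"
  using assms by (simp add: Gal_def BijGroup_def)

text \<open>
  Conjugation with \<open>h\<close>, extended by \<open>undefined\<close> outside the carrier, as \<open>BijGroup\<close> requires.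
\<close>

definition conj_iso :: "('a, 'x) ring_scheme \<Rightarrow> ('b, 'y) ring_scheme \<Rightarrow> ('a \<Rightarrow> 'b) \<Rightarrow> ('a \<Rightarrow> 'a) \<Rightarrow> 'b \<Rightarrow> 'b" where
  "conj_iso L L' h \<tau> = (\<lambda>y\<in>carrier L'. h (\<tau> (inv_into (carrier L) h y)))"

context
  fixes L :: "('a, 'x) ring_scheme" and L' :: "('b, 'y) ring_scheme" and h
  assumes h: "h \<in> ring_iso L L'"
begin

private lemma bij: "bij_betw h (carrier L) (carrier L')"
  using h by (simp add: ring_iso_def)

private lemma hom: "h \<in> ring_hom L L'"
  using h by (simp add: ring_iso_def)

private lemma h_inv: "x \<in> carrier L \<Longrightarrow> inv_into (carrier L) h (h x) = x"
  using bij by (simp add: bij_betw_def)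

private lemma h_closed: "x \<in> carrier L \<Longrightarrow> h x \<in> carrier L'"
  using bij by (auto simp: bij_betw_def)

lemma conj_iso_apply: "x \<in> carrier L \<Longrightarrow> conj_iso L L' h \<tau> (h x) = h (\<tau> x)"
  by (simp add: conj_iso_def h_closed h_inv)

lemma conj_iso_Gal:
  assumes L: "ring L" and "K \<subseteq> carrier L" and \<tau>: "\<tau> \<in> carrier (Gal L K)"
  shows "conj_iso L L' h \<tau> \<in> carrier (Gal L' (h ` K))"
  unfolding Gal_mem_iff
proof (intro conjI ballI)
  have \<tau>B: "bij_betw \<tau> (carrier L) (carrier L)" and \<tau>h: "\<tau> \<in> ring_hom L L" and \<tau>K: "\<And>x. x \<in> K \<Longrightarrow> \<tau> x = x"
    using \<tau> by (auto simp: Gal_mem_iff Bij_def)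
  have \<tau>c: "\<And>x. x \<in> carrier L \<Longrightarrow> \<tau> x \<in> carrier L" using \<tau>B by (auto simp: bij_betw_def)
  have "bij_betw (h \<circ> (\<tau> \<circ> inv_into (carrier L) h)) (carrier L') (carrier L')"
    by (rule bij_betw_trans[OF bij_betw_trans[OF bij_betw_inv_into[OF bij] \<tau>B] bij])
  then show "conj_iso L L' h \<tau> \<in> Bij (carrier L')"
    unfolding Bij_def conj_iso_def by (auto simp: o_def cong: bij_betw_cong)
  show "conj_iso L L' h \<tau> \<in> ring_hom L' L'"
  proof (rule ring_hom_memI)
    interpret L: ring L by fact
    fix y z assume y: "y \<in> carrier L'" and z: "z \<in> carrier L'"
    obtain a where a: "a \<in> carrier L" "y = h a" using bij y by (auto simp: bij_betw_def)
    obtain b where b: "b \<in> carrier L" "z = h b" using bij z by (auto simp: bij_betw_def)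
    show "conj_iso L L' h \<tau> y \<in> carrier L'" using a by (simp add: conj_iso_apply h_closed \<tau>c)
    show "conj_iso L L' h \<tau> (y \<otimes>\<^bsub>L'\<^esub> z) = conj_iso L L' h \<tau> y \<otimes>\<^bsub>L'\<^esub> conj_iso L L' h \<tau> z"
      using a b by (simp add: conj_iso_apply \<tau>c ring_hom_mult[OF \<tau>h] flip: ring_hom_mult[OF hom])
    show "conj_iso L L' h \<tau> (y \<oplus>\<^bsub>L'\<^esub> z) = conj_iso L L' h \<tau> y \<oplus>\<^bsub>L'\<^esub> conj_iso L L' h \<tau> z"
      using a b by (simp add: conj_iso_apply \<tau>c ring_hom_add[OF \<tau>h] flip: ring_hom_add[OF hom])
  next
    interpret L: ring L by fact
    show "conj_iso L L' h \<tau> \<one>\<^bsub>L'\<^esub> = \<one>\<^bsub>L'\<^esub>"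
      using conj_iso_apply[of "\<one>\<^bsub>L\<^esub>" \<tau>] ring_hom_one[OF hom] ring_hom_one[OF \<tau>h] by simp
  qed
  show "conj_iso L L' h \<tau> x = x" if "x \<in> h ` K" for x
    using that assms(2) \<tau>K by (auto simp: conj_iso_apply)
qed

end

lemma Gal_iso:
  assumes h: "h \<in> ring_iso L L'" and L: "ring L" "ring L'" and K: "K \<subseteq> carrier L"
  shows "Gal L K \<cong> Gal L' (h ` K)"
proof -
  let ?g = "inv_into (carrier L) h"
  have bij: "bij_betw h (carrier L) (carrier L')" using h by (simp add: ring_iso_def)
  interpret L: ring L by fact
  interpret L': ring L' by fact
  have hom: "h \<in> ring_hom L L'" using h by (simp add: ring_iso_def)
  have inv: "h (?g y) = y" "?g y \<in> carrier L" if "y \<in> carrier L'" for y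
    using bij that by (auto simp: bij_betw_def f_inv_into_f inv_into_into)
  have hinv: "?g (h x) = x" "h x \<in> carrier L'" if "x \<in> carrier L" for x
    using bij that by (auto simp: bij_betw_def)
  have g: "?g \<in> ring_iso L' L" by (rule ring_iso_set_sym[OF L(1) h])
  have gi: "inj_on ?g (carrier L')" using g by (simp add: ring_iso_def bij_betw_def)
  have gK: "?g ` h ` K = K" using K hinv by (auto simp: image_image subset_iff)
  have hK: "h ` K \<subseteq> carrier L'" using K hinv by auto
  have c1: "conj_iso L L' h \<tau> \<in> carrier (Gal L' (h ` K))" if "\<tau> \<in> carrier (Gal L K)" for \<tau>
    by (rule conj_iso_Gal[OF h L(1) K that])
  have c2: "conj_iso L' L ?g \<sigma> \<in> carrier (Gal L K)" if "\<sigma> \<in> carrier (Gal L' (h ` K))" for \<sigma>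
    using conj_iso_Gal[OF g L(2) hK that] unfolding gK .
  have "conj_iso L L' h \<in> iso (Gal L K) (Gal L' (h ` K))"
  proof (rule isoI)
    show "conj_iso L L' h \<in> hom (Gal L K) (Gal L' (h ` K))"
    proof (rule homI)
      fix \<sigma> \<tau> assume s: "\<sigma> \<in> carrier (Gal L K)" and t: "\<tau> \<in> carrier (Gal L K)"
      have B: "\<sigma> \<in> Bij (carrier L)" "\<tau> \<in> Bij (carrier L)" "conj_iso L L' h \<sigma> \<in> Bij (carrier L')"
        "conj_iso L L' h \<tau> \<in> Bij (carrier L')"
        using s t c1[OF s] c1[OF t] by (auto simp: Gal_mem_iff)
      have tc: "\<tau> x \<in> carrier L" if "x \<in> carrier L" for x
        using B(2) that by (auto simp: Bij_def bij_betw_def)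
      show "conj_iso L L' h (\<sigma> \<otimes>\<^bsub>Gal L K\<^esub> \<tau>) = conj_iso L L' h \<sigma> \<otimes>\<^bsub>Gal L' (h ` K)\<^esub> conj_iso L L' h \<tau>"
        unfolding Gal_mult[OF B(1,2)] Gal_mult[OF B(3,4)]
        by (rule ext) (auto simp: conj_iso_def compose_def inv hinv tc)
    qed (rule c1)
    show "bij_betw (conj_iso L L' h) (carrier (Gal L K)) (carrier (Gal L' (h ` K)))"
    proof (rule bij_betw_byWitness[where f' = "conj_iso L' L ?g"])
      show "\<forall>\<tau>\<in>carrier (Gal L K). conj_iso L' L ?g (conj_iso L L' h \<tau>) = \<tau>"
      proof
        fix \<tau> assume "\<tau> \<in> carrier (Gal L K)"
        then have B: "\<tau> \<in> extensional (carrier L)" "\<And>x. x \<in> carrier L \<Longrightarrow> \<tau> x \<in> carrier L"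
          by (auto simp: Gal_mem_iff Bij_def bij_betw_def)
        have gg: "inv_into (carrier L') ?g x = h x" if "x \<in> carrier L" for x
          by (rule inv_into_f_eq[OF gi hinv(2)[OF that] hinv(1)[OF that]])
        show "conj_iso L' L ?g (conj_iso L L' h \<tau>) = \<tau>"
          using B by (intro ext) (auto simp: conj_iso_def gg hinv extensional_def)
      qed
      show "\<forall>\<sigma>\<in>carrier (Gal L' (h ` K)). conj_iso L L' h (conj_iso L' L ?g \<sigma>) = \<sigma>"
      proof
        fix \<sigma> assume "\<sigma> \<in> carrier (Gal L' (h ` K))"
        then have B: "\<sigma> \<in> extensional (carrier L')" "\<And>x. x \<in> carrier L' \<Longrightarrow> \<sigma> x \<in> carrier L'"
          by (auto simp: Gal_mem_iff Bij_def bij_betw_def)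
        have gg: "inv_into (carrier L') ?g x = h x" if "x \<in> carrier L" for x
          by (rule inv_into_f_eq[OF gi hinv(2)[OF that] hinv(1)[OF that]])
        show "conj_iso L L' h (conj_iso L' L ?g \<sigma>) = \<sigma>"
          using B by (intro ext) (auto simp: conj_iso_def gg inv extensional_def)
      qed
    qed (use c1 c2 in auto)
  qed
  then show ?thesis by (auto simp: is_iso_def)
qed

lemma galois_extension_iso:
  assumes h: "h \<in> ring_iso L L'" and L: "field L" "field L'" and K: "galois_extension L K"
  shows "galois_extension L' (h ` K)"
proof -
  interpret L: field L by fact
  interpret L': field L' by fact
  interpret h: ring_hom_ring L L' h
    by (rule ring_hom_ringI2) (use h in \<open>auto simp: ring_iso_def L.ring_axioms L'.ring_axioms\<close>)
  have sub: "subfield K L" and alg: "\<And>x. x \<in> carrier L \<Longrightarrow> L.algebraic K x"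
    and fix': "{x \<in> carrier L. \<forall>\<sigma>\<in>carrier (Gal L K). \<sigma> x = x} = K"
    using K by (auto simp: galois_extension_def)
  have KL: "K \<subseteq> carrier L" by (rule subfieldE(3)[OF sub])
  have bij: "bij_betw h (carrier L) (carrier L')" using h by (simp add: ring_iso_def)
  have "subfield (h ` K) L'" by (rule h.img_is_subfield(2)[OF sub L'.one_not_zero])
  moreover have "L'.algebraic (h ` K) y" if y: "y \<in> carrier L'" for y
  proof -
    obtain x where x: "x \<in> carrier L" "y = h x" using bij y by (auto simp: bij_betw_def)
    obtain p where p: "p \<in> carrier (K[X]\<^bsub>L\<^esub>)" "p \<noteq> []" "L.eval p x = \<zero>\<^bsub>L\<^esub>"
      by (rule L.algebraicE[OF subfieldE(1)[OF sub] x(1)]) (use alg[OF x(1)] in \<open>auto simp: over_def\<close>)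
    show ?thesis
      using L'.algebraicI[OF h.subfield_polynomial_hom[OF sub L'.one_not_zero p(1)], of y] p
        h.eval_hom[OF subfieldE(1)[OF sub] x(1) p(1)] x by (simp add: over_def)
  qed
  moreover have "{y \<in> carrier L'. \<forall>\<sigma>\<in>carrier (Gal L' (h ` K)). \<sigma> y = y} = h ` K"
  proof (intro equalityI subsetI CollectI conjI ballI)
    fix y assume "y \<in> {y \<in> carrier L'. \<forall>\<sigma>\<in>carrier (Gal L' (h ` K)). \<sigma> y = y}"
    then have y: "y \<in> carrier L'" "\<And>\<sigma>. \<sigma> \<in> carrier (Gal L' (h ` K)) \<Longrightarrow> \<sigma> y = y" by auto
    obtain x where x: "x \<in> carrier L" "y = h x" using bij y by (auto simp: bij_betw_def)
    have "\<tau> x = x" if t: "\<tau> \<in> carrier (Gal L K)" for \<tau>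
    proof -
      have "h (\<tau> x) = h x"
        using y(2)[OF conj_iso_Gal[OF h L.ring_axioms KL t]] conj_iso_apply[OF h x(1), of \<tau>] x(2) by simp
      moreover have "\<tau> x \<in> carrier L" using t x(1) by (auto simp: Gal_mem_iff Bij_def bij_betw_def)
      ultimately show ?thesis using bij x(1) by (auto simp: bij_betw_def inj_on_def)
    qed
    then have "x \<in> K" using fix' x(1) by blast
    then show "y \<in> h ` K" using x by auto
  qed (use KL in \<open>auto simp: Gal_mem_iff\<close>)
  ultimately show ?thesis using L(2) by (auto simp: galois_extension_def)
qed

lemma group_Gal:
  assumes "ring L" "K \<subseteq> carrier L"
  shows "group (Gal L K)"
proof -
  interpret L: ring L by fact
  interpret B: group "BijGroup (carrier L)" by (rule group_BijGroup)
  let ?S = "carrier L"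
  let ?H = "{\<sigma> \<in> Bij (carrier L). \<sigma> \<in> ring_hom L L \<and> (\<forall>x\<in>K. \<sigma> x = x)}"
  have "subgroup ?H (BijGroup ?S)"
  proof (rule B.subgroupI)
    show "?H \<subseteq> carrier (BijGroup ?S)" by (auto simp: BijGroup_def)
    have "(\<lambda>x\<in>?S. x) \<in> ?H"
      using assms(2) id_Bij[of ?S] by (auto simp: ring_hom_def)
    then show "?H \<noteq> {}" by blast
  next
    fix \<sigma> \<tau> assume "\<sigma> \<in> ?H" "\<tau> \<in> ?H"
    then have B: "\<sigma> \<in> Bij ?S" "\<tau> \<in> Bij ?S" and r: "\<sigma> \<in> ring_hom L L" "\<tau> \<in> ring_hom L L"
      and f: "\<And>x. x \<in> K \<Longrightarrow> \<sigma> x = x" "\<And>x. x \<in> K \<Longrightarrow> \<tau> x = x" by auto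
    have "compose ?S \<sigma> \<tau> \<in> ring_hom L L"
      by (rule ring_hom_memI)
        (auto simp: compose_def ring_hom_closed[OF r(1)] ring_hom_closed[OF r(2)]
          ring_hom_mult[OF r(1)] ring_hom_mult[OF r(2)] ring_hom_add[OF r(1)] ring_hom_add[OF r(2)]
          ring_hom_one[OF r(1)] ring_hom_one[OF r(2)])
    moreover have "compose ?S \<sigma> \<tau> x = x" if "x \<in> K" for x
      using that assms(2) f by (auto simp: compose_def)
    ultimately show "\<sigma> \<otimes>\<^bsub>BijGroup ?S\<^esub> \<tau> \<in> ?H"
      using B compose_Bij[OF B] by (simp add: BijGroup_def)
  next
    fix \<sigma> assume "\<sigma> \<in> ?H"
    then have B: "\<sigma> \<in> Bij ?S" and r: "\<sigma> \<in> ring_hom L L"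
      and f: "\<And>x. x \<in> K \<Longrightarrow> \<sigma> x = x" by auto
    let ?i = "inv_into ?S \<sigma>"
    have bij: "bij_betw \<sigma> ?S ?S" using B by (simp add: Bij_def)
    then have si: "\<sigma> (?i x) = x" "?i x \<in> ?S" if "x \<in> ?S" for x
      using that by (auto simp: bij_betw_def f_inv_into_f inv_into_into)
    have is': "?i (\<sigma> x) = x" if "x \<in> ?S" for x
      using bij that by (simp add: bij_betw_def)
    have eq: "a = b" if "a \<in> ?S" "b \<in> ?S" "\<sigma> a = \<sigma> b" for a b
      using bij that by (auto simp: bij_betw_def inj_on_def)
    have "(\<lambda>x\<in>?S. ?i x) \<in> ring_hom L L"
    proof (rule ring_hom_memI)
      fix x y assume x: "x \<in> ?S" and y: "y \<in> ?S"
      show "(\<lambda>x\<in>?S. ?i x) x \<in> ?S" using x si by simp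
      show "(\<lambda>x\<in>?S. ?i x) (x \<otimes>\<^bsub>L\<^esub> y) = (\<lambda>x\<in>?S. ?i x) x \<otimes>\<^bsub>L\<^esub> (\<lambda>x\<in>?S. ?i x) y"
        using x y si eq[of "?i (x \<otimes>\<^bsub>L\<^esub> y)" "?i x \<otimes>\<^bsub>L\<^esub> ?i y"]
        by (simp add: ring_hom_mult[OF r])
      show "(\<lambda>x\<in>?S. ?i x) (x \<oplus>\<^bsub>L\<^esub> y) = (\<lambda>x\<in>?S. ?i x) x \<oplus>\<^bsub>L\<^esub> (\<lambda>x\<in>?S. ?i x) y"
        using x y si eq[of "?i (x \<oplus>\<^bsub>L\<^esub> y)" "?i x \<oplus>\<^bsub>L\<^esub> ?i y"]
        by (simp add: ring_hom_add[OF r])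
    next
      show "(\<lambda>x\<in>?S. ?i x) \<one>\<^bsub>L\<^esub> = \<one>\<^bsub>L\<^esub>"
        using si eq[of "?i \<one>\<^bsub>L\<^esub>" "\<one>\<^bsub>L\<^esub>"] by (simp add: ring_hom_one[OF r])
    qed
    moreover have "?i x = x" if "x \<in> K" for x
      using is'[of x] f[OF that] assms(2) that by auto
    ultimately show "inv\<^bsub>BijGroup ?S\<^esub> \<sigma> \<in> ?H"
      using B restrict_inv_into_Bij[OF B] assms(2) by (auto simp: inv_BijGroup)
  qed
  then have "group (BijGroup ?S\<lparr>carrier := ?H\<rparr>)"
    by (rule B.subgroup_imp_group)
  then show ?thesis by (simp add: Gal_def)
qed

section \<open>The rational function field as a ring\<close>

abbreviation kS :: "'k::field poly fract ring" where
  "kS \<equiv> ring_of_type_algebra"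

lemma kS_simps [simp]:
  "carrier (ring_of_type_algebra :: 'a::ring_1 ring) = UNIV"
  "x \<otimes>\<^bsub>(ring_of_type_algebra :: 'a ring)\<^esub> y = x * y"
  "x \<oplus>\<^bsub>(ring_of_type_algebra :: 'a ring)\<^esub> y = x + y"
  "\<one>\<^bsub>(ring_of_type_algebra :: 'a ring)\<^esub> = 1"
  "\<zero>\<^bsub>(ring_of_type_algebra :: 'a ring)\<^esub> = 0"
  by (simp_all add: ring_of_type_algebra_def)

lemma field_type_algebra: "field (ring_of_type_algebra :: 'a::field ring)"
  by (rule field_from_type_algebra)

lemma ring_type_algebra: "ring (ring_of_type_algebra :: 'a::comm_ring_1 ring)"
  by (rule ring_from_type_algebra)

lemma a_inv_type_algebra: "\<ominus>\<^bsub>(ring_of_type_algebra :: 'a::field ring)\<^esub> x = - x"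
proof -
  interpret R: field "ring_of_type_algebra :: 'a ring" by (rule field_type_algebra)
  have "x + (\<ominus>\<^bsub>(ring_of_type_algebra :: 'a ring)\<^esub> x) = 0"
    using R.r_neg[of x] by simp
  then show ?thesis by (simp add: eq_neg_iff_add_eq_0 add.commute)
qed

lemma m_inv_type_algebra:
  assumes "x \<noteq> 0"
  shows "inv\<^bsub>(ring_of_type_algebra :: 'a::field ring)\<^esub> x = inverse x"
proof -
  interpret R: field "ring_of_type_algebra :: 'a ring" by (rule field_type_algebra)
  have "inverse x * x = 1" using assms by simp
  then show ?thesis using R.inv_char[of x "inverse x"] assms by simp
qed

text \<open>
  The transition from the operations of the type to the ring \<open>kS\<close>.
\<close>

lemma subfield_kS:
  assumes "subfld T"
  shows "subfield T kS"
proof -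
  interpret R: field kS by (rule field_type_algebra)
  show ?thesis
  proof (rule R.subfieldI')
    show "subring T kS"
      by (rule R.subringI)
        (auto simp: a_inv_type_algebra intro: subfld_01[OF assms] subfld_add[OF assms] subfld_mult[OF assms]
          subfld_uminus[OF assms])
    show "inv\<^bsub>kS\<^esub> k \<in> T" if "k \<in> T - {\<zero>\<^bsub>kS\<^esub>}" for k
      using that by (auto simp: m_inv_type_algebra intro: subfld_inverse[OF assms])
  qed
qed

lemma Gal_kS_iff:
  assumes "range cst \<subseteq> K"
  shows "\<sigma> \<in> carrier (Gal kS K) \<longleftrightarrow> bij \<sigma> \<and> k_endo \<sigma> \<and> (\<forall>x\<in>K. \<sigma> x = x)"
proof -
  have "\<sigma> \<in> ring_hom kS kS \<longleftrightarrow> k_endo \<sigma>" if "\<forall>x\<in>K. \<sigma> x = x"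
  proof -
    have "\<sigma> (cst c) = cst c" for c using assms that by auto
    moreover from this[of 1] have "\<sigma> 1 = 1" by simp
    ultimately show ?thesis by (auto simp: ring_hom_def k_endo_def)
  qed
  then show ?thesis by (auto simp: Gal_mem_iff Bij_def)
qed

lemma Gal_kS_mult:
  assumes "\<sigma> \<in> carrier (Gal kS K)" "\<tau> \<in> carrier (Gal kS K)"
  shows "\<sigma> \<otimes>\<^bsub>Gal kS K\<^esub> \<tau> = \<sigma> \<circ> \<tau>"
  using assms by (subst Gal_mult) (auto simp: Gal_mem_iff compose_def fun_eq_iff)

text \<open>
  Algebraicity in \<open>kS\<close> refers to polynomials that are lists of coefficients, with the leading one first.
\<close>

lemma algebraic_kS:
  assumes "subfld T" "\<And>i. coeff P i \<in> T" "P \<noteq> 0" "poly P x = 0"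
  shows "ring.algebraic kS T x"
proof -
  interpret R: field kS by (rule field_type_algebra)
  have pow: "x [^]\<^bsub>kS\<^esub> (n::nat) = x ^ n" for n by (induction n) (auto simp: mult.commute)
  have app: "R.eval (q @ [a]) x = R.eval q x * x + a" for q a
    by (induction q) (auto simp: pow algebra_simps)
  have ev: "R.eval (rev (coeffs Q)) x = poly Q x" for Q
    by (induction Q) (auto simp: coeffs_pCons_eq_cCons cCons_def app)
  have "set (rev (coeffs P)) \<subseteq> T" using assms(2) by (auto simp: coeffs_def)
  moreover have "rev (coeffs P) \<noteq> []" "hd (rev (coeffs P)) \<noteq> 0"
    using assms(3) by (auto simp: hd_rev last_coeffs_eq_coeff_degree)
  ultimately have "rev (coeffs P) \<in> carrier (T[X]\<^bsub>kS\<^esub>)"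
    by (simp add: univ_poly_carrier[symmetric] polynomial_def)
  from R.algebraicI[OF this, of x] show ?thesis
    using assms(3,4) by (simp add: ev over_def)
qed

section \<open>Recognising dihedral groups\<close>

text \<open>
  By the relators every word is equivalent to \<open>a\<^sup>k\<close> or \<open>a\<^sup>k b\<close> with \<open>k < m\<close>. If a group satisfies the
  relators and these \<open>2m\<close> expressions have different values in it, then two words are equivalent if and
  only if they have the same value, so the classes of words correspond to the elements of the group.
\<close>

lemma word_eq_context: "word_eq R u v \<Longrightarrow> word_eq R (x @ u @ y) (x @ v @ y)"
proof (induction rule: word_eq.induct)
  case (cancel u g e v)
  then show ?case using word_eq.cancel[of R "x @ u" g e "v @ y"] by simp
next
  case (relator r u v)
  then show ?case using word_eq.relator[of r R "x @ u" "v @ y"] by simp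
qed (auto intro: word_eq.intros)

lemma word_eq_append: "word_eq R u v \<Longrightarrow> word_eq R u' v' \<Longrightarrow> word_eq R (u @ u') (v @ v')"
  using word_eq_context[of R u v "[]" u'] word_eq_context[of R u' v' v "[]"]
  by (auto intro: word_eq.trans)

abbreviation dihedral_relators :: "nat \<Rightarrow> dihedral_gen word set" where
  "dihedral_relators m \<equiv> {replicate m (gen_a, True), [(gen_b, True), (gen_b, True)],
      [(gen_a, True), (gen_b, True), (gen_a, True), (gen_b, True)]}"

context
  fixes m :: nat
  assumes m: "m > 0"
begin

private abbreviation weq (infix "\<doteq>" 50) where "weq \<equiv> word_eq (dihedral_relators m)"
private abbreviation A where "A \<equiv> (gen_a, True)"
private abbreviation A' where "A' \<equiv> (gen_a, False)"
private abbreviation B where "B \<equiv> (gen_b, True)"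
private abbreviation B' where "B' \<equiv> (gen_b, False)"

private lemmas trans' [trans] = word_eq.trans[of "dihedral_relators m"]
private lemmas eq_trans [trans] = back_subst[of "\<lambda>v. word_eq (dihedral_relators m) u v" for u]

private lemma am: "replicate m A @ v \<doteq> v"
  using word_eq.relator[of "replicate m A" "dihedral_relators m" "[]" v] by simp

private lemma bb: "[B, B] @ v \<doteq> v"
  using word_eq.relator[of "[B, B]" "dihedral_relators m" "[]" v] by simp

private lemma a_inv: "A' # v \<doteq> replicate (m - 1) A @ v"
proof -
  have "A' # v \<doteq> [A'] @ (replicate m A @ v)"
    using word_eq_append[OF word_eq.refl word_eq.sym[OF am[of v]], of "[A']"] by simp
  also have "[A'] @ (replicate m A @ v) = [] @ [(gen_a, False), (gen_a, \<not> False)] @ (replicate (m - 1) A @ v)"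
    using m by (cases m) auto
  also have "\<dots> \<doteq> [] @ (replicate (m - 1) A @ v)" by (rule word_eq.cancel)
  finally show ?thesis by simp
qed

private lemma b_inv: "B' # v \<doteq> B # v"
proof -
  have "B' # v \<doteq> [B'] @ ([B, B] @ v)"
    using word_eq_append[OF word_eq.refl word_eq.sym[OF bb[of v]], of "[B']"] by simp
  also have "[B'] @ ([B, B] @ v) = [] @ [(gen_b, False), (gen_b, \<not> False)] @ (B # v)" by simp
  also have "\<dots> \<doteq> [] @ (B # v)" by (rule word_eq.cancel)
  finally show ?thesis by simp
qed

text \<open>This is \<open>b a = a\<^sup>-\<^sup>1 b\<close>, with the inverse written as a positive power.\<close>

private lemma ba: "[B, A] @ v \<doteq> replicate (m - 1) A @ [B] @ v"
proof (rule word_eq.sym)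
  have "replicate (m - 1) A @ [B] @ v \<doteq> replicate (m - 1) A @ [A, B, A, B] @ [B] @ v"
    by (rule word_eq.sym, rule word_eq.relator) simp
  also have "replicate (m - 1) A @ [A, B, A, B] @ [B] @ v = replicate m A @ [B, A, B, B] @ v"
    using m by (cases m) (auto simp: replicate_append_same)
  also have "\<dots> \<doteq> [B, A, B, B] @ v" by (rule am)
  also have "[B, A, B, B] @ v = [B, A] @ [B, B] @ v" by simp
  also have "\<dots> \<doteq> [B, A] @ v" by (rule word_eq.relator) simp
  finally show "replicate (m - 1) A @ [B] @ v \<doteq> [B, A] @ v" .
qed

private lemma ba_pow: "[B] @ replicate k A @ v \<doteq> replicate ((m - 1) * k) A @ [B] @ v"
proof (induction k)
  case (Suc k)
  have "[B] @ replicate (Suc k) A @ v = [B, A] @ (replicate k A @ v)" by simp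
  also have "\<dots> \<doteq> replicate (m - 1) A @ ([B] @ replicate k A @ v)"
    using ba[of "replicate k A @ v"] by simp
  also have "\<dots> \<doteq> replicate (m - 1) A @ (replicate ((m - 1) * k) A @ [B] @ v)"
    by (rule word_eq_append[OF word_eq.refl Suc.IH])
  also have "\<dots> = replicate ((m - 1) * Suc k) A @ [B] @ v"
    by (simp add: replicate_add)
  finally show ?case .
qed (simp add: word_eq.refl)

private abbreviation nf where "nf k j \<equiv> replicate k A @ (if j then [B] else [])"

private lemma normal_form: "\<exists>k j. w \<doteq> nf k j"
proof (induction w)
  case Nil
  have "[] \<doteq> nf 0 False" by (simp add: word_eq.refl)
  then show ?case by blast
next
  case (Cons l w)
  then obtain k j where w: "w \<doteq> nf k j" by blast
  have lw: "l # w \<doteq> l # nf k j" using word_eq_append[OF word_eq.refl w, of "[l]"] by simp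
  have B: "B # nf k j \<doteq> nf ((m - 1) * k) (\<not> j)"
  proof -
    have "B # nf k j = [B] @ replicate k A @ (if j then [B] else [])" by simp
    also have "\<dots> \<doteq> replicate ((m - 1) * k) A @ [B] @ (if j then [B] else [])" by (rule ba_pow)
    also have "\<dots> \<doteq> nf ((m - 1) * k) (\<not> j)"
      using word_eq_append[OF word_eq.refl bb[of "[]"], of "replicate ((m - 1) * k) A"]
      by (cases j) (auto simp: word_eq.refl)
    finally show ?thesis .
  qed
  consider "l = A" | "l = A'" | "l = B" | "l = B'"
    by (cases l) (metis dihedral_gen.exhaust)
  then show ?case
  proof cases
    case 1
    have "l # nf k j = nf (Suc k) j" using 1 by simp
    then show ?thesis using lw by metis
  next
    case 2
    have "A' # nf k j \<doteq> nf (m - 1 + k) j" using a_inv[of "nf k j"] by (simp add: replicate_add)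
    then show ?thesis using lw 2 by (blast intro: word_eq.trans)
  next
    case 3
    then show ?thesis using lw B by (blast intro: word_eq.trans)
  next
    case 4
    then show ?thesis using lw B b_inv[of "nf k j"] by (blast intro: word_eq.trans)
  qed
qed

private lemma reduce_mod: "nf k j \<doteq> nf (k mod m) j"
proof (induction k rule: less_induct)
  case (less k)
  show ?case
  proof (cases "k < m")
    case True
    then show ?thesis by (simp add: word_eq.refl)
  next
    case False
    have "nf k j = replicate m A @ nf (k - m) j"
      using False by (simp flip: replicate_add append_assoc)
    also have "\<dots> \<doteq> nf (k - m) j" by (rule am)
    also have "\<dots> \<doteq> nf ((k - m) mod m) j" by (rule less.IH) (use False m in auto)
    also have "(k - m) mod m = k mod m" using False by (simp add: le_mod_geq)
    finally show ?thesis .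
  qed
qed

lemma dihedral_iso:
  fixes G (structure)
  assumes "group G" and a: "a \<in> carrier G" and b: "b \<in> carrier G"
    and am1: "a [^] m = \<one>" and bb1: "b \<otimes> b = \<one>" and abab: "a \<otimes> b \<otimes> (a \<otimes> b) = \<one>"
    and surj: "\<And>g. g \<in> carrier G \<Longrightarrow> \<exists>i::nat. g = a [^] i \<or> g = a [^] i \<otimes> b"
    and inj: "\<And>i j::nat. i < m \<Longrightarrow> j < m \<Longrightarrow> a [^] i = a [^] j \<Longrightarrow> i = j"
    and nb: "\<And>i j::nat. i < m \<Longrightarrow> j < m \<Longrightarrow> a [^] i \<noteq> a [^] j \<otimes> b"
  shows "G \<cong> dihedral_group (2 * m)"
proof -
  interpret group G by fact
  \<comment> \<open>values of letters and of words in the group\<close>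
  define el where "el = (\<lambda>(g, e). let x = (case g of gen_a \<Rightarrow> a | gen_b \<Rightarrow> b) in if e then x else inv x)"
  define ew where "ew = (\<lambda>w. foldr (\<lambda>l g. el l \<otimes> g) w \<one>)"
  have el: "el l \<in> carrier G" for l
    using a b by (cases l) (auto simp: el_def Let_def split: dihedral_gen.split)
  have ew_Nil: "ew [] = \<one>" and ew_Cons: "ew (l # w) = el l \<otimes> ew w" for l w by (auto simp: ew_def)
  have ew: "ew w \<in> carrier G" for w by (induction w) (auto simp: ew_Nil ew_Cons el)
  have ew_app: "ew (u @ v) = ew u \<otimes> ew v" for u v
    by (induction u) (auto simp: ew_Nil ew_Cons el ew m_assoc)
  have elA: "el A = a" and elB: "el B = b" by (auto simp: el_def)
  have ew_rep: "ew (replicate k A) = a [^] k" for k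
  proof (induction k)
    case (Suc k)
    have "a \<otimes> a [^] k = a [^] Suc k" using a by (metis nat_pow_Suc2)
    then show ?case using Suc by (simp add: ew_Cons elA)
  qed (simp add: ew_Nil)
  have rel: "ew r = \<one>" if "r \<in> dihedral_relators m" for r
    using that a b am1 bb1 abab
    by (auto simp: ew_rep ew_Cons ew_Nil elA elB m_assoc)
  have sound: "u \<doteq> v \<Longrightarrow> ew u = ew v" for u v
  proof (induction rule: word_eq.induct)
    case (cancel u g e v)
    have "el (g, e) \<otimes> (el (g, \<not> e) \<otimes> ew v) = ew v"
    proof -
      have "el (g, e) \<otimes> el (g, \<not> e) = \<one>"
        using a b by (cases g; cases e) (auto simp: el_def)
      then show ?thesis using el ew by (simp flip: m_assoc)
    qed
    then show ?case by (simp add: ew_app ew_Cons)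
  next
    case (relator r u v)
    then show ?case using rel[of r] ew by (simp add: ew_app)
  qed auto
  have ew_nf: "ew (nf k j) = (if j then a [^] k \<otimes> b else a [^] k)" for k j
    using a b by (auto simp: ew_app ew_rep ew_Cons ew_Nil elB)
  have complete: "u \<doteq> v" if "ew u = ew v" for u v
  proof -
    obtain k j where u: "u \<doteq> nf (k mod m) j"
      using normal_form[of u] reduce_mod by (blast intro: word_eq.trans)
    obtain k' j' where v: "v \<doteq> nf (k' mod m) j'"
      using normal_form[of v] reduce_mod by (blast intro: word_eq.trans)
    have eq: "ew (nf (k mod m) j) = ew (nf (k' mod m) j')"
      using sound[OF u] sound[OF v] that by simp
    have lt: "k mod m < m" "k' mod m < m" using m by auto
    have "j = j'"
      using eq nb[OF lt] nb[OF lt(2,1)] unfolding ew_nf by (cases j; cases j') auto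
    moreover have "a [^] (k mod m) = a [^] (k' mod m)"
      using eq \<open>j = j'\<close> a b unfolding ew_nf by (auto split: if_splits)
    then have "k mod m = k' mod m" by (rule inj[OF lt])
    ultimately have "u \<doteq> nf (k' mod m) j'" using u by simp
    then show ?thesis by (rule word_eq.trans[OF _ word_eq.sym[OF v]])
  qed
  have weq_iff: "u \<doteq> v \<longleftrightarrow> ew u = ew v" for u v using sound complete by blast
  define f where "f = (\<lambda>g. {w. ew w = g})"
  have ew_surj: "\<exists>w. ew w = g" if "g \<in> carrier G" for g
    using surj[OF that] ew_nf[of _ True] ew_nf[of _ False] by metis
  have D: "dihedral_group (2 * m) = presented_group (dihedral_relators m)"
    by (simp add: dihedral_group_def)
  have carr: "carrier (dihedral_group (2 * m)) = f ` carrier G"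
  proof -
    have "{(u, v). u \<doteq> v} `` {u} = f (ew u)" for u by (auto simp: f_def weq_iff)
    moreover have "range ew = carrier G" using ew ew_surj by (force simp: image_iff)
    moreover have "carrier (dihedral_group (2 * m)) = (\<Union>u. {{(u, v). u \<doteq> v} `` {u}})"
      unfolding D presented_group_def quotient_def by simp
    moreover have "(\<Union>u. {f (ew u)}) = f ` range ew" by blast
    ultimately show ?thesis by simp
  qed
  have "f \<in> iso G (dihedral_group (2 * m))"
  proof (rule isoI)
    show "f \<in> hom G (dihedral_group (2 * m))"
    proof (rule homI)
      fix x y assume x: "x \<in> carrier G" and y: "y \<in> carrier G"
      obtain u where u: "ew u = x" using ew_surj[OF x] by blast
      obtain v where v: "ew v = y" using ew_surj[OF y] by blast
      have "(\<Union>u\<in>f x. \<Union>v\<in>f y. {w. u @ v \<doteq> w}) = f (x \<otimes> y)"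
        using u v by (auto simp: f_def weq_iff ew_app)
      then show "f (x \<otimes> y) = f x \<otimes>\<^bsub>dihedral_group (2 * m)\<^esub> f y"
        unfolding D presented_group_def by simp
    qed (use carr in auto)
    have "inj_on f (carrier G)"
      using ew_surj by (intro inj_onI) (auto simp: f_def set_eq_iff)
    then show "bij_betw f (carrier G) (carrier (dihedral_group (2 * m)))"
      unfolding carr by (simp add: bij_betw_def)
  qed
  then show ?thesis by (auto simp: is_iso_def)
qed

end

section \<open>Invariants of a cyclic group\<close>

lemma root_of_const_imp_const:
  fixes x :: "'k::alg_closed_field poly fract"
  assumes "x ^ n = cst c" "n > 0"
  shows "x \<in> range cst"
proof (rule ev_eq_0_imp)
  show "ev (Polynomial.monom 1 n - [:c:]) x = 0" using assms by simp
  have "coeff (Polynomial.monom 1 n - [:c:]) n = 1" using assms(2) by (cases n) auto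
  then show "Polynomial.monom 1 n - [:c:] \<noteq> 0" by (metis coeff_0 zero_neq_one)
qed

text \<open>
  Otherwise, by Bezout's identity, all the \<open>n\<close> roots of unity would be roots of unity of the smaller
  order \<open>gcd r n\<close>.
\<close>

lemma exists_root_of_unity_neq:
  assumes n: "of_nat n \<noteq> (0::'k::alg_closed_field)" and r: "\<not> n dvd r"
  shows "\<exists>\<xi>::'k. \<xi> ^ n = 1 \<and> \<xi> ^ r \<noteq> 1"
proof (rule ccontr)
  assume "\<not> ?thesis"
  then have all: "\<And>\<xi>::'k. \<xi> ^ n = 1 \<Longrightarrow> \<xi> ^ r = 1" by blast
  have "r \<noteq> 0" "n > 0" using r n by (auto intro: Nat.gr0I)
  obtain x y where xy: "r * x = n * y + gcd r n" using bezout_nat[OF \<open>r \<noteq> 0\<close>] by blast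
  define g where "g = gcd r n"
  have g: "g > 0" "g < n" using \<open>n > 0\<close> r
    by (auto simp: g_def) (metis gcd_dvd1 gcd_le2_nat le_neq_implies_less not_gr_zero)
  have "\<xi> ^ g = 1" if "\<xi> ^ n = 1" for \<xi> :: 'k
  proof -
    have "\<xi> ^ (r * x) = 1" using all[OF that] by (simp add: power_mult)
    moreover have "\<xi> ^ (n * y + g) = \<xi> ^ g" using that by (simp add: power_add power_mult)
    ultimately show ?thesis using xy by (simp add: g_def)
  qed
  then have sub: "{\<xi>::'k. \<xi> ^ n = 1} \<subseteq> {\<xi>. \<xi> ^ g = 1}" by auto
  define p :: "'k poly" where "p = Polynomial.monom 1 g - 1"
  have "coeff p g = 1" using g by (simp add: p_def)
  then have "p \<noteq> 0" by auto
  have "degree p \<le> g" unfolding p_def by (rule degree_diff_le) (auto simp: degree_monom_le)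
  have "{\<xi>::'k. \<xi> ^ g = 1} = {x. poly p x = 0}" by (auto simp: p_def poly_monom)
  then have "card {\<xi>::'k. \<xi> ^ g = 1} \<le> g"
    using card_poly_roots_bound[OF \<open>p \<noteq> 0\<close>] \<open>degree p \<le> g\<close> by simp
  moreover have "card {\<xi>::'k. \<xi> ^ n = 1} = n" by (rule card_nth_roots_alg_closed[OF n]) simp
  moreover have "card {\<xi>::'k. \<xi> ^ n = 1} \<le> card {\<xi>::'k. \<xi> ^ g = 1}"
    by (rule card_mono[OF finite_nth_roots_field[OF g(1)] sub])
  ultimately show False using g by simp
qed

text \<open>
  The scaling by \<open>\<xi>\<close> multiplies the coefficient at \<open>r\<close> by \<open>\<xi>\<^sup>r\<close>.
\<close>

lemma coeff_scale_invariant: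
  fixes p :: "'k::alg_closed_field poly"
  assumes n: "of_nat n \<noteq> (0::'k)" and inv: "\<And>\<xi>. \<xi> ^ n = 1 \<Longrightarrow> p \<circ>\<^sub>p [:0, \<xi>:] = p"
    and r: "\<not> n dvd r"
  shows "coeff p r = 0"
proof -
  obtain \<xi> :: 'k where "\<xi> ^ n = 1" "\<xi> ^ r \<noteq> 1"
    using exists_root_of_unity_neq[OF n r] by blast
  then have "\<xi> ^ r * coeff p r = coeff p r"
    using inv[of \<xi>] by (metis coeff_pcompose_linear)
  then show ?thesis using \<open>\<xi> ^ r \<noteq> 1\<close> by simp
qed

lemma poly_scale_invariant:
  fixes p :: "'k::alg_closed_field poly"
  assumes n: "of_nat n \<noteq> (0::'k)" and inv: "\<And>\<xi>. \<xi> ^ n = 1 \<Longrightarrow> p \<circ>\<^sub>p [:0, \<xi>:] = p"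
    and D: "degree p \<le> n * D"
  shows "poly p x = (\<Sum>i\<le>D. coeff p (n * i) * (x ^ n) ^ i)"
proof -
  have n0: "n > 0" using n by (auto intro: Nat.gr0I)
  have "poly p x = (\<Sum>r\<le>n * D. coeff p r * x ^ r)"
    unfolding poly_altdef using D
    by (intro sum.mono_neutral_left) (auto simp: coeff_eq_0)
  also have "\<dots> = (\<Sum>r\<in>(\<lambda>i. n * i) ` {..D}. coeff p r * x ^ r)"
  proof (rule sum.mono_neutral_right)
    show "\<forall>r\<in>{..n * D} - (\<lambda>i. n * i) ` {..D}. coeff p r * x ^ r = 0"
    proof
      fix r assume r: "r \<in> {..n * D} - (\<lambda>i. n * i) ` {..D}"
      have "\<not> n dvd r"
      proof
        assume "n dvd r"
        then obtain i where "r = n * i" by (elim dvdE)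
        then show False using r n0 by auto
      qed
      then show "coeff p r * x ^ r = 0" using coeff_scale_invariant[OF n inv] by simp
    qed
  qed auto
  also have "\<dots> = (\<Sum>i\<le>D. coeff p (n * i) * x ^ (n * i))"
    using n0 by (subst sum.reindex) (auto simp: inj_on_def)
  finally show ?thesis by (simp add: power_mult)
qed

lemma scale_invariant_poly:
  fixes p :: "'k::alg_closed_field poly"
  assumes n: "of_nat n \<noteq> (0::'k)" and inv: "\<And>\<xi>. \<xi> ^ n = 1 \<Longrightarrow> p \<circ>\<^sub>p [:0, \<xi>:] = p"
  shows "\<exists>p'. to_fract p = ev p' (gen ^ n)"
proof -
  have n0: "n > 0" using n by (auto intro: Nat.gr0I)
  define p' where "p' = (\<Sum>i\<le>degree p. Polynomial.monom (coeff p (n * i)) i)"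
  have "p = p' \<circ>\<^sub>p Polynomial.monom 1 n"
  proof (rule poly_eqI_cofinite[of "{}"])
    fix x
    have "degree p \<le> n * degree p" using n0 by simp
    from poly_scale_invariant[OF n inv this] show "poly p x = poly (p' \<circ>\<^sub>p Polynomial.monom 1 n) x"
      by (simp add: p'_def poly_pcompose poly_sum poly_monom)
  qed simp
  then have "to_fract p = ev (p' \<circ>\<^sub>p Polynomial.monom 1 n) gen" by simp
  then show ?thesis unfolding ev_pcompose ev_monom by auto
qed

lemma scale_not_const: "c \<noteq> 0 \<Longrightarrow> cst c * gen \<notin> range cst"
proof
  assume "c \<noteq> 0" "cst c * gen \<in> range cst"
  then obtain d where "cst c * gen = cst d" by auto
  then have "gen = cst (d / c)" using \<open>c \<noteq> 0\<close> by (simp add: field_simps)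
  then show False by (simp only: gen_not_cst)
qed

lemma subst_scale_to_fract:
  fixes c :: "'k::alg_closed_field"
  assumes "c \<noteq> 0"
  shows "subst_gen (cst c * gen) (to_fract p) = to_fract (p \<circ>\<^sub>p [:0, c:])"
proof -
  note nc = scale_not_const[OF assms]
  have "subst_gen (cst c * gen) (to_fract p) = ev p (cst c * gen)"
    unfolding k_endo_to_fract[OF k_endo_subst_gen[OF nc]] subst_gen_gen[OF nc] ..
  also have "ev p (cst c * gen) = ev p (ev [:0, c:] gen)" by (simp del: ev_gen add: mult.commute)
  also have "\<dots> = to_fract (p \<circ>\<^sub>p [:0, c:])"
    using ev_pcompose[of p "[:0, c:]" gen] by (simp only: ev_gen)
  finally show ?thesis .
qed

lemma pcompose_prod: "(prod f A) \<circ>\<^sub>p q = (\<Prod>a\<in>A. f a \<circ>\<^sub>p q)"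
  by (induction A rule: infinite_finite_induct) (auto simp: pcompose_mult pcompose_1)

lemma pcompose_scale: "p \<circ>\<^sub>p [:0, a:] \<circ>\<^sub>p [:0, b:] = p \<circ>\<^sub>p [:0, a * b:]"
  for p :: "'k::comm_ring_1 poly"
  by (simp add: pcompose_assoc[symmetric] pcompose_pCons mult.commute)

text \<open>
  Multiplication by \<open>\<xi>\<close> permutes the roots of unity; norms are therefore invariant.
\<close>

lemma prod_roots_of_unity_shift:
  fixes f :: "'k::field \<Rightarrow> 'b::comm_monoid_mult"
  assumes "\<xi> ^ n = 1" "n > 0"
  shows "(\<Prod>z\<in>{z. z ^ n = 1}. f (z * \<xi>)) = (\<Prod>z\<in>{z. z ^ n = 1}. f z)"
proof -
  have "\<xi> \<noteq> 0" using assms by (auto simp: zero_power)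
  then show ?thesis
    using assms
    by (intro prod.reindex_bij_witness[of _ "\<lambda>z. z / \<xi>" "\<lambda>z. z * \<xi>"])
      (auto simp: power_mult_distrib power_divide)
qed

text \<open>
  If the denominator is replaced by its norm, which is invariant, then the numerator is invariant, too,
  and the statement for polynomials applies to both.
\<close>

lemma scale_invariant_fract:
  fixes x :: "'k::alg_closed_field poly fract"
  assumes n: "of_nat n \<noteq> (0::'k)"
    and inv: "\<And>\<xi>. \<xi> ^ n = 1 \<Longrightarrow> subst_gen (cst \<xi> * gen) x = x"
  shows "x \<in> kgen (gen ^ n)"
proof -
  have n0: "n > 0" using n by (auto intro: Nat.gr0I)
  let ?M = "{z::'k. z ^ n = 1}"
  have fin: "finite ?M" by (rule finite_nth_roots_field[OF n0])
  obtain a b where b: "b \<noteq> 0" and x: "x = ev a gen / ev b gen" by (rule fract_cases)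
  define B where "B = (\<Prod>z\<in>?M. b \<circ>\<^sub>p [:0, z:])"
  define b2 where "b2 = (\<Prod>z\<in>?M - {1}. b \<circ>\<^sub>p [:0, z:])"
  have one: "b \<circ>\<^sub>p [:0, 1:] = b" by (simp add: pcompose_idR)
  have B: "B = b * b2" unfolding B_def b2_def using fin one by (subst prod.remove[of _ 1]) auto
  have Binv: "B \<circ>\<^sub>p [:0, \<xi>:] = B" if "\<xi> ^ n = 1" for \<xi>
    unfolding B_def pcompose_prod pcompose_scale
    by (rule prod_roots_of_unity_shift[OF that n0])
  have "b \<circ>\<^sub>p [:0, z:] \<noteq> 0" if "z ^ n = 1" for z
  proof -
    have "z \<noteq> 0" using that n0 by (auto simp: zero_power)
    then show ?thesis using b by (subst pcompose_eq_0_iff) auto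
  qed
  then have "B \<noteq> 0" unfolding B_def using fin by simp
  have xB: "x * to_fract B = to_fract (a * b2)"
    using b unfolding x B by simp
  have Ninv: "(a * b2) \<circ>\<^sub>p [:0, \<xi>:] = a * b2" if "\<xi> ^ n = 1" for \<xi>
  proof -
    have "\<xi> \<noteq> 0" using that n0 by (auto simp: zero_power)
    let ?s = "subst_gen (cst \<xi> * gen)"
    have s: "k_endo ?s" by (rule k_endo_subst_gen[OF scale_not_const[OF \<open>\<xi> \<noteq> 0\<close>]])
    have "?s (x * to_fract B) = x * to_fract B"
      using inv[OF that] Binv[OF that] by (simp add: k_endo_mult[OF s] subst_scale_to_fract[OF \<open>\<xi> \<noteq> 0\<close>])
    then show ?thesis
      unfolding xB subst_scale_to_fract[OF \<open>\<xi> \<noteq> 0\<close>] by (simp only: to_fract_eq_iff)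
  qed
  obtain B' where B': "to_fract B = ev B' (gen ^ n)" using scale_invariant_poly[OF n Binv] by blast
  obtain N' where N': "to_fract (a * b2) = ev N' (gen ^ n)" using scale_invariant_poly[OF n Ninv] by blast
  have "x = ev N' (gen ^ n) / ev B' (gen ^ n)"
    using xB \<open>B \<noteq> 0\<close> unfolding N' [symmetric] B'[symmetric] by (simp add: field_simps)
  then show ?thesis using \<open>B \<noteq> 0\<close> B' by (auto intro!: kgen_evI)
qed

section \<open>The dihedral extension\<close>

text \<open>
  The function \<open>s\<^sup>m - s\<^sup>-\<^sup>m\<close> is the quotient map of the line by the dihedral group of all \<open>s \<mapsto> z s\<close> and
  \<open>s \<mapsto> h/s\<close> with \<open>z\<^sup>m = 1\<close> and \<open>h\<^sup>m = -1\<close>. Below, \<open>\<zeta>\<close> is a primitive root of unity of order \<open>m\<close> and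
  \<open>\<eta>\<close> is one of the \<open>h\<close>.
\<close>

definition dih_fun :: "nat \<Rightarrow> 'k::field poly fract \<Rightarrow> 'k poly fract" where
  "dih_fun m x = x ^ m - inverse (x ^ m)"

context
  fixes m :: nat and \<zeta> \<eta> :: "'k::alg_closed_field"
  assumes m: "of_nat m \<noteq> (0::'k)" and two: "(2::'k) \<noteq> 0"
    and \<zeta>: "\<zeta> ^ m = 1" and \<eta>: "\<eta> ^ m = - 1"
    and prim: "\<And>z::'k. z ^ m = 1 \<Longrightarrow> \<exists>i. z = \<zeta> ^ i"
    and ord: "\<And>i j. i < m \<Longrightarrow> j < m \<Longrightarrow> \<zeta> ^ i = \<zeta> ^ j \<Longrightarrow> i = j"
begin

private abbreviation u where "u \<equiv> dih_fun m (gen :: 'k poly fract)"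
private abbreviation G where "G \<equiv> Gal kS (kgen u)"

private lemma m0: "m > 0" using m by (auto intro: Nat.gr0I)

private lemma nz: "\<zeta> \<noteq> 0" "\<eta> \<noteq> 0" using \<zeta> \<eta> m0 by (auto simp: zero_power)

private lemma inv_not_const: "c \<noteq> 0 \<Longrightarrow> cst (c::'k) / gen \<notin> range cst"
proof
  assume "c \<noteq> 0" "cst c / gen \<in> range cst"
  then obtain d where d: "cst c / gen = cst d" by auto
  then have cd: "cst c = cst d * gen" by (simp add: field_simps)
  then have "d \<noteq> 0" using \<open>c \<noteq> 0\<close> by auto
  then have "gen = cst (c / d)" using cd by (simp add: field_simps)
  then show False by (simp only: gen_not_cst)
qed

private lemma endo_scale: "c \<noteq> 0 \<Longrightarrow> k_endo (subst_gen (cst c * (gen :: 'k poly fract)))"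
  and endo_inv: "c \<noteq> 0 \<Longrightarrow> k_endo (subst_gen (cst c / (gen :: 'k poly fract)))"
  and gen_scale: "c \<noteq> 0 \<Longrightarrow> subst_gen (cst c * (gen :: 'k poly fract)) gen = cst c * gen"
  and gen_inv: "c \<noteq> 0 \<Longrightarrow> subst_gen (cst c / (gen :: 'k poly fract)) gen = cst c / gen"
  by (simp_all add: k_endo_subst_gen subst_gen_gen scale_not_const inv_not_const)

private lemma Gal_iff: "\<sigma> \<in> carrier G \<longleftrightarrow> bij \<sigma> \<and> k_endo \<sigma> \<and> \<sigma> u = u"
proof -
  have "range cst \<subseteq> kgen u" using subfld_cst[OF subfld_kgen] by auto
  from Gal_kS_iff[OF this] show ?thesis using k_endo_fixes_kgen[of \<sigma> u] by blast
qed

private lemma endo_u: "k_endo \<sigma> \<Longrightarrow> \<sigma> u = \<sigma> gen ^ m - inverse (\<sigma> gen ^ m)"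
  by (simp add: dih_fun_def k_endo_diff k_endo_power k_endo_inverse)

private lemma scale_Gal: "z ^ m = 1 \<Longrightarrow> subst_gen (cst z * gen) \<in> carrier G"
proof -
  assume z: "z ^ m = 1"
  then have z0: "z \<noteq> 0" using m0 by (auto simp: zero_power)
  have c: "subst_gen (cst a * gen) \<circ> subst_gen (cst b * gen) = id"
    if a: "a \<noteq> 0" and b: "b \<noteq> 0" and ab: "b * a = 1" for a b :: 'k
  proof (rule k_endo_eqI[OF k_endo_comp k_endo_id])
    show "k_endo (subst_gen (cst a * gen))" "k_endo (subst_gen (cst b * gen))"
      by (rule endo_scale[OF a], rule endo_scale[OF b])
    show "(subst_gen (cst a * gen) \<circ> subst_gen (cst b * gen)) gen = id gen"
      unfolding o_apply gen_scale[OF b] k_endo_mult[OF endo_scale[OF a]] k_endo_cst[OF endo_scale[OF a]]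
        gen_scale[OF a] using ab by (simp flip: mult.assoc cst_simps(4))
  qed
  have "bij (subst_gen (cst z * gen))"
    by (rule o_bij[OF c[of "inverse z" z] c[of z "inverse z"]]) (use z0 in auto)
  moreover have "(cst z * gen) ^ m = gen ^ m"
    unfolding power_mult_distrib cst_power[symmetric] z by simp
  ultimately show ?thesis
    unfolding Gal_iff endo_u[OF endo_scale[OF z0]] gen_scale[OF z0]
    using endo_scale[OF z0] by (simp add: dih_fun_def)
qed

private lemma inv_Gal: "h ^ m = - 1 \<Longrightarrow> subst_gen (cst h / gen) \<in> carrier G"
proof -
  assume h: "h ^ m = - 1"
  then have h0: "h \<noteq> 0" using m0 by (auto simp: zero_power)
  have c: "subst_gen (cst h / gen) \<circ> subst_gen (cst h / gen) = id"
  proof (rule k_endo_eqI[OF k_endo_comp k_endo_id])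
    show "k_endo (subst_gen (cst h / gen))" "k_endo (subst_gen (cst h / gen))"
      using h0 by (auto intro: endo_inv)
    show "(subst_gen (cst h / gen) \<circ> subst_gen (cst h / gen)) gen = id gen"
      using h0 by (simp add: gen_inv k_endo_divide[OF endo_inv] k_endo_cst[OF endo_inv])
  qed
  have "bij (subst_gen (cst h / gen))" by (rule o_bij[OF c c])
  moreover have "(cst h / gen) ^ m = - inverse (gen ^ m)"
    unfolding power_divide cst_power[symmetric] h by (simp add: divide_inverse)
  ultimately show ?thesis
    unfolding Gal_iff endo_u[OF endo_inv[OF h0]] gen_inv[OF h0]
    using endo_inv[OF h0] by (simp add: dih_fun_def)
qed

text \<open>
  If \<open>\<sigma>\<close> fixes \<open>u\<close>, then the \<open>m\<close>-th powers of \<open>\<sigma> s\<close> and of \<open>s\<close> are roots of the same quadratic equation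
  \<open>Y\<^sup>2 - u Y - 1 = 0\<close>, whose roots are \<open>s\<^sup>m\<close> and \<open>-s\<^sup>-\<^sup>m\<close>.
\<close>

private lemma Gal_cases:
  assumes "\<sigma> \<in> carrier G"
  shows "(\<exists>z. z ^ m = 1 \<and> \<sigma> = subst_gen (cst z * gen)) \<or> (\<exists>h. h ^ m = - 1 \<and> \<sigma> = subst_gen (cst h / gen))"
proof -
  have \<sigma>: "k_endo \<sigma>" "\<sigma> u = u" using assms Gal_iff by auto
  define A where "A = (gen :: 'k poly fract) ^ m"
  define T where "T = \<sigma> gen"
  have T0: "T \<noteq> 0" using k_endo_eq_0[OF \<sigma>(1), of gen] by (simp add: T_def)
  have A0: "A \<noteq> 0" by (simp add: A_def)
  have "T ^ m - inverse (T ^ m) = A - inverse A"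
    using endo_u[OF \<sigma>(1)] \<sigma>(2) by (simp add: T_def A_def dih_fun_def)
  then have "(T ^ m - A) * (T ^ m * A + 1) = 0"
    using T0 A0 by (simp add: field_simps)
  then consider "T ^ m = A" | "T ^ m * A = - 1" by (auto simp: eq_neg_iff_add_eq_0)
  then show ?thesis
  proof cases
    case 1
    then have "(T / gen) ^ m = cst 1" by (simp add: power_divide A_def)
    from root_of_const_imp_const[OF this m0] obtain z where "T / gen = cst z" by auto
    then have Tz: "T = cst z * gen" by (simp add: field_simps)
    have "cst (z ^ m) = cst 1"
      using 1 unfolding Tz A_def by (simp add: power_mult_distrib)
    then have z: "z ^ m = 1" by (simp only: cst_simps)
    then have "z \<noteq> 0" using m0 by (auto simp: zero_power)
    have "\<sigma> = subst_gen (cst z * gen)"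
      by (rule k_endo_eqI[OF \<sigma>(1) endo_scale[OF \<open>z \<noteq> 0\<close>]]) (use Tz gen_scale[OF \<open>z \<noteq> 0\<close>] in \<open>simp add: T_def\<close>)
    then show ?thesis using z by blast
  next
    case 2
    then have "(T * gen) ^ m = cst (- 1)" by (simp add: power_mult_distrib A_def)
    from root_of_const_imp_const[OF this m0] obtain h where h: "T * gen = cst h" by auto
    then have Th: "T = cst h / gen" by (simp add: field_simps)
    have "cst (h ^ m) = cst (- 1)"
      using 2 h unfolding A_def by (metis cst_power cst_simps(2,5) power_mult_distrib)
    then have hm: "h ^ m = - 1" by (simp only: cst_simps(7))
    then have "h \<noteq> 0" using m0 by (auto simp: zero_power)
    have "\<sigma> = subst_gen (cst h / gen)"
      by (rule k_endo_eqI[OF \<sigma>(1) endo_inv[OF \<open>h \<noteq> 0\<close>]]) (use Th gen_inv[OF \<open>h \<noteq> 0\<close>] in \<open>simp add: T_def\<close>)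
    then show ?thesis using hm by blast
  qed
qed

text \<open>
  The invariants of the scalings form \<open>k(A)\<close> with \<open>A = s\<^sup>m\<close>. As \<open>A\<close> is a root of \<open>Y\<^sup>2 - u Y - 1\<close>, every
  element of \<open>k(A)\<close> has the form \<open>a + b A\<close> with \<open>a\<close> and \<open>b\<close> in \<open>k(u)\<close>. The involution \<open>s \<mapsto> \<eta>/s\<close> sends
  \<open>A\<close> to the other root \<open>-1/A\<close>, so an invariant element has \<open>b = 0\<close>.
\<close>

lemma dih_fixed_field:
  assumes "\<And>\<sigma>. \<sigma> \<in> carrier G \<Longrightarrow> \<sigma> x = x"
  shows "x \<in> kgen u"
proof -
  define A where "A = (gen :: 'k poly fract) ^ m"
  have A0: "A \<noteq> 0" by (simp add: A_def)
  have uA: "u = A - inverse A" by (simp add: dih_fun_def A_def)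
  have AA: "A * A = u * A + 1" using A0 by (simp add: uA algebra_simps)
  let ?t = "subst_gen (cst \<eta> / (gen :: 'k poly fract))"
  have t: "k_endo ?t" by (rule endo_inv[OF nz(2)])
  have tA: "?t A = - inverse A"
    unfolding A_def k_endo_power[OF t] gen_inv[OF nz(2)]
    unfolding power_divide cst_power[symmetric] \<eta> by (simp add: divide_inverse)
  have tk: "?t y = y" if "y \<in> kgen u" for y
    using inv_Gal[OF \<eta>] that k_endo_fixes_kgen[OF t] unfolding Gal_iff by blast
  define W where "W = {a + b * A | a b. a \<in> kgen u \<and> b \<in> kgen u}"
  note K = subfld_kgen[of u]
  have uK: "u \<in> kgen u" by (rule kgen_self)
  have WI: "a + b * A \<in> W" if "a \<in> kgen u" "b \<in> kgen u" for a b
    using that by (auto simp: W_def)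
  have AI: "A * inverse A = 1" using A0 by simp
  have "subfld W"
    unfolding subfld_def
  proof (intro conjI ballI)
    show "range cst \<subseteq> W"
      using WI[OF subfld_cst[OF K] subfld_01(1)[OF K]] by auto
    fix y z assume "y \<in> W" "z \<in> W"
    then obtain a b c d where y: "y = a + b * A" "a \<in> kgen u" "b \<in> kgen u"
      and z: "z = c + d * A" "c \<in> kgen u" "d \<in> kgen u" by (auto simp: W_def)
    have "y + z = (a + c) + (b + d) * A" unfolding y z by (simp add: algebra_simps)
    then show "y + z \<in> W" using WI[OF subfld_add[OF K y(2) z(2)] subfld_add[OF K y(3) z(3)]] by simp
    have "y * z = a * c + (a * d + b * c) * A + b * d * (A * A)" unfolding y z by (simp add: algebra_simps)
    also have "\<dots> = (a * c + b * d) + (a * d + b * c + b * d * u) * A"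
      unfolding AA by (simp add: algebra_simps)
    also have "\<dots> \<in> W"
      by (intro WI subfld_add[OF K] subfld_mult[OF K] y z uK)
    finally show "y * z \<in> W" .
  next
    fix y assume "y \<in> W"
    then obtain a b where y: "y = a + b * A" "a \<in> kgen u" "b \<in> kgen u" by (auto simp: W_def)
    show "inverse y \<in> W"
    proof (cases "y = 0")
      case True
      then show ?thesis using \<open>y \<in> W\<close> by simp
    next
      case False
      \<comment> \<open>the norm of the element down to the field generated by u\<close>
      define N where "N = a * a + a * b * u - b * b"
      have ty: "?t y = a - b * inverse A"
        unfolding y(1) k_endo_add[OF t] k_endo_mult[OF t] tA tk[OF y(2)] tk[OF y(3)] by simp
      have "?t y \<noteq> 0" using False k_endo_eq_0[OF t] by simp
      have "(a + b * A) * (a - b * I) = a * a + a * b * (A - I) - b * b * (A * I)" for I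
        by (simp add: algebra_simps)
      from this[of "inverse A"] have yN: "y * ?t y = N"
        unfolding ty unfolding y(1) N_def uA AI by simp
      then have "N \<noteq> 0" using False \<open>?t y \<noteq> 0\<close> by (metis mult_eq_0_iff)
      have "?t y = (a + b * u) + (- b) * A" unfolding ty uA by (simp add: algebra_simps)
      moreover have "inverse y = ?t y / N"
        unfolding yN[symmetric] using False \<open>?t y \<noteq> 0\<close> by (simp add: divide_inverse)
      ultimately have "inverse y = (a + b * u) / N + (- b / N) * A"
        by (simp add: add_divide_distrib diff_divide_distrib)
      moreover have "N \<in> kgen u" unfolding N_def
        using y uK by (intro subfld_diff[OF K] subfld_add[OF K] subfld_mult[OF K])
      then have "(a + b * u) / N \<in> kgen u" "- b / N \<in> kgen u"
        using y uK by (auto intro!: subfld_divide[OF K] subfld_add[OF K] subfld_mult[OF K] subfld_uminus[OF K])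
      ultimately show ?thesis using WI by metis
    qed
  qed
  moreover have "A \<in> W"
    using WI[OF subfld_01[OF K]] by simp
  ultimately have "kgen A \<subseteq> W" by (rule kgen_least)
  moreover have "x \<in> kgen A" unfolding A_def
    by (rule scale_invariant_fract[OF m]) (rule assms[OF scale_Gal])
  ultimately obtain a b where x: "x = a + b * A" "a \<in> kgen u" "b \<in> kgen u" by (auto simp: W_def)
  have "?t x = a - b * inverse A"
    unfolding x(1) k_endo_add[OF t] k_endo_mult[OF t] tA tk[OF x(2)] tk[OF x(3)] by simp
  then have "b * (A + inverse A) = 0" using assms[OF inv_Gal[OF \<eta>]] x(1) by (simp add: algebra_simps)
  moreover have "A + inverse A \<noteq> 0"
  proof
    assume "A + inverse A = 0"
    then have "A * (A + inverse A) = 0" by simp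
    then have "A * A = - 1" using AI by (simp add: distrib_left eq_neg_iff_add_eq_0)
    then have "gen ^ (2 * m) = cst (- 1 :: 'k)"
      by (simp add: A_def mult_2 power_add)
    from root_of_const_imp_const[OF this] m0 show False by auto
  qed
  ultimately have "b = 0" by simp
  then show ?thesis using x by simp
qed

text \<open>
  The extension is algebraic because \<open>s\<close> is a root of \<open>Y\<^sup>2\<^sup>m - u Y\<^sup>m - 1\<close>.
\<close>

lemma dih_galois_extension: "galois_extension kS (kgen u)"
  unfolding galois_extension_def
proof (intro conjI ballI)
  show "field (kS :: 'k poly fract ring)" by (rule field_type_algebra)
  show sf: "subfield (kgen u) kS" by (rule subfield_kS[OF subfld_kgen])
  show "{x \<in> carrier kS. \<forall>\<sigma>\<in>carrier G. \<sigma> x = x} = kgen u"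
    using dih_fixed_field by (auto simp: Gal_mem_iff)
  interpret R: field "kS :: 'k poly fract ring" by (rule field_type_algebra)
  define P where "P = Polynomial.monom (1::'k poly fract) (2 * m) - Polynomial.monom u m - 1"
  note K = subfld_kgen[of u]
  have "R.algebraic (kgen u) gen"
  proof (rule algebraic_kS[OF K])
    show "coeff P i \<in> kgen u" for i
      unfolding P_def coeff_diff coeff_monom coeff_1
      by (intro subfld_diff[OF K]) (auto simp: subfld_01[OF K] kgen_self)
    have "coeff P (2 * m) = 1" using m0 by (simp add: P_def)
    then show "P \<noteq> 0" by auto
    show "poly P gen = 0"
    proof -
      have "gen ^ (2 * m) = gen ^ m * (gen ^ m :: 'k poly fract)" by (simp add: mult_2 power_add)
      then show ?thesis by (simp add: P_def poly_monom dih_fun_def left_diff_distrib)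
    qed
  qed
  have sa: "subfield {x \<in> carrier kS. (R.algebraic over (kgen u)) x} kS"
    by (rule R.subfield_of_algebraics[OF sf])
  have "subfld {x. (R.algebraic over (kgen u)) x}"
    unfolding subfld_def
  proof (intro conjI ballI)
    show "range cst \<subseteq> {x. (R.algebraic over kgen u) x}"
      using R.algebraic_self[OF subfieldE(1)[OF sf]] subfld_cst[OF K] by auto
    show "x + y \<in> {x. (R.algebraic over kgen u) x}" "x * y \<in> {x. (R.algebraic over kgen u) x}"
      if "x \<in> {x. (R.algebraic over kgen u) x}" "y \<in> {x. (R.algebraic over kgen u) x}" for x y
      using subringE(6,7)[OF subfieldE(1)[OF sa], of x y] that by simp_all
    show "inverse x \<in> {x. (R.algebraic over kgen u) x}" if "x \<in> {x. (R.algebraic over kgen u) x}" for x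
    proof (cases "x = 0")
      case False
      then show ?thesis
        using R.subfield_m_inv(1)[OF sa, of x] that by (simp add: m_inv_type_algebra)
    qed (use that in simp)
  qed
  then have "{x. (R.algebraic over (kgen u)) x} = UNIV"
    by (rule subfld_gen_UNIV) (use \<open>R.algebraic (kgen u) gen\<close> in \<open>simp add: over_def\<close>)
  then show "R.algebraic (kgen u) x" for x by (auto simp: over_def)
qed

lemma dih_Gal_iso: "G \<cong> dihedral_group (2 * m)"
proof (rule dihedral_iso[OF m0])
  let ?a = "subst_gen (cst \<zeta> * (gen :: 'k poly fract))" and ?b = "subst_gen (cst \<eta> / (gen :: 'k poly fract))"
  show "group G" by (rule group_Gal) (auto simp: ring_type_algebra)
  then interpret G: group G .
  show a: "?a \<in> carrier G" by (rule scale_Gal[OF \<zeta>])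
  show b: "?b \<in> carrier G" by (rule inv_Gal[OF \<eta>])
  have endo: "\<And>\<sigma>. \<sigma> \<in> carrier G \<Longrightarrow> k_endo \<sigma>" by (simp add: Gal_iff)
  have one: "\<one>\<^bsub>G\<^esub> = id" by (simp add: Gal_def BijGroup_def fun_eq_iff)
  have mult: "\<sigma> \<otimes>\<^bsub>G\<^esub> \<tau> = \<sigma> \<circ> \<tau>" if "\<sigma> \<in> carrier G" "\<tau> \<in> carrier G" for \<sigma> \<tau>
    by (rule Gal_kS_mult[OF that])
  have eqI: "\<sigma> = \<tau>" if "\<sigma> \<in> carrier G" "\<tau> \<in> carrier G" "\<sigma> gen = \<tau> gen" for \<sigma> \<tau>
    using that by (intro k_endo_eqI endo)
  have pow: "(?a [^]\<^bsub>G\<^esub> i) gen = cst (\<zeta> ^ i) * gen" for i :: nat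
  proof (induction i)
    case (Suc i)
    have ai: "?a [^]\<^bsub>G\<^esub> i \<in> carrier G" using a by simp
    show ?case
      using Suc by (simp add: mult[OF ai a] gen_scale[OF nz(1)] k_endo_mult[OF endo[OF ai]]
          k_endo_power[OF endo[OF ai]] k_endo_cst[OF endo[OF ai]])
  qed (simp add: one)
  have powc: "?a [^]\<^bsub>G\<^esub> i \<in> carrier G" for i :: nat using a by simp
  have powb: "(?a [^]\<^bsub>G\<^esub> i \<otimes>\<^bsub>G\<^esub> ?b) gen = cst (\<eta> / \<zeta> ^ i) / gen" for i :: nat
    by (simp add: mult[OF powc b] gen_inv[OF nz(2)] k_endo_divide[OF endo[OF powc]]
        k_endo_cst[OF endo[OF powc]] pow del: cst_power) 
  show "?a [^]\<^bsub>G\<^esub> m = \<one>\<^bsub>G\<^esub>"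
    by (rule eqI[OF powc G.one_closed]) (use pow[of m] \<zeta> in \<open>simp add: one del: cst_power\<close>)
  show "?b \<otimes>\<^bsub>G\<^esub> ?b = \<one>\<^bsub>G\<^esub>"
  proof (rule eqI)
    show "(?b \<otimes>\<^bsub>G\<^esub> ?b) gen = \<one>\<^bsub>G\<^esub> gen"
      using nz by (simp add: mult[OF b b] one gen_inv k_endo_divide[OF endo[OF b]] k_endo_cst[OF endo[OF b]])
  qed (use b in auto)
  show "?a \<otimes>\<^bsub>G\<^esub> ?b \<otimes>\<^bsub>G\<^esub> (?a \<otimes>\<^bsub>G\<^esub> ?b) = \<one>\<^bsub>G\<^esub>"
  proof (rule eqI)
    have ab: "?a \<otimes>\<^bsub>G\<^esub> ?b \<in> carrier G" using a b by simp
    have abg: "(?a \<otimes>\<^bsub>G\<^esub> ?b) gen = cst (\<eta> / \<zeta>) / gen" using powb[of 1] a by simp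
    show "(?a \<otimes>\<^bsub>G\<^esub> ?b \<otimes>\<^bsub>G\<^esub> (?a \<otimes>\<^bsub>G\<^esub> ?b)) gen = \<one>\<^bsub>G\<^esub> gen"
      unfolding mult[OF ab ab] o_apply abg k_endo_divide[OF endo[OF ab]] k_endo_cst[OF endo[OF ab]]
      using nz by (simp add: one)
  qed (use a b in auto)
  show "\<exists>i::nat. g = ?a [^]\<^bsub>G\<^esub> i \<or> g = ?a [^]\<^bsub>G\<^esub> i \<otimes>\<^bsub>G\<^esub> ?b" if g: "g \<in> carrier G" for g
    using Gal_cases[OF g]
  proof (elim disjE exE conjE)
    fix z :: 'k assume z: "z ^ m = 1" "g = subst_gen (cst z * gen)"
    then have z0: "z \<noteq> 0" using m0 by (auto simp: zero_power)
    obtain i where "z = \<zeta> ^ i" using prim[OF z(1)] by blast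
    then have "g = ?a [^]\<^bsub>G\<^esub> i"
      using g z z0 powc by (intro eqI) (auto simp: pow gen_scale simp del: cst_power)
    then show ?thesis by blast
  next
    fix h :: 'k assume h: "h ^ m = - 1" "g = subst_gen (cst h / gen)"
    then have h0: "h \<noteq> 0" using m0 by (auto simp: zero_power)
    have "(\<eta> / h) ^ m = 1" using h \<eta> by (simp add: power_divide)
    then obtain i where i: "\<eta> / h = \<zeta> ^ i" using prim by blast
    then have "h = \<eta> / \<zeta> ^ i" using h0 nz by (simp add: field_simps)
    then have "g = ?a [^]\<^bsub>G\<^esub> i \<otimes>\<^bsub>G\<^esub> ?b"
      using g h h0 powc b by (intro eqI) (auto simp: powb gen_inv simp del: cst_power cst_divide)
    then show ?thesis by blast
  qed
  show "i = j" if "i < m" "j < m" "?a [^]\<^bsub>G\<^esub> i = ?a [^]\<^bsub>G\<^esub> j" for i j :: nat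
  proof -
    have "cst (\<zeta> ^ i) * gen = cst (\<zeta> ^ j) * gen" using that(3) pow by metis
    then have "\<zeta> ^ i = \<zeta> ^ j" by (simp del: cst_power)
    then show ?thesis by (rule ord[OF that(1,2)])
  qed
  show "?a [^]\<^bsub>G\<^esub> i \<noteq> ?a [^]\<^bsub>G\<^esub> j \<otimes>\<^bsub>G\<^esub> ?b" for i j :: nat
  proof
    assume "?a [^]\<^bsub>G\<^esub> i = ?a [^]\<^bsub>G\<^esub> j \<otimes>\<^bsub>G\<^esub> ?b"
    then have "cst (\<zeta> ^ i) * gen = cst (\<eta> / \<zeta> ^ j) / gen" using pow powb by metis
    then have "gen ^ 2 = cst (\<eta> / \<zeta> ^ j / \<zeta> ^ i)"
      using nz by (simp add: field_simps power2_eq_square)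
    from root_of_const_imp_const[OF this] show False by auto
  qed
qed

end

section \<open>Rational functions that do not define a Galois extension\<close>

text \<open>The numerator of \<open>p (a/b)\<close> for the denominator \<open>b\<^sup>n\<close>.\<close>

definition hom_eval :: "'k::field poly \<Rightarrow> nat \<Rightarrow> 'k poly \<Rightarrow> 'k poly \<Rightarrow> 'k poly" where
  "hom_eval p n a b = (\<Sum>i\<le>n. Polynomial.smult (coeff p i) (a ^ i * b ^ (n - i)))"

lemma to_fract_hom_eval:
  assumes "degree p \<le> n" "b \<noteq> 0"
  shows "to_fract (hom_eval p n a b) = to_fract b ^ n * ev p (to_fract a / to_fract b)"
proof -
  have tp: "to_fract (q ^ k) = to_fract q ^ k" for q :: "'a poly" and k by (induction k) auto
  have ts: "to_fract (sum f A) = (\<Sum>i\<in>A. to_fract (f i))" for f :: "nat \<Rightarrow> 'a poly" and A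
    by (induction A rule: infinite_finite_induct) auto
  have sm: "to_fract (Polynomial.smult c q) = cst c * to_fract q" for c and q :: "'a poly"
    by (simp add: cst_def flip: to_fract_mult)
  have "ev p x = (\<Sum>i\<le>n. cst (coeff p i) * x ^ i)" for x
    unfolding ev_altdef using assms(1)
    by (intro sum.mono_neutral_left) (auto simp: coeff_eq_0)
  moreover have "to_fract (Polynomial.smult (coeff p i) (a ^ i * b ^ (n - i))) =
      to_fract b ^ n * (cst (coeff p i) * (to_fract a / to_fract b) ^ i)" if "i \<le> n" for i
  proof -
    have "to_fract b ^ n = to_fract b ^ i * to_fract b ^ (n - i)"
      using that by (simp flip: power_add)
    then show ?thesis using assms(2) by (simp add: sm tp power_divide)
  qed
  ultimately show ?thesis by (simp add: hom_eval_def ts sum_distrib_left)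
qed

lemma poly_hom_eval_0: "poly b x = 0 \<Longrightarrow> poly (hom_eval p n a b) x = coeff p n * poly a x ^ n"
proof -
  assume b: "poly b x = 0"
  have "poly (hom_eval p n a b) x = (\<Sum>i\<le>n. if i = n then coeff p n * poly a x ^ n else 0)"
    unfolding hom_eval_def poly_sum by (intro sum.cong) (auto simp: b zero_power)
  then show ?thesis by simp
qed

lemma poly_hom_eval_root: "poly a x = 0 \<Longrightarrow> poly (hom_eval p n a b) x = coeff p 0 * poly b x ^ n"
proof -
  assume b: "poly a x = 0"
  have "poly (hom_eval p n a b) x = (\<Sum>i\<le>n. if i = 0 then coeff p 0 * poly b x ^ n else 0)"
    unfolding hom_eval_def poly_sum by (intro sum.cong) (auto simp: b zero_power)
  then show ?thesis by simp
qed

lemma degree_hom_eval_le: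
  assumes "degree a \<le> N" "degree b \<le> N"
  shows "degree (hom_eval p n a b) \<le> n * N"
  unfolding hom_eval_def
proof (rule degree_sum_le)
  fix i assume "i \<in> {..n}"
  have "degree (Polynomial.smult (coeff p i) (a ^ i * b ^ (n - i))) \<le> degree (a ^ i) + degree (b ^ (n - i))"
    using degree_smult_le degree_mult_le le_trans by blast
  also have "\<dots> \<le> i * N + (n - i) * N"
  proof (rule add_mono)
    show "degree (a ^ i) \<le> i * N"
      using order_trans[OF degree_power_le[of a i] mult_le_mono1[OF assms(1), of i]]
      by (simp only: mult.commute)
    show "degree (b ^ (n - i)) \<le> (n - i) * N"
      using order_trans[OF degree_power_le[of b "n - i"] mult_le_mono1[OF assms(2), of "n - i"]]
      by (simp only: mult.commute)
  qed
  also have "\<dots> = n * N" using \<open>i \<in> {..n}\<close> by (simp flip: add_mult_distrib)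
  finally show "degree (Polynomial.smult (coeff p i) (a ^ i * b ^ (n - i))) \<le> n * N" .
qed simp

text \<open>
  Suppose \<open>g\<^sup>M\<close> is the value of a reduced fraction \<open>a/b\<close> at \<open>g/D\<close>. Clearing denominators gives an
  identity of polynomials in \<open>s\<close>. If \<open>b 0 = 0\<close>, then \<open>a 0 \<noteq> 0\<close> and the identity fails at a zero of
  \<open>g\<close>, since \<open>g\<^sup>M\<close> vanishes there. If \<open>b 0 \<noteq> 0\<close>, then the two sides have different degrees, since
  \<open>g\<^sup>M\<close> has a pole at infinity while \<open>g/D\<close> vanishes there.
\<close>

lemma not_in_kgen_of_degrees:
  fixes g D :: "'k::alg_closed_field poly"
  assumes cop: "\<And>x. poly g x = 0 \<Longrightarrow> poly D x \<noteq> 0"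
    and g: "degree g \<ge> 1" and D: "degree D > degree g" and M: "M > 0"
  shows "to_fract g ^ M \<notin> kgen (to_fract g / to_fract D)"
proof
  define f where "f = to_fract g / to_fract D"
  have nz: "g \<noteq> 0" "D \<noteq> 0" using g D by auto
  assume "to_fract g ^ M \<in> kgen (to_fract g / to_fract D)"
  then obtain R1 R2 where R: "to_fract g ^ M = ev R1 f / ev R2 f" "ev R2 f \<noteq> 0"
    by (auto simp: kgen_def f_def)
  have "f \<notin> range cst"
  proof
    assume "f \<in> range cst"
    then obtain c where c: "f = to_fract [:c:]" by (auto simp: cst_def)
    then have "to_fract g = to_fract ([:c:] * D)"
      unfolding to_fract_mult using nz by (simp add: f_def field_simps)
    then have "g = [:c:] * D" by (simp only: to_fract_eq_iff)
    then have "g = Polynomial.smult c D" by simp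
    then show False using D nz by (cases "c = 0") auto
  qed
  then have evnz: "ev p f \<noteq> 0" if "p \<noteq> 0" for p using ev_eq_0_imp that by blast
  obtain a b where ab: "b \<noteq> 0" "to_fract R1 / to_fract R2 = to_fract a / to_fract b"
    "\<And>c. poly a c = 0 \<Longrightarrow> poly b c \<noteq> 0"
    using fract_reduced[of "to_fract R1 / to_fract R2"] by metis
  have "R2 \<noteq> 0" using R by auto
  then have "to_fract (R1 * b) = to_fract (a * R2)"
    using ab by (simp add: field_simps)
  then have "R1 * b = a * R2" by (simp only: to_fract_eq_iff)
  then have "ev R1 f * ev b f = ev a f * ev R2 f" by (metis ev_mult)
  then have ga: "to_fract g ^ M * ev b f = ev a f"
  proof -
    have "to_fract g ^ M * ev R2 f = ev R1 f" using R by simp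
    then have "ev R2 f * (to_fract g ^ M * ev b f) = ev R1 f * ev b f" by (simp add: ac_simps)
    also have "\<dots> = ev R2 f * ev a f"
      using \<open>ev R1 f * ev b f = ev a f * ev R2 f\<close> by (simp add: mult.commute)
    finally show ?thesis using R(2) by (metis mult_left_cancel)
  qed
  define d where "d = max (degree a) (degree b)"
  define Ha where "Ha = hom_eval a d g D"
  define Hb where "Hb = hom_eval b d g D"
  have tp: "to_fract (q ^ k) = to_fract q ^ k" for q :: "'k poly" and k by (induction k) auto
  have "to_fract (g ^ M * Hb) = to_fract Ha"
    unfolding Ha_def Hb_def to_fract_mult tp
    using ga nz by (simp add: to_fract_hom_eval d_def f_def)
  then have eq: "g ^ M * Hb = Ha" by (simp only: to_fract_eq_iff)
  show False
  proof (cases "coeff b 0 = 0")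
    case True
    then have "poly b 0 = 0" by (simp add: poly_0_coeff_0)
    then have a0: "coeff a 0 \<noteq> 0" using ab(3)[of 0] by (auto simp: poly_0_coeff_0)
    obtain x where x: "poly g x = 0" using alg_closed_imp_poly_has_root[of g] g by auto
    have "poly Ha x = coeff a 0 * poly D x ^ d" unfolding Ha_def by (rule poly_hom_eval_root[OF x])
    moreover have "poly Ha x = 0" unfolding eq[symmetric] using x M by simp
    ultimately show False using a0 cop[OF x] by simp
  next
    case False
    let ?N = "degree D"
    have "coeff Hb (d * ?N) = (\<Sum>i\<le>d. if i = 0 then coeff b 0 * lead_coeff D ^ d else 0)"
      unfolding Hb_def hom_eval_def coeff_sum
    proof (rule sum.cong[OF HOL.refl])
      fix i assume i: "i \<in> {..d}"
      show "coeff (Polynomial.smult (coeff b i) (g ^ i * D ^ (d - i))) (d * ?N) =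
        (if i = 0 then coeff b 0 * lead_coeff D ^ d else 0)"
      proof (cases "i = 0")
        case True
        have "coeff (D ^ d) (d * ?N) = lead_coeff (D ^ d)"
          using nz by (simp add: degree_power_eq)
        then show ?thesis using True by (simp add: lead_coeff_power)
      next
        case False
        have "degree (g ^ i * D ^ (d - i)) = i * degree g + (d - i) * ?N"
          using nz by (simp add: degree_mult_eq degree_power_eq)
        also have "\<dots> < i * ?N + (d - i) * ?N" using False D by simp
        also have "\<dots> = d * ?N" using i by (simp flip: add_mult_distrib)
        finally show ?thesis using False by (simp add: coeff_eq_0)
      qed
    qed
    also have "\<dots> = coeff b 0 * lead_coeff D ^ d" by simp
    finally have "coeff Hb (d * ?N) \<noteq> 0" using False nz by simp
    then have dHb: "degree Hb \<ge> d * ?N" "Hb \<noteq> 0" by (auto intro: le_degree)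
    have "degree Ha = M * degree g + degree Hb"
      unfolding eq[symmetric] using nz dHb by (simp add: degree_mult_eq degree_power_eq)
    moreover have "degree Ha \<le> d * ?N" unfolding Ha_def using D by (intro degree_hom_eval_le) auto
    moreover have "M * degree g > 0" using M g by simp
    ultimately show False using dHb by simp
  qed
qed

text \<open>
  Let \<open>M = deg D - deg g \<ge> 2\<close>, the order to which \<open>g/D\<close> vanishes at infinity. Where \<open>\<sigma> s\<close> has a pole,
  \<open>g/D = \<sigma> (g/D)\<close> vanishes to an order at least \<open>M\<close>; but all the finite zeros of \<open>g/D\<close> are simple. So
  \<open>\<sigma> s\<close> is a polynomial \<open>a'\<close>. Comparing zeros and degrees, \<open>\<sigma>\<close> multiplies \<open>g\<close> and \<open>D\<close> by the same
  constant \<open>\<kappa>\<close>. If \<open>c\<close> is the leading coefficient of \<open>a'\<close>, then \<open>\<kappa>\<close> is both the power of \<open>c\<close> with exponent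
  \<open>deg g\<close> and that with exponent \<open>deg D\<close>, whence \<open>c\<^sup>M = 1\<close> and \<open>\<kappa>\<^sup>M = 1\<close>.
\<close>

lemma k_endo_fixing_quotient:
  fixes g D :: "'k::alg_closed_field poly"
  assumes cop: "\<And>x. poly g x = 0 \<Longrightarrow> poly D x \<noteq> 0"
    and sqf: "\<And>x. poly g x = 0 \<Longrightarrow> poly (pderiv g) x \<noteq> 0"
    and g: "degree g \<ge> 1" and D: "degree D \<ge> degree g + 2"
    and \<sigma>: "k_endo \<sigma>" "\<sigma> (to_fract g / to_fract D) = to_fract g / to_fract D"
  shows "\<sigma> (to_fract g ^ (degree D - degree g)) = to_fract g ^ (degree D - degree g)"
proof -
  define e where "e = degree g"
  define N where "N = degree D"
  define M where "M = N - e"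
  have M2: "M \<ge> 2" and NM: "N = e + M" using D by (auto simp: M_def N_def e_def)
  have nz: "g \<noteq> 0" "D \<noteq> 0" using g D by auto
  have tp: "to_fract (q ^ k) = to_fract q ^ k" for q :: "'k poly" and k by (induction k) auto
  obtain a b where ab: "b \<noteq> 0" "\<sigma> gen = to_fract a / to_fract b"
    "\<And>c. poly a c = 0 \<Longrightarrow> poly b c \<noteq> 0"
    using fract_reduced[of "\<sigma> gen"] by metis
  define r where "r = \<sigma> gen"
  have evnz: "ev p r \<noteq> 0" if "p \<noteq> 0" for p
    using that k_endo_eq_0[OF \<sigma>(1), of "to_fract p"] by (simp add: r_def k_endo_to_fract[OF \<sigma>(1)])
  have "ev g r / ev D r = to_fract g / to_fract D"
    using \<sigma>(2) by (simp add: k_endo_divide[OF \<sigma>(1)] k_endo_to_fract[OF \<sigma>(1)] r_def)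
  then have evgD: "ev g r * to_fract D = to_fract g * ev D r"
    using nz evnz by (simp add: frac_eq_eq)
  define Hg where "Hg = hom_eval g e a b"
  define HD where "HD = hom_eval D N a b"
  have "to_fract (Hg * b ^ M * D) = to_fract (HD * g)"
    unfolding to_fract_mult tp Hg_def HD_def
    using evgD ab(1) by (simp add: to_fract_hom_eval e_def N_def power_add NM[unfolded N_def e_def] flip: ab(2) r_def)
  then have eq: "Hg * b ^ M * D = HD * g" by (simp only: to_fract_eq_iff)
  \<comment> \<open>At a root of the denominator \<open>b\<close> the left side of \<open>eq\<close> has a zero of order at least \<open>M\<close>, the right
    side at most one.\<close>
  have noroot: "poly b x \<noteq> 0" for x
  proof
    assume bx: "poly b x = 0"
    then have ax: "poly a x \<noteq> 0" using ab(3) by blast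
    have "poly HD x \<noteq> 0" unfolding HD_def poly_hom_eval_0[OF bx] using ax nz by (simp add: N_def)
    moreover have "[:-x, 1:] ^ 2 dvd b ^ M"
      using bx M2 by (metis dvd_power_same dvd_trans le_imp_power_dvd poly_eq_0_iff_dvd)
    then have "[:-x, 1:] ^ 2 dvd g * HD"
      using eq by (metis dvd_mult dvd_mult2 mult.commute)
    ultimately have "[:-x, 1:] ^ 2 dvd g"
      by (intro dvd_of_no_common_root[of _ g HD]) auto
    then obtain g' where "g = [:-x, 1:] ^ 2 * g'" by (elim dvdE)
    then have g': "g = [:-x, 1:] * ([:-x, 1:] * g')" by (simp only: power2_eq_square mult.assoc)
    have "poly g x = 0" "poly (pderiv g) x = 0"
      unfolding g' pderiv_mult by (simp_all add: pderiv_pCons)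
    then show False using sqf by blast
  qed
  then have "degree b = 0" using alg_closed_imp_poly_has_root[of b] by auto
  then obtain \<beta> where \<beta>: "b = [:\<beta>:]" by (elim degree_eq_zeroE)
  with ab(1) have "\<beta> \<noteq> 0" by auto
  define a' where "a' = Polynomial.smult (inverse \<beta>) a"
  have r: "r = to_fract a'"
  proof -
    have "a = b * a'" using \<beta> \<open>\<beta> \<noteq> 0\<close> by (simp add: a'_def)
    then have "to_fract a = to_fract b * to_fract a'" by (metis to_fract_mult)
    then show ?thesis using ab(1,2) by (simp add: r_def)
  qed
  have \<sigma>p: "\<sigma> (to_fract p) = to_fract (p \<circ>\<^sub>p a')" for p
    using ev_pcompose[of p a' gen] unfolding k_endo_to_fract[OF \<sigma>(1)] r_def[symmetric] r by simp
  have da': "degree a' > 0"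
  proof (rule ccontr)
    assume "\<not> degree a' > 0"
    then obtain c where "a' = [:c:]" by (metis degree_eq_zeroE not_gr_zero)
    then have "\<sigma> gen = \<sigma> (cst c)" using r k_endo_cst[OF \<sigma>(1)] by (simp add: r_def cst_def)
    then show False using k_endo_inj[OF \<sigma>(1)] gen_not_cst by metis
  qed
  have eq2: "(g \<circ>\<^sub>p a') * D = (D \<circ>\<^sub>p a') * g"
  proof -
    have "to_fract ((g \<circ>\<^sub>p a') * D) = to_fract ((D \<circ>\<^sub>p a') * g)"
      using evgD unfolding to_fract_mult r_def \<sigma>p[symmetric] k_endo_to_fract[OF \<sigma>(1), symmetric]
      by (simp add: mult.commute)
    then show ?thesis by (simp only: to_fract_eq_iff)
  qed
  have ga: "degree (g \<circ>\<^sub>p a') = e * degree a'" by (simp add: degree_pcompose e_def)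
  then have gnz: "g \<circ>\<^sub>p a' \<noteq> 0" using g da' by (auto simp: e_def)
  have "g \<circ>\<^sub>p a' dvd g"
  proof (rule dvd_of_no_common_root[OF gnz])
    show "g \<circ>\<^sub>p a' dvd g * (D \<circ>\<^sub>p a')" using eq2 by (metis dvd_triv_left mult.commute)
    show "poly (D \<circ>\<^sub>p a') x \<noteq> 0" if "poly (g \<circ>\<^sub>p a') x = 0" for x
      using that cop by (simp add: poly_pcompose)
  qed
  then obtain t where t: "g = (g \<circ>\<^sub>p a') * t" by (elim dvdE)
  have "t \<noteq> 0" using t nz by auto
  have "e = e * degree a' + degree t"
    using degree_mult_eq[OF gnz \<open>t \<noteq> 0\<close>] t ga by (simp add: e_def)
  moreover have "e * degree a' \<ge> e" using da' by simp
  ultimately have "degree t = 0" by linarith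
  then obtain \<kappa>' where \<kappa>': "t = [:\<kappa>':]" by (elim degree_eq_zeroE)
  with \<open>t \<noteq> 0\<close> have "\<kappa>' \<noteq> 0" by auto
  define \<kappa> where "\<kappa> = inverse \<kappa>'"
  have "\<kappa> \<noteq> 0" using \<open>\<kappa>' \<noteq> 0\<close> by (simp add: \<kappa>_def)
  have "g = Polynomial.smult \<kappa>' (g \<circ>\<^sub>p a')" using t \<kappa>' by simp
  then have gk: "g \<circ>\<^sub>p a' = Polynomial.smult \<kappa> g"
    using \<open>\<kappa>' \<noteq> 0\<close> by (metis \<kappa>_def left_inverse smult_1_left smult_smult)
  have "g * (D \<circ>\<^sub>p a') = g * Polynomial.smult \<kappa> D" using eq2 unfolding gk by (simp add: mult.commute)
  then have Dk: "D \<circ>\<^sub>p a' = Polynomial.smult \<kappa> D" using nz(1) by (metis mult_left_cancel)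
  define c where "c = lead_coeff a'"
  have "c \<noteq> 0" using da' by (auto simp: c_def)
  have "lead_coeff g * c ^ e = \<kappa> * lead_coeff g"
    unfolding c_def e_def lead_coeff_comp[OF da', of g, symmetric] gk by (rule lead_coeff_smult)
  then have k1: "\<kappa> = c ^ e" using nz by simp
  have "lead_coeff D * c ^ N = \<kappa> * lead_coeff D"
    unfolding c_def N_def lead_coeff_comp[OF da', of D, symmetric] Dk by (rule lead_coeff_smult)
  then have "\<kappa> = c ^ e * c ^ M" using nz by (simp add: NM power_add)
  then have "c ^ M = 1" using k1 \<open>c \<noteq> 0\<close> by simp
  then have kM: "\<kappa> ^ M = 1" unfolding k1 by (metis mult.commute power_mult power_one)
  have "\<sigma> (to_fract g) = cst \<kappa> * to_fract g"
    unfolding \<sigma>p gk by (simp add: cst_def flip: to_fract_mult)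
  then have "\<sigma> (to_fract g ^ M) = cst (\<kappa> ^ M) * to_fract g ^ M"
    by (simp add: k_endo_power[OF \<sigma>(1)] power_mult_distrib)
  then have "\<sigma> (to_fract g ^ M) = to_fract g ^ M" unfolding kM by simp
  then show ?thesis by (simp add: M_def N_def e_def)
qed

lemma not_galois_quotient:
  fixes g D :: "'k::alg_closed_field poly"
  assumes cop: "\<And>x. poly g x = 0 \<Longrightarrow> poly D x \<noteq> 0"
    and sqf: "\<And>x. poly g x = 0 \<Longrightarrow> poly (pderiv g) x \<noteq> 0"
    and g: "degree g \<ge> 1" and D: "degree D \<ge> degree g + 2"
  shows "\<not> galois_extension kS (kgen (to_fract g / to_fract D))"
proof
  let ?K = "kgen (to_fract g / to_fract D)"
  assume "galois_extension kS ?K"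
  then have fixd: "{x. \<forall>\<sigma>\<in>carrier (Gal kS ?K). \<sigma> x = x} = ?K"
    by (simp add: galois_extension_def)
  have "\<sigma> (to_fract g ^ (degree D - degree g)) = to_fract g ^ (degree D - degree g)"
    if "\<sigma> \<in> carrier (Gal kS ?K)" for \<sigma>
  proof (rule k_endo_fixing_quotient[OF assms])
    have "range cst \<subseteq> ?K" using subfld_cst[OF subfld_kgen] by auto
    from Gal_kS_iff[OF this] that
    show "k_endo \<sigma>" "\<sigma> (to_fract g / to_fract D) = to_fract g / to_fract D"
      using kgen_self by blast+
  qed
  then have "to_fract g ^ (degree D - degree g) \<in> ?K" using fixd by blast
  then show False
    using not_in_kgen_of_degrees[OF cop g, of "degree D - degree g"] D by auto
qed

section \<open>The equation of the curve\<close>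

abbreviation v3 :: "'a::zero \<Rightarrow> 'a \<Rightarrow> 'a \<Rightarrow> 3 \<Rightarrow> 'a" where
  "v3 a b c \<equiv> vec_nth (vector [a, b, c])"

lemma v3_eqI: "x 1 = a \<Longrightarrow> x 2 = b \<Longrightarrow> x 3 = c \<Longrightarrow> x = v3 a b c"
proof (rule ext)
  fix i assume "x 1 = a" "x 2 = b" "x 3 = c"
  then show "x i = v3 a b c i" using exhaust_3[of i] by auto
qed

lemma map_poly_mult_hom:
  assumes "g 0 = 0" "\<And>a b. g (a + b) = g a + g b" "\<And>a b. g (a * b) = g a * g b"
  shows "map_poly g (P * Q) = map_poly g P * map_poly g (Q :: 'a::comm_semiring_1 poly)"
proof -
  have s: "g (sum f A) = (\<Sum>a\<in>A. g (f a))" for f :: "nat \<Rightarrow> 'a" and A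
    by (induction A rule: infinite_finite_induct) (auto simp: assms)
  show ?thesis by (rule poly_eqI) (simp add: coeff_map_poly assms coeff_mult s)
qed

lemma map_poly_prod_hom:
  assumes "g 0 = 0" "g 1 = 1" "\<And>a b. g (a + b) = g a + g b" "\<And>a b. g (a * b) = g a * g b"
  shows "map_poly g (prod f A) = (\<Prod>a\<in>A. map_poly g (f a :: 'a::comm_semiring_1 poly))"
  by (induction A rule: infinite_finite_induct)
    (auto simp: map_poly_mult_hom[OF assms(1,3,4)] map_poly_1' assms)

lemma poly_pderiv_0: "poly (pderiv p) 0 = coeff p 1" for p :: "'a::idom poly"
  by (simp add: poly_0_coeff_0 coeff_pderiv)

lemma coeff_linear_mult:
  "coeff ([:a, b:] * P) j = a * coeff P j + b * (if j = 0 then 0 else coeff P (j - 1))"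
  for a :: "'a::comm_semiring_1"
  by (cases j) (auto simp: coeff_pCons)

lemma coeff_prod_linear:
  fixes a b :: "'i \<Rightarrow> 'a::comm_semiring_1"
  assumes "finite I"
  shows "degree (\<Prod>i\<in>I. [:a i, b i:]) \<le> card I"
    and "coeff (\<Prod>i\<in>I. [:a i, b i:]) (card I) = (\<Prod>i\<in>I. b i)"
    and "coeff (\<Prod>i\<in>I. [:a i, b i:]) 0 = (\<Prod>i\<in>I. a i)"
  using assms
proof (induction I rule: finite_induct)
  case (insert x I)
  { case 1
    have "degree ([:a x, b x:] * (\<Prod>i\<in>I. [:a i, b i:])) \<le> degree [:a x, b x:] + degree (\<Prod>i\<in>I. [:a i, b i:])"
      by (rule degree_mult_le)
    also have "\<dots> \<le> 1 + card I" using insert.IH(1) by (intro add_mono) auto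
    finally show ?case using insert.hyps by simp }
  { case 2
    have "coeff (\<Prod>i\<in>I. [:a i, b i:]) (Suc (card I)) = 0"
      using insert.IH(1) by (intro coeff_eq_0) simp
    then show ?case using insert by (simp add: coeff_linear_mult) }
  { case 3 show ?case using insert by (simp add: coeff_linear_mult) }
qed auto

text \<open>
  With \<open>w = 1 - 1/s\<close> the projection from \<open>(0:0:1)\<close> is \<open>y/x = w\<^sup>n\<close>. The factor for \<open>\<xi>\<close>, a polynomial in
  \<open>Z\<close> over \<open>k[w]\<close>, vanishes at the value of \<open>z/x\<close> at \<open>\<xi>w\<close>. The product of the factors with
  \<open>\<xi>\<^sup>n = 1\<close> only involves \<open>w\<^sup>n\<close>; replacing \<open>w\<^sup>n\<close> by \<open>Y/X\<close> and \<open>Z\<close> by \<open>Z/X\<close> and multiplying by \<open>X\<^sup>q\<close>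
  gives the equation of the curve.
\<close>

definition eq_factor :: "nat \<Rightarrow> 'k::field \<Rightarrow> 'k poly poly" where
  "eq_factor m \<xi> = [:[:1, - \<xi>:] ^ (2 * m) - 1, [:1, - \<xi>:] ^ m:]"

definition eq_norm :: "nat \<Rightarrow> nat \<Rightarrow> 'k::field poly poly" where
  "eq_norm m n = (\<Prod>\<xi>\<in>{\<xi>. \<xi> ^ n = 1}. eq_factor m \<xi>)"

definition eq_coeff :: "nat \<Rightarrow> nat \<Rightarrow> nat \<Rightarrow> nat \<Rightarrow> 'k::field" where
  "eq_coeff m n i j = coeff (coeff (eq_norm m n) j) (n * i)"

definition xyz_monom :: "nat \<Rightarrow> nat \<Rightarrow> nat \<Rightarrow> 3 \<Rightarrow>\<^sub>0 nat" where
  "xyz_monom a b c = Poly_Mapping.single 1 a + Poly_Mapping.single 2 b + Poly_Mapping.single 3 c"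

definition curve_eqn :: "nat \<Rightarrow> nat \<Rightarrow> ('k::field, 3) mpoly" where
  "curve_eqn m n = (\<Sum>j\<le>n. \<Sum>i\<le>2 * m.
     Poly_Mapping.single (xyz_monom (2 * m + 1 - i - j) i j) (eq_coeff m n i j))"

lemma lookup_xyz_monom:
  "Poly_Mapping.lookup (xyz_monom a b c) 1 = a" "Poly_Mapping.lookup (xyz_monom a b c) 2 = b"
  "Poly_Mapping.lookup (xyz_monom a b c) 3 = c"
  by (simp_all add: xyz_monom_def lookup_add lookup_single)

lemma prod_3: "prod f (UNIV :: 3 set) = f 1 * f 2 * f 3"
  unfolding UNIV_3 by (simp add: ac_simps)

lemma (in coeff_hom) mp_eval_curve_eqn:
  "mp_eval h x (curve_eqn m n) = (\<Sum>j\<le>n. \<Sum>i\<le>2 * m. h (eq_coeff m n i j) *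
     (x 1 ^ (2 * m + 1 - i - j) * x 2 ^ i * x 3 ^ j))"
  by (simp add: curve_eqn_def mp_eval_sum mp_eval_single prod_3 lookup_xyz_monom)

text \<open>
  The exponents attached to an odd power \<open>q\<close> of the characteristic of \<open>k\<close>. The argument \<open>kt\<close> only names
  the type of the field.
\<close>

locale curve_params =
  fixes m n q :: nat and kt :: "'k::alg_closed_field itself"
  assumes m2: "m \<ge> 2" and n: "n = m + 1" and q: "q = 2 * m + 1"
    and q0: "of_nat q = (0::'k)"
    and frob: "\<And>x y::'k. (x + y) ^ q = x ^ q + y ^ q"
begin

lemma two_m: "2 * of_nat m = (- 1 :: 'k)"
proof -
  have "2 * of_nat m + 1 = (0::'k)" using q0 unfolding q by (simp add: add.commute)
  then show ?thesis by (rule eq_neg_iff_add_eq_0[THEN iffD2])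
qed

lemma two_n: "2 * of_nat n = (1 :: 'k)"
  unfolding n of_nat_add of_nat_1 distrib_left two_m by simp

lemma nonzero_of_nat: "of_nat n \<noteq> (0::'k)" "of_nat m \<noteq> (0::'k)" "(2::'k) \<noteq> 0"
proof -
  show "of_nat n \<noteq> (0::'k)" using two_n by (metis mult_zero_right zero_neq_one)
  show "of_nat m \<noteq> (0::'k)" using two_m by (metis mult_zero_right neg_equal_0_iff_equal zero_neq_one)
  show "(2::'k) \<noteq> 0" using two_n by (metis mult_zero_left zero_neq_one)
qed

abbreviation mu_n :: "'k set" where "mu_n \<equiv> {\<xi>. \<xi> ^ n = 1}"

lemma finite_mu_n: "finite mu_n" using n by (intro finite_nth_roots_field) simp

lemma card_mu_n: "card mu_n = n" by (rule card_nth_roots_alg_closed[OF nonzero_of_nat(1)]) simp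

lemma mu_n_nz: "\<xi> \<in> mu_n \<Longrightarrow> \<xi> \<noteq> 0" using n by (auto simp: zero_power)

abbreviation norm_poly :: "'k poly poly" where "norm_poly \<equiv> eq_norm m n"
abbreviation cc :: "nat \<Rightarrow> nat \<Rightarrow> 'k" where "cc \<equiv> eq_coeff m n"

lemma degree_one_minus_power: "degree ([:1, - \<xi>:] ^ k) = (if \<xi> = 0 then 0 else k)" for \<xi> :: 'k
proof (cases "\<xi> = 0")
  case True
  then show ?thesis by (simp add: poly_const_pow)
next
  case False
  then show ?thesis by (subst degree_power_eq) auto
qed

lemma degree_const_factor: "\<xi> \<noteq> 0 \<Longrightarrow> degree ([:1, - \<xi>:] ^ (2 * m) - 1) = 2 * m" for \<xi> :: 'k
  using degree_add_eq_left[of "- 1" "[:1, - \<xi>:] ^ (2 * m)"] degree_one_minus_power[of \<xi> "2 * m"] m2 by simp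

text \<open>
  In a factor the constant term has degree \<open>2m\<close> in \<open>w\<close> and the coefficient of \<open>Z\<close> has degree \<open>m\<close>; a term
  with \<open>Z\<^sup>j\<close> takes the latter from \<open>j\<close> of the factors.
\<close>

lemma degree_coeff_factor_prod:
  assumes "finite I"
  shows "degree (coeff (\<Prod>\<xi>\<in>I. eq_factor m (\<xi>::'k)) j) \<le> m * (2 * card I - j)"
  using assms
proof (induction I arbitrary: j rule: finite_induct)
  case empty
  show ?case by (simp add: coeff_pCons one_pCons split: nat.split)
next
  case (insert x I)
  let ?P = "\<Prod>\<xi>\<in>I. eq_factor m \<xi>"
  have dP: "degree ?P \<le> card I"
    unfolding eq_factor_def using coeff_prod_linear(1)[OF insert.hyps(1)] .
  have d1: "degree ([:1, - x:] ^ (2 * m) - 1) \<le> 2 * m"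
    by (intro degree_diff_le) (auto simp: degree_one_minus_power)
  have d2: "degree ([:1, - x:] ^ m) \<le> m" by (simp add: degree_one_minus_power)
  have c: "card (insert x I) = Suc (card I)" using insert.hyps by simp
  have t1: "degree (([:1, - x:] ^ (2 * m) - 1) * coeff ?P j) \<le> m * (2 * card (insert x I) - j)"
  proof (cases "j \<le> card I")
    case True
    have "degree (([:1, - x:] ^ (2 * m) - 1) * coeff ?P j) \<le> 2 * m + m * (2 * card I - j)"
      using degree_mult_le[of "[:1, - x:] ^ (2 * m) - 1" "coeff ?P j"] d1 insert.IH[of j] by linarith
    also have "2 * m + m * (2 * card I - j) = m * (2 + (2 * card I - j))" by (simp add: algebra_simps)
    also have "2 + (2 * card I - j) = 2 * card (insert x I) - j" using True c by simp
    finally show ?thesis .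
  next
    case False
    then have "coeff ?P j = 0" using dP by (intro coeff_eq_0) simp
    then show ?thesis by simp
  qed
  have t2: "degree ([:1, - x:] ^ m * (if j = 0 then 0 else coeff ?P (j - 1))) \<le> m * (2 * card (insert x I) - j)"
  proof (cases "j = 0 \<or> j - 1 > card I")
    case True
    then show ?thesis using dP by (auto simp: coeff_eq_0)
  next
    case False
    have "degree ([:1, - x:] ^ m * coeff ?P (j - 1)) \<le> m + m * (2 * card I - (j - 1))"
      using degree_mult_le[of "[:1, - x:] ^ m" "coeff ?P (j - 1)"] d2 insert.IH[of "j - 1"] by linarith
    also have "m + m * (2 * card I - (j - 1)) = m * (1 + (2 * card I - (j - 1)))" by simp
    also have "1 + (2 * card I - (j - 1)) = 2 * card (insert x I) - j" using False c by auto
    finally show ?thesis using False by simp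
  qed
  have "(\<Prod>\<xi>\<in>insert x I. eq_factor m \<xi>) = eq_factor m x * ?P" using insert.hyps by simp
  then show ?case
    unfolding eq_factor_def[of m x] using coeff_linear_mult[of "[:1, - x:] ^ (2 * m) - 1" "[:1, - x:] ^ m" ?P j] t1 t2
    by (simp only:) (rule degree_add_le)
qed

lemma degree_norm_poly: "degree norm_poly \<le> n"
  using coeff_prod_linear(1)[OF finite_mu_n, where a = "\<lambda>\<xi>. [:1, - \<xi>:] ^ (2 * m) - 1" and b = "\<lambda>\<xi>. [:1, - \<xi>:] ^ m"]
  unfolding eq_norm_def eq_factor_def card_mu_n .

lemma coeff_norm_poly_n: "coeff norm_poly n = (\<Prod>\<xi>\<in>mu_n. [:1, - \<xi>:] ^ m)"
  using coeff_prod_linear(2)[OF finite_mu_n, where a = "\<lambda>\<xi>. [:1, - \<xi>:] ^ (2 * m) - 1" and b = "\<lambda>\<xi>. [:1, - \<xi>:] ^ m"]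
  unfolding eq_norm_def eq_factor_def card_mu_n .

lemma coeff_norm_poly_0: "coeff norm_poly 0 = (\<Prod>\<xi>\<in>mu_n. [:1, - \<xi>:] ^ (2 * m) - 1)"
  using coeff_prod_linear(3)[OF finite_mu_n, where a = "\<lambda>\<xi>. [:1, - \<xi>:] ^ (2 * m) - 1" and b = "\<lambda>\<xi>. [:1, - \<xi>:] ^ m"]
  unfolding eq_norm_def eq_factor_def .

lemma degree_coeff_norm_poly: "degree (coeff norm_poly j) \<le> m * (2 * n - j)"
  using degree_coeff_factor_prod[OF finite_mu_n, of j] unfolding eq_norm_def card_mu_n .

text \<open>
  No denominator remains after multiplication by \<open>X\<^sup>q\<close>, and \<open>Y\<^sup>m Z\<^sup>n\<close> is the only monomial of the equation
  without \<open>X\<close>.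
\<close>

lemma eq_coeff_degree:
  assumes "cc i j \<noteq> 0"
  shows "j \<le> n" "i \<le> 2 * m" "i + j < q \<or> i = m \<and> j = n"
proof -
  have nz: "coeff norm_poly j \<noteq> 0" and le: "n * i \<le> degree (coeff norm_poly j)"
    using assms by (auto simp: eq_coeff_def intro: le_degree)
  show jn: "j \<le> n" using nz degree_norm_poly by (metis coeff_eq_0 le_trans not_le)
  have "n * i \<le> m * (2 * n - j)" using le degree_coeff_norm_poly[of j] by simp
  also have "\<dots> = 2 * (m * n) - m * j" by (simp add: diff_mult_distrib2)
  finally have a: "n * i + m * j \<le> 2 * (m * n)"
    using mult_le_mono2[OF jn, of m] by linarith
  have "n * (2 * m) = 2 * (m * n)" by simp
  then have "n * i \<le> n * (2 * m)" using a by linarith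
  have n0: "n > 0" using n by simp
  show "i \<le> 2 * m" using \<open>n * i \<le> n * (2 * m)\<close> n0 by (simp only: nat_mult_le_cancel1)
  show "i + j < q \<or> i = m \<and> j = n"
  proof (cases "i + j < q")
    case False
    then have "n * (2 * m + 1) \<le> n * (i + j)" using q by (intro mult_le_mono2) simp
    also have "n * (i + j) = n * i + m * j + j" by (simp add: n algebra_simps)
    also have "\<dots> \<le> 2 * (m * n) + j" using a by simp
    finally have "n \<le> j" by (simp add: distrib_left)
    then have "j = n" using jn by simp
    then have "n * i \<le> n * m" using a by (simp add: mult.commute)
    then have "i \<le> m" using n0 by (simp only: nat_mult_le_cancel1)
    then show ?thesis using False \<open>j = n\<close> n q by simp
  qed simp
qed

lemma eq_coeff_top: "cc m n \<noteq> 0"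
proof -
  have "degree (coeff norm_poly n) = (\<Sum>\<xi>\<in>mu_n. degree ([:1, - \<xi>:] ^ m))"
    unfolding coeff_norm_poly_n by (rule degree_prod_sum_eq) simp
  also have "\<dots> = (\<Sum>\<xi>\<in>mu_n. m)"
    using mu_n_nz by (intro sum.cong) (auto simp: degree_one_minus_power)
  also have "\<dots> = n * m" by (simp add: card_mu_n)
  finally have "cc m n = lead_coeff (coeff norm_poly n)" by (simp add: eq_coeff_def)
  moreover have "coeff norm_poly n \<noteq> 0" unfolding coeff_norm_poly_n using finite_mu_n by simp
  ultimately show ?thesis by simp
qed

text \<open>
  The coefficient of \<open>X Y\<^sup>2\<^sup>m\<close>, which makes the curve smooth at \<open>(0:1:0)\<close>. It is the leading
  coefficient of the term of the norm without \<open>Z\<close>.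
\<close>

lemma eq_coeff_P1: "cc (2 * m) 0 \<noteq> 0"
proof -
  have nz: "[:1, - \<xi>:] ^ (2 * m) - 1 \<noteq> 0" if "\<xi> \<in> mu_n" for \<xi> :: 'k
    using degree_const_factor[OF mu_n_nz[OF that]] m2 by (metis degree_0 mult_is_0 not_numeral_le_zero zero_neq_numeral)
  have "degree (coeff norm_poly 0) = (\<Sum>\<xi>\<in>mu_n. degree ([:1, - \<xi>:] ^ (2 * m) - 1))"
    unfolding coeff_norm_poly_0 using nz by (rule degree_prod_sum_eq)
  also have "\<dots> = (\<Sum>\<xi>\<in>mu_n. 2 * m)"
    using degree_const_factor mu_n_nz by (intro sum.cong) auto
  also have "\<dots> = n * (2 * m)" by (simp add: card_mu_n)
  finally have "cc (2 * m) 0 = lead_coeff (coeff norm_poly 0)" by (simp add: eq_coeff_def)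
  moreover have "coeff norm_poly 0 \<noteq> 0" unfolding coeff_norm_poly_0 using finite_mu_n nz by simp
  ultimately show ?thesis by simp
qed

text \<open>
  The coefficient of \<open>X\<^sup>2\<^sup>m Y\<close>, which makes the curve smooth at \<open>(1:0:0)\<close>. The constant term of each factor
  starts with \<open>-2m \<xi> w\<close>, and \<open>-2m = 1\<close> in \<open>k\<close>; the product of these initial terms is the one with
  \<open>w\<^sup>n\<close>.
\<close>

lemma eq_coeff_P2: "cc 1 0 \<noteq> 0"
proof -
  define r where "r = (\<lambda>\<xi>::'k. ([:1, - \<xi>:] ^ (2 * m) - 1) div [:0, 1:])"
  have r: "[:1, - \<xi>:] ^ (2 * m) - 1 = [:0, 1:] * r \<xi>" for \<xi>
  proof -
    have "[:- 0, 1:] dvd [:1, - \<xi>:] ^ (2 * m) - 1" by (subst poly_eq_0_iff_dvd[symmetric]) simp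
    then have "[:0, 1:] dvd [:1, - \<xi>:] ^ (2 * m) - 1" by (simp only: minus_zero)
    then show ?thesis unfolding r_def by (rule dvd_mult_div_cancel[symmetric])
  qed
  have r0: "poly (r \<xi>) 0 = \<xi>" for \<xi>
  proof -
    have "poly (pderiv ([:1, - \<xi>:] ^ (2 * m) - 1)) 0 = poly (r \<xi>) 0"
      unfolding r pderiv_mult by (simp add: pderiv_pCons)
    moreover have "poly (pderiv ([:1, - \<xi>:] ^ (2 * m) - 1)) 0 = - (2 * of_nat m * \<xi>)"
      by (simp add: pderiv_diff pderiv_power pderiv_pCons)
    ultimately show ?thesis using two_m by simp
  qed
  have "coeff norm_poly 0 = (\<Prod>\<xi>\<in>mu_n. [:0, 1:] * r \<xi>)"
    unfolding coeff_norm_poly_0 by (intro prod.cong HOL.refl r)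
  also have "\<dots> = [:0, 1:] ^ n * (\<Prod>\<xi>\<in>mu_n. r \<xi>)"
    by (simp only: prod.distrib prod_constant card_mu_n)
  also have "[:0, 1:] ^ n = Polynomial.monom (1::'k) n" by (simp add: monom_altdef)
  finally have "cc 1 0 = coeff (\<Prod>\<xi>\<in>mu_n. r \<xi>) 0"
    by (simp add: eq_coeff_def coeff_monom_mult)
  also have "\<dots> = (\<Prod>\<xi>\<in>mu_n. \<xi>)" by (simp add: r0 poly_prod flip: poly_0_coeff_0)
  also have "\<dots> \<noteq> 0" using finite_mu_n mu_n_nz by simp
  finally show ?thesis .
qed

text \<open>
  The substitution of \<open>\<xi> w\<close> for \<open>w\<close> permutes the factors.
\<close>

lemma eq_norm_invariant:
  assumes "\<xi> ^ n = (1::'k)"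
  shows "coeff norm_poly j \<circ>\<^sub>p [:0, \<xi>:] = coeff norm_poly j"
proof -
  let ?g = "\<lambda>p::'k poly. p \<circ>\<^sub>p [:0, \<xi>:]"
  have g: "?g 0 = 0" "?g 1 = 1" "\<And>a b. ?g (a + b) = ?g a + ?g b" "\<And>a b. ?g (a * b) = ?g a * ?g b"
    by (auto simp: pcompose_add pcompose_mult pcompose_1)
  have gp: "?g (a ^ k) = ?g a ^ k" for a k by (induction k) (auto simp: pcompose_mult pcompose_1)
  have f: "map_poly ?g (eq_factor m z) = eq_factor m (z * \<xi>)" for z
    by (simp add: eq_factor_def map_poly_pCons g gp pcompose_diff pcompose_pCons pcompose_1 mult.commute)
  have "map_poly ?g norm_poly = (\<Prod>z\<in>mu_n. eq_factor m (z * \<xi>))"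
    unfolding eq_norm_def by (subst map_poly_prod_hom[OF g]) (simp add: f)
  also have "\<dots> = norm_poly"
    unfolding eq_norm_def using n by (intro prod_roots_of_unity_shift[OF assms]) simp
  finally show ?thesis by (metis coeff_map_poly g(1))
qed

lemma eq_coeff_sum:
  "(\<Sum>j\<le>n. \<Sum>i\<le>2 * m. cc i j * (w ^ n) ^ i * z ^ j) =
   (\<Prod>\<xi>\<in>mu_n. (1 - \<xi> * w) ^ m * z + (1 - \<xi> * w) ^ (2 * m) - 1)"
proof -
  have c: "(\<Sum>i\<le>2 * m. cc i j * (w ^ n) ^ i) = poly (coeff norm_poly j) w" for j
  proof -
    have "m * (2 * n - j) \<le> m * (2 * n)" by (rule mult_le_mono2) simp
    then have "degree (coeff norm_poly j) \<le> m * (2 * n)"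
      by (rule le_trans[OF degree_coeff_norm_poly])
    also have "m * (2 * n) = n * (2 * m)" by simp
    finally have "degree (coeff norm_poly j) \<le> n * (2 * m)" .
    then show ?thesis
      using poly_scale_invariant[OF nonzero_of_nat(1) eq_norm_invariant] by (simp add: eq_coeff_def)
  qed
  let ?g = "\<lambda>p::'k poly. poly p w"
  have "(\<Sum>j\<le>n. \<Sum>i\<le>2 * m. cc i j * (w ^ n) ^ i * z ^ j) = (\<Sum>j\<le>n. coeff (map_poly ?g norm_poly) j * z ^ j)"
    by (simp add: coeff_map_poly flip: sum_distrib_right c)
  also have "\<dots> = poly (map_poly ?g norm_poly) z"
  proof -
    have "degree (map_poly ?g norm_poly) \<le> n"
      using degree_norm_poly by (intro degree_le) (auto simp: coeff_map_poly coeff_eq_0)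
    then show ?thesis unfolding poly_altdef
      by (intro sum.mono_neutral_right) (auto simp: coeff_eq_0)
  qed
  also have "map_poly ?g norm_poly = (\<Prod>\<xi>\<in>mu_n. map_poly ?g (eq_factor m \<xi>))"
    unfolding eq_norm_def by (subst map_poly_prod_hom) auto
  also have "poly \<dots> z = (\<Prod>\<xi>\<in>mu_n. (1 - \<xi> * w) ^ m * z + (1 - \<xi> * w) ^ (2 * m) - 1)"
    unfolding poly_prod by (intro prod.cong HOL.refl) (simp add: eq_factor_def map_poly_pCons algebra_simps)
  finally show ?thesis .
qed

abbreviation F :: "('k, 3) mpoly" where "F \<equiv> curve_eqn m n"

lemma homogeneous_F: "homogeneous q F"
  unfolding curve_eqn_def
proof (intro homogeneous_sum)
  fix i j
  show "homogeneous q (Poly_Mapping.single (xyz_monom (2 * m + 1 - i - j) i j) (cc i j))"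
  proof (cases "cc i j = 0")
    case False
    then have "i + j \<le> 2 * m + 1" using eq_coeff_degree[OF False] n q by auto
    then show ?thesis by (intro homogeneous_single) (simp add: sum_3 lookup_xyz_monom q)
  qed simp
qed

lemma F_eval_nz:
  assumes "x 1 \<noteq> 0" "w ^ n = x 2 / x 1"
  shows "mp_eval id x F = x 1 ^ q *
    (\<Prod>\<xi>\<in>mu_n. (1 - \<xi> * w) ^ m * (x 3 / x 1) + (1 - \<xi> * w) ^ (2 * m) - 1)"
  unfolding id_hom.mp_eval_curve_eqn eq_coeff_sum[symmetric] sum_distrib_left
proof (intro sum.cong HOL.refl)
  fix i j
  show "id (cc i j) * (x 1 ^ (2 * m + 1 - i - j) * x 2 ^ i * x 3 ^ j) =
    x 1 ^ q * (cc i j * (w ^ n) ^ i * (x 3 / x 1) ^ j)"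
  proof (cases "cc i j = 0")
    case False
    then have "i + j \<le> q" using eq_coeff_degree[OF False] n q by auto
    then have "x 1 ^ q = x 1 ^ (2 * m + 1 - i - j) * x 1 ^ i * x 1 ^ j"
      by (simp add: q flip: power_add)
    then show ?thesis using assms by (simp add: power_divide)
  qed simp
qed

lemma F_eval_0:
  assumes "x 1 = 0"
  shows "mp_eval id x F = cc m n * x 2 ^ m * x 3 ^ n"
proof -
  have "mp_eval id x F = (\<Sum>j\<le>n. \<Sum>i\<le>2 * m. if j = n then (if i = m then cc m n * x 2 ^ m * x 3 ^ n else 0) else 0)"
    unfolding id_hom.mp_eval_curve_eqn
  proof (intro sum.cong HOL.refl)
    fix i j
    show "id (cc i j) * (x 1 ^ (2 * m + 1 - i - j) * x 2 ^ i * x 3 ^ j) =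
      (if j = n then (if i = m then cc m n * x 2 ^ m * x 3 ^ n else 0) else 0)"
    proof (cases "cc i j = 0")
      case True
      then show ?thesis using eq_coeff_top by auto
    next
      case False
      then consider "i + j < q" | "i = m" "j = n" using eq_coeff_degree by blast
      then show ?thesis
      proof cases
        case 1
        then have "x 1 ^ (2 * m + 1 - i - j) = 0" using assms q by (simp add: zero_power)
        moreover have "\<not> (i = m \<and> j = n)" using 1 n q by auto
        ultimately show ?thesis by auto
      next
        case 2
        have "2 * m + 1 - m - n = 0" using n by simp
        then show ?thesis using 2 by simp
      qed
    qed
  qed
  also have "\<dots> = (\<Sum>j\<le>n. if j = n then cc m n * x 2 ^ m * x 3 ^ n else 0)"
    using m2 by (intro sum.cong) auto
  finally show ?thesis by simp
qed

lemma F_pderiv_P1: "mp_eval id (vec_nth (vector [0, 1, 0])) (mp_pderiv 1 F) \<noteq> 0"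
proof -
  define l :: "3 \<Rightarrow> 'k poly" where "l = vec_nth (vector [[:0, 1:], 1, 0])"
  have l: "l 1 = [:0, 1:]" "l 2 = 1" "l 3 = 0" unfolding l_def vector_3 by (rule HOL.refl)+
  have "pderiv (mp_poly l F) = mp_poly l (mp_pderiv 1 F)"
    unfolding pderiv_mp_poly sum_3 l by (simp add: pderiv_pCons)
  moreover have "(\<lambda>i. poly (l i) 0) = vec_nth (vector [0, 1, 0])"
    by (rule v3_eqI) (simp_all add: l)
  ultimately have "mp_eval id (vec_nth (vector [0, 1, 0])) (mp_pderiv 1 F) = coeff (mp_poly l F) 1"
    using poly_mp_poly[of l "mp_pderiv 1 F" 0] poly_pderiv_0[of "mp_poly l F"] by simp
  also have "\<dots> = (\<Sum>j\<le>n. \<Sum>i\<le>2 * m. if j = 0 then (if i = 2 * m then cc (2 * m) 0 else 0) else 0)"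
    unfolding pc_hom.mp_eval_curve_eqn coeff_sum
  proof (intro sum.cong HOL.refl)
    fix i j assume "i \<in> {..2 * m}"
    then have i: "2 * m + 1 - i = 1 \<longleftrightarrow> i = 2 * m" by auto
    have mon: "[:0, 1:] ^ k = Polynomial.monom (1::'k) k" for k by (simp add: monom_altdef)
    show "coeff ([:cc i j:] * (l 1 ^ (2 * m + 1 - i - j) * l 2 ^ i * l 3 ^ j)) 1 =
      (if j = 0 then (if i = 2 * m then cc (2 * m) 0 else 0) else 0)"
    proof (cases "j = 0")
      case True
      then have "coeff ([:cc i j:] * (l 1 ^ (2 * m + 1 - i - j) * l 2 ^ i * l 3 ^ j)) 1 =
          cc i 0 * coeff (Polynomial.monom 1 (2 * m + 1 - i)) 1"
        unfolding l mon by simp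
      then show ?thesis using True i by (simp only: coeff_monom) auto
    qed (simp add: l zero_power)
  qed
  also have "\<dots> = (\<Sum>j\<le>n. if j = 0 then cc (2 * m) 0 else 0)"
    by (intro sum.cong) auto
  also have "\<dots> = cc (2 * m) 0" by simp
  finally show ?thesis using eq_coeff_P1 by simp
qed

lemma F_pderiv_P2: "mp_eval id (vec_nth (vector [1, 0, 0])) (mp_pderiv 2 F) \<noteq> 0"
proof -
  define l :: "3 \<Rightarrow> 'k poly" where "l = vec_nth (vector [1, [:0, 1:], 0])"
  have l: "l 1 = 1" "l 2 = [:0, 1:]" "l 3 = 0" unfolding l_def vector_3 by (rule HOL.refl)+
  have "pderiv (mp_poly l F) = mp_poly l (mp_pderiv 2 F)"
    unfolding pderiv_mp_poly sum_3 l by (simp add: pderiv_pCons)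
  moreover have "(\<lambda>i. poly (l i) 0) = vec_nth (vector [1, 0, 0])"
    by (rule v3_eqI) (simp_all add: l)
  ultimately have "mp_eval id (vec_nth (vector [1, 0, 0])) (mp_pderiv 2 F) = coeff (mp_poly l F) 1"
    using poly_mp_poly[of l "mp_pderiv 2 F" 0] poly_pderiv_0[of "mp_poly l F"] by simp
  also have "\<dots> = (\<Sum>j\<le>n. \<Sum>i\<le>2 * m. if j = 0 then (if i = 1 then cc 1 0 else 0) else 0)"
    unfolding pc_hom.mp_eval_curve_eqn coeff_sum
  proof (intro sum.cong HOL.refl)
    fix i j assume "i \<in> {..2 * m}"
    have mon: "[:0, 1:] ^ k = Polynomial.monom (1::'k) k" for k by (simp add: monom_altdef)
    show "coeff ([:cc i j:] * (l 1 ^ (2 * m + 1 - i - j) * l 2 ^ i * l 3 ^ j)) 1 =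
      (if j = 0 then (if i = 1 then cc 1 0 else 0) else 0)"
    proof (cases "j = 0")
      case True
      then have "coeff ([:cc i j:] * (l 1 ^ (2 * m + 1 - i - j) * l 2 ^ i * l 3 ^ j)) 1 =
          cc i 0 * coeff (Polynomial.monom 1 i) 1"
        unfolding l mon by simp
      then show ?thesis using True by (simp only: coeff_monom) auto
    qed (simp add: l zero_power)
  qed
  also have "\<dots> = (\<Sum>j\<le>n. if j = 0 then cc 1 0 else 0)"
    using m2 by (intro sum.cong) auto
  also have "\<dots> = cc 1 0" by simp
  finally show ?thesis using eq_coeff_P2 by simp
qed

end

lemma vec3_eqI: "vec_nth v 1 = vec_nth w 1 \<Longrightarrow> vec_nth v 2 = vec_nth w 2 \<Longrightarrow> vec_nth v 3 = vec_nth w 3 \<Longrightarrow> v = w"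
  for v w :: "'a ^ 3"
  by (simp add: vec_eq_iff forall_3)

lemma proj_pt_scale: "c \<noteq> 0 \<Longrightarrow> proj_pt (c *s v) = proj_pt (v :: 'k::field ^ 'n::finite)"
  unfolding proj_pt_def
proof (intro equalityI subsetI; elim CollectE exE conjE)
  fix x a assume "c \<noteq> 0" "x = a *s (c *s v)" "a \<noteq> 0"
  then show "x \<in> {c *s v |c. c \<noteq> 0}" by (auto intro!: exI[of _ "a * c"] simp: vector_smult_assoc)
next
  fix x a assume "c \<noteq> 0" "x = a *s v" "a \<noteq> 0"
  then show "x \<in> {a *s (c *s v) |a. a \<noteq> 0}" by (auto intro!: exI[of _ "a / c"] simp: vector_smult_assoc)
qed

lemma proj_pt_eqD: "proj_pt v = proj_pt w \<Longrightarrow> \<exists>c. c \<noteq> 0 \<and> w = c *s (v :: 'k::field ^ 'n::finite)"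
  using proj_pt_self[of w] by (auto simp: proj_pt_def)

context curve_params
begin

text \<open>
  Coordinates of the image of \<open>(s:1)\<close>; the image of \<open>(1:0)\<close> is called \<open>Pinf\<close>.
\<close>

definition aff_pt :: "'k \<Rightarrow> 'k ^ 3" where
  "aff_pt s = vector [s ^ n, (s - 1) ^ n, s ^ q - s]"

definition Pinf :: "('k, 3) proj_pt" where "Pinf = proj_pt (vector [0, 0, 1])"

abbreviation C :: "('k, 3) proj_pt set" where "C \<equiv> C2 q"

lemma aff_pt_simps [simp]:
  "vec_nth (aff_pt s) 1 = s ^ n" "vec_nth (aff_pt s) 2 = (s - 1) ^ n" "vec_nth (aff_pt s) 3 = s ^ q - s"
  by (simp_all add: aff_pt_def)

lemma pos: "m > 0" "n > 0" "q > 0" using m2 n q by auto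

lemma power_q: "x ^ q = x ^ n * x ^ m" "x ^ q = x * x ^ (2 * m)" for x :: "'a::monoid_mult"
proof -
  have "q = n + m" using n q by simp
  then show "x ^ q = x ^ n * x ^ m" by (simp only: power_add)
  show "x ^ q = x * x ^ (2 * m)" unfolding q by simp
qed

lemma aff_pt_nz: "aff_pt s \<noteq> 0"
proof
  assume "aff_pt s = 0"
  then have "vec_nth (aff_pt s) 1 = 0" "vec_nth (aff_pt s) 2 = 0" by simp_all
  then show False using pos by auto
qed

lemma phi2_proj_pt:
  "phi2 q (proj_pt v) = proj_pt (vector [vec_nth v 1 ^ n * vec_nth v 2 ^ m,
     (vec_nth v 1 - vec_nth v 2) ^ n * vec_nth v 2 ^ m, vec_nth v 1 ^ q - vec_nth v 1 * vec_nth v 2 ^ (2 * m)] :: 'k ^ 3)"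
    (is "_ = proj_pt (?f v)")
proof -
  have h: "(q + 1) div 2 = n" "(q - 1) div 2 = m" "q - 1 = 2 * m" using n q by auto
  have s: "?f (c *s v) = (c ^ q) *s ?f v" for c
  proof -
    let ?s = "vec_nth v 1" and ?t = "vec_nth v 2"
    have d: "c * ?s - c * ?t = c * (?s - ?t)" by (simp add: right_diff_distrib)
    have "(c * ?s) ^ q - c * ?s * (c * ?t) ^ (2 * m) = c ^ q * ?s ^ q - (c * c ^ (2 * m)) * (?s * ?t ^ (2 * m))"
      by (simp add: power_mult_distrib ac_simps)
    also have "\<dots> = c ^ q * (?s ^ q - ?s * ?t ^ (2 * m))"
      unfolding power_q(2)[symmetric] by (simp add: right_diff_distrib)
    finally show ?thesis
      by (intro vec3_eqI) (simp_all add: d power_mult_distrib power_q(1)[of c] ac_simps)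
  qed
  have "phi2 q (proj_pt v) = (\<Union>w\<in>proj_pt v. proj_pt (?f w))"
    unfolding phi2_def proj_map_def Let_def h(1,2) unfolding h(3) ..
  also have "\<dots> = (\<Union>w\<in>proj_pt v. proj_pt (?f v))"
  proof (rule SUP_cong[OF HOL.refl])
    fix w assume "w \<in> proj_pt v"
    then obtain c where "c \<noteq> 0" "w = c *s v" by (auto simp: proj_pt_def)
    then show "proj_pt (?f w) = proj_pt (?f v)" using s[of c] proj_pt_scale[of "c ^ q"] by simp
  qed
  also have "\<dots> = proj_pt (?f v)" using proj_pt_self[of v] by auto
  finally show ?thesis .
qed

lemma C_eq: "C = insert Pinf (range (\<lambda>s. proj_pt (aff_pt s)))"
proof (intro equalityI subsetI)
  fix P assume "P \<in> C"
  then obtain v :: "'k ^ 2" where v: "v \<noteq> 0" "P = phi2 q (proj_pt v)"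
    by (auto simp: C2_def proj_space_def)
  show "P \<in> insert Pinf (range (\<lambda>s. proj_pt (aff_pt s)))"
  proof (cases "vec_nth v 2 = 0")
    case True
    then have s: "vec_nth v 1 \<noteq> 0" using v(1) by (auto simp: vec_eq_iff forall_2)
    have "P = proj_pt ((vec_nth v 1 ^ q) *s vector [0, 0, 1])"
      unfolding v(2) phi2_proj_pt using True m2
      by (intro arg_cong[where f = proj_pt] vec3_eqI) (auto simp: zero_power)
    also have "\<dots> = Pinf" unfolding Pinf_def by (rule proj_pt_scale) (use s in simp)
    finally show ?thesis by simp
  next
    case False
    define s where "s = vec_nth v 1 / vec_nth v 2"
    have vs: "vec_nth v 1 = s * vec_nth v 2" using False by (simp add: s_def)
    let ?t = "vec_nth v 2"
    have d: "s * ?t - ?t = (s - 1) * ?t" by (simp add: left_diff_distrib)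
    have "(s * ?t) ^ q - s * ?t * ?t ^ (2 * m) = ?t ^ q * s ^ q - s * (?t * ?t ^ (2 * m))"
      by (simp add: power_mult_distrib ac_simps)
    also have "\<dots> = ?t ^ q * (s ^ q - s)"
      unfolding power_q(2)[symmetric] by (simp add: right_diff_distrib)
    finally have "P = proj_pt ((?t ^ q) *s aff_pt s)"
      unfolding v(2) phi2_proj_pt vs d
      by (intro arg_cong[where f = proj_pt] vec3_eqI) (simp_all add: power_mult_distrib power_q(1)[of ?t] ac_simps)
    then show ?thesis using proj_pt_scale[of "vec_nth v 2 ^ q" "aff_pt s"] False by auto
  qed
next
  fix P assume "P \<in> insert Pinf (range (\<lambda>s. proj_pt (aff_pt s)))"
  then consider "P = Pinf" | s where "P = proj_pt (aff_pt s)" by auto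
  then show "P \<in> C"
  proof cases
    case 1
    have "phi2 q (proj_pt (vector [1, 0])) = P"
      unfolding phi2_proj_pt 1 Pinf_def using m2
      by (intro arg_cong[where f = proj_pt] vec3_eqI) (auto simp: zero_power)
    moreover have "(vector [1, 0] :: 'k ^ 2) \<noteq> 0" by (auto simp: vec_eq_iff forall_2)
    ultimately show ?thesis unfolding C2_def proj_space_def by blast
  next
    case 2
    have "phi2 q (proj_pt (vector [s, 1])) = P"
      unfolding phi2_proj_pt 2
      by (intro arg_cong[where f = proj_pt] vec3_eqI) auto
    moreover have "(vector [s, 1] :: 'k ^ 2) \<noteq> 0" by (auto simp: vec_eq_iff forall_2)
    ultimately show ?thesis unfolding C2_def proj_space_def by blast
  qed
qed

subsection \<open>The points of the curve\<close>

lemma sq_minus_s: "s ^ q - s = s * (s ^ (2 * m) - 1)" for s :: 'k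
  by (simp add: q algebra_simps)

text \<open>In terms of \<open>u = 1/s = 1 - w\<close> the third coordinate function is \<open>z/x = (1 - u\<^sup>2\<^sup>m) / u\<^sup>m\<close>.\<close>

lemma aff_pt_ratio:
  assumes "s \<noteq> (0::'k)"
  shows "(inverse s) ^ m * ((s ^ q - s) / s ^ n) = 1 - (inverse s) ^ (2 * m)"
proof -
  have "s ^ n = s * s ^ m" by (simp add: n)
  then have "(inverse s) ^ m * ((s ^ q - s) / s ^ n) = (s ^ (2 * m) - 1) / (s ^ m * s ^ m)"
    unfolding sq_minus_s using assms by (simp add: power_inverse divide_inverse)
  also have "s ^ m * s ^ m = s ^ (2 * m)" by (simp add: mult_2 power_add)
  finally show ?thesis using assms by (simp add: power_inverse divide_inverse left_diff_distrib)
qed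

lemma F_aff_pt: "mp_eval id (vec_nth (aff_pt s)) F = 0"
proof (cases "s = 0")
  case True
  then have "vec_nth (aff_pt s) 1 = 0" using pos by (simp add: zero_power)
  then show ?thesis using True pos by (simp add: F_eval_0 zero_power)
next
  case False
  have w: "((s - 1) / s) ^ n = vec_nth (aff_pt s) 2 / vec_nth (aff_pt s) 1" by (simp add: power_divide)
  have u: "1 - 1 * ((s - 1) / s) = inverse s" using False by (simp add: field_simps)
  have f: "(1 - 1 * ((s - 1) / s)) ^ m * (vec_nth (aff_pt s) 3 / vec_nth (aff_pt s) 1) + (1 - 1 * ((s - 1) / s)) ^ (2 * m) - 1 = 0"
    unfolding u aff_pt_simps aff_pt_ratio[OF False] by simp
  have "(\<Prod>\<xi>\<in>mu_n. (1 - \<xi> * ((s - 1) / s)) ^ m * (vec_nth (aff_pt s) 3 / vec_nth (aff_pt s) 1) +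
      (1 - \<xi> * ((s - 1) / s)) ^ (2 * m) - 1) = 0"
    by (rule prod_zero[OF finite_mu_n], rule bexI[of _ 1]) (use f in simp_all)
  then show ?thesis
    using F_eval_nz[of "vec_nth (aff_pt s)", OF _ w] False by simp
qed

text \<open>
  At a zero of the equation with \<open>x \<noteq> 0\<close> some factor of the norm vanishes, say that for \<open>\<xi>\<close>, and the
  parameter of the point is given by \<open>\<xi> w = 1 - 1/s\<close>. On the line \<open>x = 0\<close> the equation is
  \<open>y\<^sup>m z\<^sup>n = 0\<close>.
\<close>

lemma zero_locus_F: "zero_locus F = C"
proof (intro equalityI subsetI)
  fix P assume "P \<in> C"
  then consider "P = Pinf" | s where "P = proj_pt (aff_pt s)" by (auto simp: C_eq)
  then show "P \<in> zero_locus F"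
  proof cases
    case 1
    have "(vector [0, 0, 1] :: 'k ^ 3) \<noteq> 0" by (auto simp: vec_eq_iff forall_3)
    then show ?thesis
      unfolding 1 Pinf_def zero_locus_def using m2
      by (auto simp: vanishes_at_proj_pt[OF homogeneous_F] F_eval_0 proj_space_def zero_power)
  next
    case 2
    then show ?thesis
      using aff_pt_nz[of s] by (auto simp: zero_locus_def vanishes_at_proj_pt[OF homogeneous_F] F_aff_pt proj_space_def)
  qed
next
  fix P assume "P \<in> zero_locus F"
  then obtain v where v: "v \<noteq> 0" "P = proj_pt v" and F0: "mp_eval id (vec_nth v) F = 0"
    by (auto simp: zero_locus_def proj_space_def vanishes_at_proj_pt[OF homogeneous_F])
  let ?x = "vec_nth v 1" and ?y = "vec_nth v 2" and ?z = "vec_nth v 3"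
  show "P \<in> C"
  proof (cases "?x = 0")
    case True
    then have "?y ^ m * ?z ^ n = 0" using F0 eq_coeff_top by (simp add: F_eval_0)
    then consider "?y = 0" | "?z = 0" by auto
    then show ?thesis
    proof cases
      case 1
      then have "v = ?z *s vector [0, 0, 1]" using True by (intro vec3_eqI) auto
      moreover have "?z \<noteq> 0" using v(1) True 1 by (auto simp: vec_eq_iff forall_3)
      ultimately have "P = Pinf" using proj_pt_scale[of ?z] unfolding v(2) Pinf_def by metis
      then show ?thesis by (simp add: C_eq)
    next
      case 2
      have "v = (?y * (- 1) ^ n) *s aff_pt 0" using True 2 pos by (intro vec3_eqI) (simp_all add: zero_power flip: power_mult_distrib)
      moreover have "?y * (- 1) ^ n \<noteq> 0" using v(1) True 2 by (auto simp: vec_eq_iff forall_3)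
      ultimately have "P = proj_pt (aff_pt 0)" using proj_pt_scale[of "?y * (- 1) ^ n"] unfolding v(2) by metis
      then show ?thesis by (auto simp: C_eq)
    qed
  next
    case False
    obtain w where w: "w ^ n = ?y / ?x" using nth_root_exists[of n "?y / ?x"] n by auto
    have "(\<Prod>\<xi>\<in>mu_n. (1 - \<xi> * w) ^ m * (?z / ?x) + (1 - \<xi> * w) ^ (2 * m) - 1) = 0"
      using F_eval_nz[OF False w] F0 False by simp
    then obtain \<xi> where \<xi>: "\<xi> ^ n = 1" "(1 - \<xi> * w) ^ m * (?z / ?x) + (1 - \<xi> * w) ^ (2 * m) - 1 = 0"
      using finite_mu_n by (auto simp: prod_zero_iff)
    have nz: "1 - \<xi> * w \<noteq> 0"
    proof
      assume "1 - \<xi> * w = 0"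
      then show False using \<xi>(2) m2 by (simp add: zero_power)
    qed
    define s where "s = inverse (1 - \<xi> * w)"
    have s0: "s \<noteq> 0" and si: "1 - \<xi> * w = inverse s" using nz by (auto simp: s_def)
    have xw: "\<xi> * w = (s - 1) / s" using s0 si by (simp add: field_simps)
    have "(\<xi> * w) ^ n = ?y / ?x" using \<xi>(1) w by (simp add: power_mult_distrib)
    then have y: "?y = ?x / s ^ n * (s - 1) ^ n" unfolding xw using False s0 by (simp add: power_divide field_simps)
    have "(inverse s) ^ m * (?z / ?x) = (inverse s) ^ m * ((s ^ q - s) / s ^ n)"
      unfolding aff_pt_ratio[OF s0] using \<xi>(2) unfolding si by (simp add: algebra_simps)
    then have "?z / ?x = (s ^ q - s) / s ^ n"
      using s0 by (metis mult_left_cancel nonzero_imp_inverse_nonzero power_not_zero)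
    then have z: "?z = ?x / s ^ n * (s ^ q - s)" using False by (simp add: field_simps)
    have "v = (?x / s ^ n) *s aff_pt s"
      using y z s0 by (intro vec3_eqI) auto
    then have "P = proj_pt (aff_pt s)"
      using proj_pt_scale[of "?x / s ^ n" "aff_pt s"] False s0 unfolding v(2) by (metis divide_eq_0_iff power_not_zero)
    then show ?thesis by (auto simp: C_eq)
  qed
qed

text \<open>
  The parametrization by polynomials in \<open>s\<close>.
\<close>

definition aff_par :: "3 \<Rightarrow> 'k poly" where
  "aff_par = v3 ([:0, 1:] ^ n) ([:- 1, 1:] ^ n) ([:0, 1:] ^ q - [:0, 1:])"

lemma aff_par_simps: "aff_par 1 = [:0, 1:] ^ n" "aff_par 2 = [:- 1, 1:] ^ n" "aff_par 3 = [:0, 1:] ^ q - [:0, 1:]"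
  by (simp_all add: aff_par_def)

lemma poly_aff_par: "(\<lambda>i. poly (aff_par i) s) = vec_nth (aff_pt s)"
  unfolding aff_pt_def by (rule v3_eqI) (simp_all add: aff_par_simps algebra_simps)

lemma poly_aff_par': "poly (aff_par i) s = vec_nth (aff_pt s) i" using poly_aff_par by (rule fun_cong)

lemma poly_mp_poly_aff_par: "poly (mp_poly aff_par A) s = mp_eval id (vec_nth (aff_pt s)) A"
  by (simp add: poly_mp_poly poly_aff_par)

text \<open>The parametrization in the coordinate \<open>1/s\<close>, which covers the point \<open>s = \<infinity>\<close>.\<close>

definition inf_par :: "3 \<Rightarrow> 'k poly" where
  "inf_par = v3 ([:0, 1:] ^ m) ([:1, - 1:] ^ n * [:0, 1:] ^ m) (1 - [:0, 1:] ^ (2 * m))"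

lemma inf_par_simps: "inf_par 1 = [:0, 1:] ^ m" "inf_par 2 = [:1, - 1:] ^ n * [:0, 1:] ^ m" "inf_par 3 = 1 - [:0, 1:] ^ (2 * m)"
  by (simp_all add: inf_par_def)

lemma poly_inf_par: "(\<lambda>i. poly (inf_par i) t) = v3 (t ^ m) ((1 - t) ^ n * t ^ m) (1 - t ^ (2 * m))"
  by (rule v3_eqI) (simp_all add: inf_par_simps)

lemma poly_inf_par_0: "(\<lambda>i. poly (inf_par i) 0) = v3 0 0 1"
  unfolding poly_inf_par using pos by (intro v3_eqI) (auto simp: zero_power)

lemma poly_inf_par_aff_pt:
  assumes t: "t \<noteq> 0"
  shows "(\<lambda>i. poly (inf_par i) t) = (\<lambda>i. t ^ q * vec_nth (aff_pt (inverse t)) i)"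
  unfolding poly_inf_par
proof (rule v3_eqI[symmetric])
  have tq: "t ^ q = t ^ m * t ^ n" "t ^ q = t * t ^ (2 * m)" using power_q[of t] by (simp_all only: mult.commute)
  show "t ^ q * vec_nth (aff_pt (inverse t)) 1 = t ^ m" using t by (simp add: tq(1) power_inverse)
  have "inverse t - 1 = (1 - t) * inverse t" using t by (simp add: field_simps)
  then show "t ^ q * vec_nth (aff_pt (inverse t)) 2 = (1 - t) ^ n * t ^ m"
    using t by (simp add: tq(1) power_inverse power_mult_distrib)
  show "t ^ q * vec_nth (aff_pt (inverse t)) 3 = 1 - t ^ (2 * m)"
    using t by (simp add: power_inverse right_diff_distrib) (simp add: tq(2))
qed

text \<open>
  The two parametrizations agree up to the factor \<open>t\<^sup>q\<close>.
\<close>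

lemma mp_poly_inf_par_eq_0:
  assumes A: "homogeneous d A" and z: "\<And>s. mp_eval id (vec_nth (aff_pt s)) A = 0"
  shows "mp_poly inf_par A = 0"
proof (rule poly_eq_0_of_cofinite[of "{0}"])
  fix t :: 'k assume "t \<notin> {0}"
  then show "poly (mp_poly inf_par A) t = 0"
    using id_hom.mp_eval_homogeneous[OF A, of "t ^ q" "vec_nth (aff_pt (inverse t))"] z
    by (simp add: poly_mp_poly poly_inf_par_aff_pt)
qed simp

lemma vanishes_on_C_iff:
  assumes A: "homogeneous d A"
  shows "(\<forall>P\<in>C. vanishes_at A P) \<longleftrightarrow> mp_poly aff_par A = 0"
proof
  assume "\<forall>P\<in>C. vanishes_at A P"
  then have "vanishes_at A (proj_pt (aff_pt s))" for s by (auto simp: C_eq)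
  then show "mp_poly aff_par A = 0"
    by (intro poly_eq_0_of_cofinite[of "{}"]) (auto simp: poly_mp_poly_aff_par vanishes_at_proj_pt[OF A])
next
  assume "mp_poly aff_par A = 0"
  then have z: "mp_eval id (vec_nth (aff_pt s)) A = 0" for s by (metis poly_0 poly_mp_poly_aff_par)
  have "mp_eval id (v3 0 0 1) A = 0"
    using mp_poly_inf_par_eq_0[OF A z] poly_mp_poly[of inf_par A 0] unfolding poly_inf_par_0 by simp
  then show "\<forall>P\<in>C. vanishes_at A P"
    using z by (auto simp: C_eq Pinf_def vanishes_at_proj_pt[OF A])
qed

end

subsection \<open>Irreducibility\<close>

lemma v3_poly: "(\<lambda>i. poly (v3 a b c i) t) = v3 (poly a t) (poly b t) (poly c t)"
  by (rule v3_eqI) simp_all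

context curve_params
begin

text \<open>
  The value of \<open>z/x\<close> at the parameter \<open>s = 1/(1 - w)\<close>.
\<close>

definition zx :: "'k \<Rightarrow> 'k" where
  "zx w = (1 - (1 - w) ^ (2 * m)) / (1 - w) ^ m"

lemma aff_pt_as_multiple:
  assumes "w \<noteq> 1"
  shows "vec_nth (aff_pt (inverse (1 - w))) = (\<lambda>i. inverse (1 - w) ^ n * v3 1 (w ^ n) (zx w) i)"
proof -
  define s where "s = inverse (1 - w)"
  have s0: "s \<noteq> 0" and si: "inverse s = 1 - w" using assms by (simp_all add: s_def)
  have s1: "s - 1 = s * w"
  proof -
    have "s * (1 - w) = 1" using assms by (simp add: s_def)
    then have "s = 1 + s * w" by (simp add: right_diff_distrib diff_eq_eq)
    then show ?thesis by (metis add_diff_cancel_left')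
  qed
  have "(1 - w) ^ m * ((s ^ q - s) / s ^ n) = 1 - (1 - w) ^ (2 * m)"
    using aff_pt_ratio[OF s0] unfolding si .
  then have "(s ^ q - s) / s ^ n = zx w"
    using assms by (simp add: zx_def eq_divide_eq mult.commute)
  then have "s ^ q - s = s ^ n * zx w"
    using s0 by (simp add: divide_eq_eq mult.commute)
  then show ?thesis
    unfolding s_def[symmetric] aff_pt_def
    by (intro v3_eqI[symmetric]) (simp_all add: s1 power_mult_distrib)
qed

text \<open>
  The line \<open>y = w\<^sup>n x\<close> meets the curve in \<open>n\<close> different points apart from \<open>(0:0:1)\<close>.
\<close>

definition generic :: "'k \<Rightarrow> bool" where
  "generic w \<longleftrightarrow> (\<forall>\<xi>\<in>mu_n. \<xi> * w \<noteq> 1) \<and> inj_on (\<lambda>\<xi>. zx (\<xi> * w)) mu_n"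

text \<open>
  The values of \<open>z/x\<close> at \<open>\<xi>w\<close> and \<open>\<xi>'w\<close> agree only at the zeros of a polynomial, which is not the zero
  polynomial because at \<open>w = 1/\<xi>\<close> just one of the two values has a pole.
\<close>

lemma finite_not_generic: "finite {w. \<not> generic w}"
proof -
  define D where "D = (\<lambda>\<xi> \<xi>'::'k. (1 - [:1, - \<xi>:] ^ (2 * m)) * [:1, - \<xi>':] ^ m - (1 - [:1, - \<xi>':] ^ (2 * m)) * [:1, - \<xi>:] ^ m)"
  have D: "D \<xi> \<xi>' \<noteq> 0" if "\<xi> \<in> mu_n" "\<xi>' \<in> mu_n" "\<xi> \<noteq> \<xi>'" for \<xi> \<xi>'
  proof
    assume D0: "D \<xi> \<xi>' = 0"
    have z: "\<xi> \<noteq> 0" using mu_n_nz[OF that(1)] .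
    have "poly (D \<xi> \<xi>') (inverse \<xi>) = (1 - \<xi>' / \<xi>) ^ m"
      using z pos by (simp add: D_def zero_power divide_inverse mult.commute)
    then have "\<xi>' / \<xi> = 1" using D0 pos by simp
    then show False using z that(3) by simp
  qed
  have "{w. \<not> generic w} \<subseteq> inverse ` mu_n \<union> (\<Union>\<xi>\<in>mu_n. \<Union>\<xi>'\<in>mu_n - {\<xi>}. {w. poly (D \<xi> \<xi>') w = 0})"
  proof
    fix w assume "w \<in> {w. \<not> generic w}"
    then have ng: "\<not> generic w" by simp
    show "w \<in> inverse ` mu_n \<union> (\<Union>\<xi>\<in>mu_n. \<Union>\<xi>'\<in>mu_n - {\<xi>}. {w. poly (D \<xi> \<xi>') w = 0})"
    proof (cases "\<exists>\<xi>\<in>mu_n. \<xi> * w = 1")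
      case True
      then obtain \<xi> where "\<xi> \<in> mu_n" "\<xi> * w = 1" by blast
      then have "w = inverse \<xi>" by (metis inverse_unique)
      then show ?thesis using \<open>\<xi> \<in> mu_n\<close> by blast
    next
      case False
      then have "\<not> inj_on (\<lambda>\<xi>. zx (\<xi> * w)) mu_n" using ng by (auto simp: generic_def)
      then obtain \<xi> \<xi>' where x: "\<xi> \<in> mu_n" "\<xi>' \<in> mu_n" "\<xi> \<noteq> \<xi>'" "zx (\<xi> * w) = zx (\<xi>' * w)"
        unfolding inj_on_def by blast
      have "1 - \<xi> * w \<noteq> 0" "1 - \<xi>' * w \<noteq> 0" using False x by auto
      then have "poly (D \<xi> \<xi>') w = 0"
        using x(4) by (simp add: D_def zx_def frac_eq_eq mult.commute)
      then show ?thesis using x by blast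
    qed
  qed
  moreover have "finite (inverse ` mu_n \<union> (\<Union>\<xi>\<in>mu_n. \<Union>\<xi>'\<in>mu_n - {\<xi>}. {w. poly (D \<xi> \<xi>') w = 0}))"
    using finite_mu_n poly_roots_finite[OF D] by auto
  ultimately show ?thesis by (rule finite_subset)
qed

text \<open>
  The restriction of \<open>A\<close> to the line through \<open>(0:0:1)\<close> and \<open>(1:y:0)\<close>, as a polynomial in \<open>z\<close>.
\<close>

abbreviation fibre_poly :: "('k, 3) mpoly \<Rightarrow> 'k \<Rightarrow> 'k poly" where
  "fibre_poly A y \<equiv> mp_poly (v3 1 [:y:] [:0, 1:]) A"

lemma poly_fibre_poly: "poly (fibre_poly A y) z = mp_eval id (v3 1 y z) A"
  by (simp add: poly_mp_poly v3_poly)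

lemma fibre_poly_F: "fibre_poly F (w ^ n) = (\<Prod>\<xi>\<in>mu_n. [:(1 - \<xi> * w) ^ (2 * m) - 1, (1 - \<xi> * w) ^ m:])"
proof (rule poly_eqI_cofinite[of "{}"])
  fix z
  have "mp_eval id (v3 1 (w ^ n) z) F = (\<Prod>\<xi>\<in>mu_n. (1 - \<xi> * w) ^ m * z + (1 - \<xi> * w) ^ (2 * m) - 1)"
    by (subst F_eval_nz[of _ w]) simp_all
  then show "poly (fibre_poly F (w ^ n)) z = poly (\<Prod>\<xi>\<in>mu_n. [:(1 - \<xi> * w) ^ (2 * m) - 1, (1 - \<xi> * w) ^ m:]) z"
    unfolding poly_fibre_poly poly_prod by (simp add: algebra_simps)
qed simp

lemma fibre_poly_F_nz: "fibre_poly F y \<noteq> 0" and degree_fibre_poly_F: "degree (fibre_poly F y) \<le> n"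
proof -
  obtain w where w: "y = w ^ n" using nth_root_exists[of n y] pos by metis
  have "[:(1 - \<xi> * w) ^ (2 * m) - 1, (1 - \<xi> * w) ^ m:] \<noteq> 0" for \<xi>
    using pos by (cases "1 - \<xi> * w = 0") (auto simp: zero_power)
  then show "fibre_poly F y \<noteq> 0" unfolding w fibre_poly_F using finite_mu_n by (simp only: prod_zero_iff) blast
  show "degree (fibre_poly F y) \<le> n"
    unfolding w fibre_poly_F using coeff_prod_linear(1)[OF finite_mu_n] by (simp only: card_mu_n)
qed

text \<open>
  If \<open>A\<close> vanishes on the curve, then it has \<open>n\<close> zeros on a generic line through \<open>(0:0:1)\<close>, and these are all
  that the equation allows. Hence \<open>B\<close> is constant on these lines, that is, \<open>B(1,y,z)\<close> only depends on
  \<open>y\<close>. It has no zero, since the equation vanishes on no line \<open>y = const\<close>; so it is constant. Then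
  \<open>B\<close> is a multiple of a power of \<open>X\<close>, and \<open>X\<close> does not divide the equation.
\<close>

lemma cofactor_dvd_1:
  assumes AB: "F = A * B" and A: "homogeneous dA A" and B: "homogeneous dB B"
    and A0: "mp_poly aff_par A = 0"
  shows "B dvd 1"
proof -
  have Aph: "mp_eval id (vec_nth (aff_pt s)) A = 0" for s
    by (metis A0 poly_0 poly_mp_poly_aff_par)
  have Azx: "mp_eval id (v3 1 (w ^ n) (zx w)) A = 0" if "w \<noteq> 1" for w
    using Aph[of "inverse (1 - w)"] that
    unfolding aff_pt_as_multiple[OF that] id_hom.mp_eval_homogeneous[OF A] by simp
  have pzAB: "fibre_poly F y = fibre_poly A y * fibre_poly B y" for y unfolding AB by (rule pc_hom.mp_eval_mult)
  have gen: "mp_eval id (v3 1 (w ^ n) z) B = mp_eval id (v3 1 (w ^ n) 0) B" if w: "generic w" for w z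
  proof -
    have nz: "fibre_poly A (w ^ n) \<noteq> 0" "fibre_poly B (w ^ n) \<noteq> 0" using fibre_poly_F_nz[of "w ^ n"] unfolding pzAB by auto
    have "(\<lambda>\<xi>. zx (\<xi> * w)) ` mu_n \<subseteq> {z. poly (fibre_poly A (w ^ n)) z = 0}"
    proof (rule image_subsetI)
      fix \<xi> assume "\<xi> \<in> mu_n"
      then have "(\<xi> * w) ^ n = w ^ n" "\<xi> * w \<noteq> 1" using w by (auto simp: power_mult_distrib generic_def)
      then show "zx (\<xi> * w) \<in> {z. poly (fibre_poly A (w ^ n)) z = 0}" using Azx[of "\<xi> * w"] by (simp add: poly_fibre_poly)
    qed
    then have "card ((\<lambda>\<xi>. zx (\<xi> * w)) ` mu_n) \<le> degree (fibre_poly A (w ^ n))"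
      using card_mono[OF poly_roots_finite[OF nz(1)]] card_poly_roots_bound[OF nz(1)] le_trans by blast
    then have "n \<le> degree (fibre_poly A (w ^ n))"
      using w by (simp add: generic_def card_image card_mu_n)
    moreover have "degree (fibre_poly A (w ^ n)) + degree (fibre_poly B (w ^ n)) \<le> n"
      using degree_fibre_poly_F[of "w ^ n"] unfolding pzAB using degree_mult_eq[OF nz] by simp
    ultimately have "degree (fibre_poly B (w ^ n)) = 0" by simp
    then obtain c where "fibre_poly B (w ^ n) = [:c:]" by (elim degree_eq_zeroE)
    then show ?thesis using poly_fibre_poly[of "w ^ n" B z] poly_fibre_poly[of "w ^ n" B 0] by simp
  qed
  have const_z: "mp_eval id (v3 1 y z) B = mp_eval id (v3 1 y 0) B" for y z
  proof -
    obtain w where w: "y = w ^ n" using nth_root_exists[of n y] pos by metis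
    have "mp_poly (v3 1 ([:0, 1:] ^ n) [:z:]) B = mp_poly (v3 1 ([:0, 1:] ^ n) 0) B"
      by (rule poly_eqI_cofinite[OF finite_not_generic]) (simp add: poly_mp_poly v3_poly, rule gen, simp)
    from arg_cong[OF this, of "\<lambda>p. poly p w"] show ?thesis
      by (simp add: poly_mp_poly v3_poly w)
  qed
  define b where "b = mp_poly (v3 1 [:0, 1:] 0) B"
  have b: "poly b y = mp_eval id (v3 1 y z) B" for y z
    unfolding const_z[of y z] by (simp add: b_def poly_mp_poly v3_poly)
  have "poly b y \<noteq> 0" for y
  proof
    assume "poly b y = 0"
    then have "fibre_poly B y = 0" by (intro poly_eq_0_of_cofinite[of "{}"]) (auto simp: poly_fibre_poly b[symmetric])
    then show False using fibre_poly_F_nz[of y] pzAB[of y] by simp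
  qed
  then have "degree b = 0" using alg_closed_imp_poly_has_root[of b] by auto
  then obtain c where c: "b = [:c:]" by (elim degree_eq_zeroE)
  have B1: "mp_eval id (v3 1 y z) B = c" for y z using b[of y z] c by simp
  have "dB = 0"
  proof (rule ccontr)
    assume "dB \<noteq> 0"
    have "mp_poly (v3 [:0, 1:] 1 1) B = Polynomial.smult c ([:0, 1:] ^ dB)"
    proof (rule poly_eqI_cofinite[of "{0}"])
      fix x :: 'k assume "x \<notin> {0}"
      then have "v3 x 1 1 = (\<lambda>i. x * v3 1 (1 / x) (1 / x) i)" by (intro v3_eqI[symmetric]) auto
      then show "poly (mp_poly (v3 [:0, 1:] 1 1) B) x = poly (Polynomial.smult c ([:0, 1:] ^ dB)) x"
        using id_hom.mp_eval_homogeneous[OF B, of x "v3 1 (1 / x) (1 / x)"] B1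
        by (simp add: poly_mp_poly v3_poly)
    qed simp
    from arg_cong[OF this, of "\<lambda>p. poly p 0"] have "mp_eval id (v3 0 1 1) B = 0"
      using \<open>dB \<noteq> 0\<close> by (simp add: poly_mp_poly v3_poly zero_power)
    then have "mp_eval id (v3 0 1 1) F = 0" unfolding AB by (simp add: id_hom.mp_eval_mult)
    then show False using eq_coeff_top by (simp add: F_eval_0)
  qed
  define c' where "c' = Poly_Mapping.lookup B 0"
  have Bc: "B = Poly_Mapping.single 0 c'"
    using homogeneous_0_imp_const B \<open>dB = 0\<close> unfolding c'_def by blast
  have "F \<noteq> 0" using fibre_poly_F_nz[of 0] by auto
  then have "c' \<noteq> 0" using AB Bc by auto
  then have "B * Poly_Mapping.single 0 (inverse c') = 1" unfolding Bc by (simp add: mult_single)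
  then show ?thesis by (metis dvd_triv_left)
qed

lemma irreducible_F: "Factorial_Ring.irreducible F"
proof (rule Factorial_Ring.irreducibleI)
  show Fnz: "F \<noteq> 0" using fibre_poly_F_nz[of 0] by auto
  have "mp_eval id (v3 0 1 0) F = 0" using pos by (simp add: F_eval_0 zero_power)
  moreover have "mp_eval id (v3 0 1 0) F \<noteq> 0" if "F dvd 1"
  proof
    assume *: "mp_eval id (v3 0 1 0) F = 0"
    obtain G where "1 = F * G" using \<open>F dvd 1\<close> by (elim dvdE)
    then have "mp_eval id (v3 0 1 0) 1 = mp_eval id (v3 0 1 0) F * mp_eval id (v3 0 1 0) G"
      by (metis id_hom.mp_eval_mult)
    then show False using * by simp
  qed
  ultimately show "\<not> F dvd 1" by blast
  fix A B assume AB: "F = A * B"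
  obtain dA where A: "homogeneous dA A" using homogeneous_factor[of q A B] homogeneous_F Fnz AB by auto
  have BA: "F = B * A" using AB by (simp add: mult.commute)
  obtain dB where B: "homogeneous dB B" using homogeneous_factor[of q B A] homogeneous_F Fnz BA by auto
  have "mp_poly aff_par F = 0"
    using vanishes_on_C_iff[OF homogeneous_F] zero_locus_F by (auto simp: zero_locus_def)
  then have "mp_poly aff_par A * mp_poly aff_par B = 0" unfolding AB by (simp add: pc_hom.mp_eval_mult)
  then consider "mp_poly aff_par A = 0" | "mp_poly aff_par B = 0" by auto
  then show "A dvd 1 \<or> B dvd 1"
    using cofactor_dvd_1[OF AB A B] cofactor_dvd_1[OF BA B A] by cases auto
qed

lemma curve_equation_F: "curve_equation q F C"
  by (simp add: curve_equation_def homogeneous_F irreducible_F zero_locus_F)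

lemma smooth_P1: "smooth_point C (proj_pt (vector [0, 1, 0]))"
  unfolding smooth_point_def
proof (intro conjI exI)
  show "curve_equation q F C" by (rule curve_equation_F)
  show "\<not> vanishes_at (mp_pderiv 1 F) (proj_pt (vector [0, 1, 0]))"
    using F_pderiv_P1 proj_pt_self unfolding vanishes_at_def by blast
  have "(vector [0, 1, 0] :: 'k ^ 3) \<noteq> 0" by (auto simp: vec_eq_iff forall_3)
  then show "proj_pt (vector [0, 1, 0]) \<in> C"
    unfolding zero_locus_F[symmetric] zero_locus_def using pos
    by (auto simp: vanishes_at_proj_pt[OF homogeneous_F] proj_space_def F_eval_0 zero_power)
qed

lemma smooth_P2: "smooth_point C (proj_pt (vector [1, 0, 0]))"
  unfolding smooth_point_def
proof (intro conjI exI)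
  show "curve_equation q F C" by (rule curve_equation_F)
  show "\<not> vanishes_at (mp_pderiv 2 F) (proj_pt (vector [1, 0, 0]))"
    using F_pderiv_P2 proj_pt_self unfolding vanishes_at_def by blast
  have "aff_pt 1 = vector [1, 0, 0]" using pos by (intro vec3_eqI) (simp_all add: zero_power)
  then show "proj_pt (vector [1, 0, 0]) \<in> C" unfolding C_eq by (metis insertCI rangeI)
qed

end

section \<open>Quotients of forms along a parametrization\<close>

definition mval :: "('n::finite \<Rightarrow> 'k::field poly) \<Rightarrow> ('k, 'n) mpoly \<Rightarrow> 'k poly fract" where
  "mval l A = mp_eval cst (\<lambda>i. to_fract (l i)) A"

lemma mval_eq: "mval l A = to_fract (mp_poly l A)"
  by (simp add: mval_def to_fract_mp_poly)

lemma mval_eq_0_iff: "mval l A = 0 \<longleftrightarrow> mp_poly l A = 0"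
  by (simp add: mval_eq)

lemma mval_simps:
  "mval l (A * B) = mval l A * mval l B" "mval l (A + B) = mval l A + mval l B"
  "mval l (A - B) = mval l A - mval l B" "mval l 0 = 0" "mval l 1 = 1"
  "mval l (Poly_Mapping.single 0 c) = cst c"
  by (simp_all add: mval_def cst_hom.mp_eval_mult cst_hom.mp_eval_add cst_hom.mp_eval_diff cst_hom.mp_eval_const)

lemma mval_var: "mval l (Poly_Mapping.single (Poly_Mapping.single i 1) 1) = to_fract (l i)"
  unfolding mval_def cst_hom.mp_eval_var by simp

text \<open>
  Values of the quotients of forms of the same degree along the map to projective space with coordinate
  functions \<open>l\<close>.
\<close>

definition ratios :: "('n::finite \<Rightarrow> 'k::field poly) \<Rightarrow> 'k poly fract set" where
  "ratios l = {mval l A / mval l B | A B. (\<exists>d. homogeneous d A \<and> homogeneous d B) \<and> mval l B \<noteq> 0}"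

lemma ratiosI: "homogeneous d A \<Longrightarrow> homogeneous d B \<Longrightarrow> mval l B \<noteq> 0 \<Longrightarrow> mval l A / mval l B \<in> ratios l"
  unfolding ratios_def by blast

lemma subfld_ratios: "subfld (ratios l)"
  unfolding subfld_def
proof (intro conjI ballI)
  show "range cst \<subseteq> ratios l"
  proof (rule image_subsetI)
    fix c show "cst c \<in> ratios l"
      using ratiosI[OF homogeneous_const homogeneous_1, of l c] by (simp add: mval_simps)
  qed
next
  fix x y assume "x \<in> ratios l" "y \<in> ratios l"
  then obtain A B d A' B' d' where x: "x = mval l A / mval l B" "homogeneous d A" "homogeneous d B" "mval l B \<noteq> 0"
    and y: "y = mval l A' / mval l B'" "homogeneous d' A'" "homogeneous d' B'" "mval l B' \<noteq> 0"
    unfolding ratios_def by blast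
  have "x + y = mval l (A * B' + A' * B) / mval l (B * B')"
    unfolding x(1) y(1) mval_simps using x(4) y(4) by (rule add_frac_eq)
  moreover have "homogeneous (d + d') (A * B' + A' * B)"
    using homogeneous_mult[OF x(2) y(3)] homogeneous_mult[OF y(2) x(3)]
    by (intro homogeneous_add) (simp_all add: add.commute)
  ultimately show "x + y \<in> ratios l"
    using ratiosI[OF _ homogeneous_mult[OF x(3) y(3)], of "A * B' + A' * B" l] x(4) y(4) by (simp add: mval_simps)
  have "x * y = mval l (A * A') / mval l (B * B')"
    unfolding x(1) y(1) mval_simps by simp
  then show "x * y \<in> ratios l"
    using ratiosI[OF homogeneous_mult[OF x(2) y(2)] homogeneous_mult[OF x(3) y(3)], of l] x(4) y(4) by (simp add: mval_simps)
next
  fix x assume "x \<in> ratios l"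
  then obtain A B d where x: "x = mval l A / mval l B" "homogeneous d A" "homogeneous d B" "mval l B \<noteq> 0"
    unfolding ratios_def by blast
  show "inverse x \<in> ratios l"
  proof (cases "mval l A = 0")
    case True
    then show ?thesis using ratiosI[OF homogeneous_0 homogeneous_1, of l] x(1) by (simp add: mval_simps)
  next
    case False
    then show ?thesis using ratiosI[OF x(3,2) False] x(1) by simp
  qed
qed

lemma var_ratio: "l j \<noteq> 0 \<Longrightarrow> to_fract (l i) / to_fract (l j) \<in> ratios l"
  using ratiosI[OF homogeneous_var homogeneous_var, of l j 1 i 1] unfolding mval_var to_fract_eq_0_iff by simp

text \<open>
  Divide numerator and denominator by the power of \<open>l j\<close> that makes them polynomials in the \<open>l i / l j\<close>.
\<close>

lemma ratios_subset:
  assumes T: "subfld T" and j: "l j \<noteq> 0" and i: "\<And>i. to_fract (l i) / to_fract (l j) \<in> T"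
  shows "ratios l \<subseteq> T"
proof
  fix x assume "x \<in> ratios l"
  then obtain A B d where x: "x = mval l A / mval l B" "homogeneous d A" "homogeneous d B" "mval l B \<noteq> 0"
    unfolding ratios_def by blast
  define y where "y = (\<lambda>i. to_fract (l i) / to_fract (l j))"
  have l: "(\<lambda>i. to_fract (l i)) = (\<lambda>i. to_fract (l j) * y i)" using j by (simp add: y_def)
  have s: "mval l G = to_fract (l j) ^ d * mp_eval cst y G" if "homogeneous d G" for G
    unfolding mval_def l by (rule cst_hom.mp_eval_homogeneous[OF that])
  have yT: "mp_eval cst y G \<in> T" for G
    unfolding mp_eval_def using i
    by (intro subfld_sum[OF T] subfld_mult[OF T] subfld_prod[OF T] subfld_power[OF T] subfld_cst[OF T]) (simp add: y_def)
  have "x = mp_eval cst y A / mp_eval cst y B"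
    unfolding x(1) s[OF x(2)] s[OF x(3)] using j by simp
  then show "x \<in> T" using yT subfld_divide[OF T] by simp
qed

section \<open>The parametrization is birational\<close>

lemma map_poly_sum_hom:
  assumes "g 0 = 0" "\<And>a b. g (a + b) = g a + g b"
  shows "map_poly g (sum f A) = (\<Sum>a\<in>A. map_poly g (f a :: 'a::comm_semiring_1 poly))"
proof -
  have s: "g (sum f A) = (\<Sum>a\<in>A. g (f a))" for f :: "_ \<Rightarrow> 'a" and A
    by (induction A rule: infinite_finite_induct) (auto simp: assms)
  show ?thesis by (rule poly_eqI) (simp add: coeff_map_poly assms coeff_sum s)
qed

text \<open>
  Lagrange interpolation. Let \<open>c \<xi>\<close> be the conjugate of \<open>e\<close> under \<open>w \<mapsto> \<xi>w\<close>. The coefficients of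
  \<open>E = \<Prod> (Y - c \<xi>)\<close> and of the interpolation polynomial \<open>L\<close>, which is \<open>\<Sum> \<xi>w \<Prod> (Y - c z)\<close> with the inner
  product over all \<open>z \<noteq> \<xi>\<close>, are invariant and so are functions of \<open>w\<^sup>n\<close>. At \<open>Y = e\<close> only the
  summand for \<open>\<xi> = 1\<close> remains, and \<open>w = L(e)/E'(e)\<close>.
\<close>

lemma kummer_generator:
  fixes e :: "'k::alg_closed_field poly"
  assumes n: "of_nat n \<noteq> (0::'k)" and T: "subfld T"
    and w: "w \<notin> range cst" "w ^ n \<in> T" and e: "ev e w \<in> T"
    and dist: "\<And>\<xi>. \<xi> ^ n = 1 \<Longrightarrow> \<xi> \<noteq> 1 \<Longrightarrow> e \<circ>\<^sub>p [:0, \<xi>:] \<noteq> e"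
  shows "w \<in> T"
proof -
  have n0: "n > 0" using n by (auto intro: Nat.gr0I)
  let ?M = "{z::'k. z ^ n = 1}"
  have fin: "finite ?M" by (rule finite_nth_roots_field[OF n0])
  define c where "c = (\<lambda>\<xi>. e \<circ>\<^sub>p [:0, \<xi>:])"
  define f where "f = (\<lambda>\<xi>. [:- c \<xi>, 1:])"
  define h where "h = (\<lambda>\<xi>::'k. [:[:0, \<xi>:]:] * (\<Prod>z\<in>?M - {\<xi>}. f z))"
  define L where "L = sum h ?M"
  define E where "E = prod f ?M"
  have c1: "c 1 = e" by (simp add: c_def pcompose_idR)
  have inv: "ev p w \<in> T" if p: "\<And>\<xi>. \<xi> ^ n = 1 \<Longrightarrow> p \<circ>\<^sub>p [:0, \<xi>:] = p" for p
  proof -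
    obtain p' where p': "to_fract p = ev p' (gen ^ n)" using scale_invariant_poly[OF n p] by blast
    have "to_fract p = to_fract (p' \<circ>\<^sub>p Polynomial.monom 1 n)"
      using ev_pcompose[of p' "Polynomial.monom 1 n" gen] p' unfolding ev_monom by simp
    then have "p = p' \<circ>\<^sub>p Polynomial.monom 1 n" by (simp only: to_fract_eq_iff)
    then have "ev p w = ev p' (w ^ n)" by (simp add: ev_pcompose)
    then show ?thesis using subfld_ev[OF T w(2)] by simp
  qed
  have evT: "ev (poly P e) w \<in> T" if P: "\<And>j \<xi>. \<xi> ^ n = 1 \<Longrightarrow> coeff P j \<circ>\<^sub>p [:0, \<xi>:] = coeff P j" for P
    unfolding poly_altdef ev_sum ev_mult ev_power
    by (intro subfld_sum[OF T] subfld_mult[OF T] subfld_power[OF T] e inv P)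
  have g: "(0::'k poly) \<circ>\<^sub>p q = 0" "1 \<circ>\<^sub>p q = 1" "(a + b) \<circ>\<^sub>p q = a \<circ>\<^sub>p q + b \<circ>\<^sub>p q"
    "(a * b) \<circ>\<^sub>p q = (a \<circ>\<^sub>p q) * (b \<circ>\<^sub>p q)" for a b q :: "'k poly"
    by (auto simp: pcompose_add pcompose_mult pcompose_1)
  have mf: "map_poly (\<lambda>p. p \<circ>\<^sub>p [:0, \<xi>:]) (f z) = f (z * \<xi>)" for z \<xi>
    by (simp add: f_def c_def map_poly_pCons g pcompose_uminus pcompose_scale)
  have mE: "map_poly (\<lambda>p. p \<circ>\<^sub>p [:0, \<xi>:]) E = E" if "\<xi> ^ n = 1" for \<xi>
  proof -
    have "map_poly (\<lambda>p. p \<circ>\<^sub>p [:0, \<xi>:]) E = (\<Prod>z\<in>?M. f (z * \<xi>))"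
      unfolding E_def map_poly_prod_hom[of "\<lambda>p. p \<circ>\<^sub>p [:0, \<xi>:]", OF g] mf ..
    also have "\<dots> = E" unfolding E_def by (rule prod_roots_of_unity_shift[OF that n0])
    finally show ?thesis .
  qed
  have mh: "map_poly (\<lambda>p. p \<circ>\<^sub>p [:0, \<xi>:]) (h z) = h (z * \<xi>)" if "\<xi> ^ n = 1" for \<xi> z
  proof -
    have x0: "\<xi> \<noteq> 0" using that n0 by (auto simp: zero_power)
    have "map_poly (\<lambda>p. p \<circ>\<^sub>p [:0, \<xi>:]) (h z) = [:[:0, z * \<xi>:]:] * (\<Prod>y\<in>?M - {z}. f (y * \<xi>))"
      unfolding h_def map_poly_mult_hom[of "\<lambda>p. p \<circ>\<^sub>p [:0, \<xi>:]", OF g(1,3,4)]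
        map_poly_prod_hom[of "\<lambda>p. p \<circ>\<^sub>p [:0, \<xi>:]", OF g] mf
      by (simp add: map_poly_pCons g pcompose_pCons mult.commute)
    also have "(\<Prod>y\<in>?M - {z}. f (y * \<xi>)) = (\<Prod>y\<in>?M - {z * \<xi>}. f y)"
      using that x0
      by (intro prod.reindex_bij_witness[of _ "\<lambda>y. y / \<xi>" "\<lambda>y. y * \<xi>"])
        (auto simp: power_mult_distrib power_divide)
    finally show ?thesis by (simp add: h_def)
  qed
  have mL: "map_poly (\<lambda>p. p \<circ>\<^sub>p [:0, \<xi>:]) L = L" if "\<xi> ^ n = 1" for \<xi>
  proof -
    have x0: "\<xi> \<noteq> 0" using that n0 by (auto simp: zero_power)
    have "map_poly (\<lambda>p. p \<circ>\<^sub>p [:0, \<xi>:]) L = (\<Sum>z\<in>?M. h (z * \<xi>))"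
      unfolding L_def map_poly_sum_hom[of "\<lambda>p. p \<circ>\<^sub>p [:0, \<xi>:]", OF g(1,3)] mh[OF that] ..
    also have "\<dots> = L"
      unfolding L_def using that x0
      by (intro sum.reindex_bij_witness[of _ "\<lambda>y. y / \<xi>" "\<lambda>y. y * \<xi>"])
        (auto simp: power_mult_distrib power_divide)
    finally show ?thesis .
  qed
  have cmap: "coeff (map_poly (\<lambda>p. p \<circ>\<^sub>p [:0, \<xi>:]) P) j = coeff P j \<circ>\<^sub>p [:0, \<xi>:]" for P :: "'k poly poly" and \<xi> j
    by (simp add: coeff_map_poly)
  have "ev (poly L e) w \<in> T"
    by (rule evT) (metis cmap mL)
  moreover have "poly L e = [:0, 1:] * (\<Prod>z\<in>?M - {1}. e - c z)"
  proof -
    have "poly (h \<xi>) e = 0" if "\<xi> \<in> ?M - {1}" for \<xi>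
    proof -
      have "(\<Prod>z\<in>?M - {\<xi>}. poly (f z) e) = 0"
        using fin that by (intro prod_zero) (auto intro!: bexI[of _ 1] simp: f_def c1)
      then show ?thesis by (simp add: h_def poly_prod)
    qed
    then have "(\<Sum>\<xi>\<in>?M - {1}. poly (h \<xi>) e) = 0" by (rule sum.neutral[OF ballI])
    then have "poly L e = poly (h 1) e"
      unfolding L_def poly_sum using fin by (subst sum.remove[of _ 1]) auto
    also have "\<dots> = [:0, 1:] * (\<Prod>z\<in>?M - {1}. e - c z)"
      unfolding h_def poly_mult poly_prod by (simp add: f_def)
    finally show ?thesis .
  qed
  moreover have "ev (poly (pderiv E) e) w \<in> T"
  proof (rule evT)
    fix j and \<xi> :: 'k assume "\<xi> ^ n = 1"
    then have "coeff E (Suc j) \<circ>\<^sub>p [:0, \<xi>:] = coeff E (Suc j)" by (metis cmap mE)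
    moreover have "(of_nat k :: 'k poly) \<circ>\<^sub>p q = of_nat k" for k q
      by (induction k) (auto simp: pcompose_add pcompose_1)
    ultimately show "coeff (pderiv E) j \<circ>\<^sub>p [:0, \<xi>:] = coeff (pderiv E) j"
      unfolding coeff_pderiv pcompose_mult by metis
  qed
  moreover have "poly (pderiv E) e = (\<Prod>z\<in>?M - {1}. e - c z)"
  proof -
    have "E = f 1 * (\<Prod>z\<in>?M - {1}. f z)" unfolding E_def using fin by (subst prod.remove[of _ 1]) auto
    then have "poly (pderiv E) e = poly (\<Prod>z\<in>?M - {1}. f z) e"
      by (simp only: pderiv_mult) (simp add: f_def c1 pderiv_pCons)
    then show ?thesis by (simp add: poly_prod f_def)
  qed
  moreover have "(\<Prod>z\<in>?M - {1}. e - c z) \<noteq> 0"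
  proof -
    have "e - c z \<noteq> 0" if "z \<in> ?M - {1}" for z
      using dist[of z, symmetric] that by (simp add: c_def)
    then show ?thesis using fin by (simp add: prod_zero_iff)
  qed
  then have "ev (\<Prod>z\<in>?M - {1}. e - c z) w \<noteq> 0" using ev_eq_0_imp w(1) by blast
  ultimately have "w * ev (\<Prod>z\<in>?M - {1}. e - c z) w \<in> T" "ev (\<Prod>z\<in>?M - {1}. e - c z) w \<in> T"
    by (simp_all only: ev_mult ev_pCons ev_0 cst_simps) simp_all
  from subfld_divide[OF T this] show ?thesis
    using \<open>ev (\<Prod>z\<in>?M - {1}. e - c z) w \<noteq> 0\<close> by simp
qed

context curve_params
begin

text \<open>
  The parametrization is birational. With \<open>w = 1 - 1/s\<close> one has \<open>w\<^sup>n = y/x\<close>, so it suffices to find an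
  element of the field whose conjugates under \<open>w \<mapsto> \<xi>w\<close> are distinct. Such an element is \<open>z/x\<close>; it is
  multiplied by an invariant polynomial \<open>Q\<close> to become a polynomial \<open>e\<close> in \<open>w\<close>. The conjugates of \<open>e\<close> differ
  because \<open>e 1 \<noteq> 0\<close> and \<open>e \<xi> = 0\<close> for the other \<open>\<xi>\<close> with \<open>\<xi>\<^sup>n = 1\<close>.
\<close>

lemma ratios_aff_par: "ratios aff_par = UNIV"
proof (rule subfld_gen_UNIV[OF subfld_ratios])
  let ?T = "ratios aff_par"
  note T = subfld_ratios[of aff_par]
  define t where "t = (gen :: 'k poly fract)"
  define w where "w = 1 - inverse t"
  have t0: "t \<noteq> 0" by (simp add: t_def)
  have l1: "aff_par 1 \<noteq> 0" by (simp add: aff_par_simps)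
  have tp: "to_fract (p ^ i) = to_fract p ^ i" for p :: "'k poly" and i by (induction i) auto
  have t1: "t - 1 = to_fract [:- 1, 1:]"
    by (simp add: t_def gen_def flip: to_fract_1 to_fract_diff) (simp add: one_pCons)
  have lpt: "to_fract (aff_par 1) = t ^ n" "to_fract (aff_par 2) = (t - 1) ^ n" "to_fract (aff_par 3) = t ^ q - t"
    unfolding t1 by (simp_all add: aff_par_simps tp t_def gen_def)
  have wt: "t - 1 = t * w" using t0 by (simp add: w_def right_diff_distrib)
  have u: "1 - w = inverse t" by (simp add: w_def)
  have "w \<notin> range cst"
  proof
    assume "w \<in> range cst"
    then obtain c where "w = cst c" by auto
    then have "inverse t = cst (1 - c)" using u by simp
    then have "t = cst (inverse (1 - c))" by (metis cst_inverse inverse_inverse_eq)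
    then show False unfolding t_def by (simp only: gen_not_cst)
  qed
  have v: "w ^ n \<in> ?T"
  proof -
    have "to_fract (aff_par 2) / to_fract (aff_par 1) = w ^ n" unfolding lpt wt using t0 by (simp add: power_mult_distrib)
    then show ?thesis using var_ratio[where l = aff_par and j = 1 and i = 2, OF l1] by simp
  qed
  define Q where "Q = (\<Prod>\<xi>\<in>mu_n. [:1, - \<xi>:] ^ m)"
  define Q1 where "Q1 = (\<Prod>\<xi>\<in>mu_n - {1}. [:1, - \<xi>:] ^ m)"
  have Q: "Q = [:1, - 1:] ^ m * Q1"
    unfolding Q_def Q1_def using finite_mu_n by (subst prod.remove[of _ 1]) auto
  define e where "e = (1 - [:1, - 1:] ^ (2 * m)) * Q1"
  have QT: "ev Q w \<in> ?T"
  proof -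
    have "Q \<circ>\<^sub>p [:0, \<xi>:] = Q" if "\<xi> ^ n = 1" for \<xi>
      using eq_norm_invariant[OF that, of n] unfolding coeff_norm_poly_n Q_def .
    then obtain p' where p': "to_fract Q = ev p' (gen ^ n)" using scale_invariant_poly[OF nonzero_of_nat(1)] by blast
    have "to_fract Q = to_fract (p' \<circ>\<^sub>p Polynomial.monom 1 n)"
      using ev_pcompose[of p' "Polynomial.monom 1 n" gen] p' unfolding ev_monom by simp
    then have "Q = p' \<circ>\<^sub>p Polynomial.monom 1 n" by (simp only: to_fract_eq_iff)
    then have "ev Q w = ev p' (w ^ n)" by (simp add: ev_pcompose)
    then show ?thesis using subfld_ev[OF T v] by simp
  qed
  have eT: "ev e w \<in> ?T"
  proof -
    have e1: "ev [:1, - 1:] w = 1 - w" by simp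
    have "t ^ q - t = t * (t ^ (2 * m) - 1)" using power_q(2)[of t] by (simp add: right_diff_distrib)
    then have "to_fract (aff_par 3) / to_fract (aff_par 1) * ev Q w = (t * (t ^ (2 * m) - 1) / t ^ n) * ((1 - w) ^ m * ev Q1 w)"
      unfolding lpt Q ev_mult ev_power e1 by simp
    also have "t ^ n = t * t ^ m" by (simp add: n)
    also have "t * (t ^ (2 * m) - 1) / (t * t ^ m) * ((1 - w) ^ m * ev Q1 w) = (1 - (1 - w) ^ (2 * m)) * ev Q1 w"
    proof -
      have "(t ^ (2 * m) - 1) * inverse (t ^ m) * inverse (t ^ m) = 1 - inverse (t ^ (2 * m))"
      proof -
        have "(a * a - 1) * inverse a * inverse a = 1 - inverse (a * a)" if "a \<noteq> 0" for a :: "'k poly fract"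
          using that by (simp add: field_simps)
        from this[of "t ^ m"] show ?thesis using t0 by (simp add: mult_2 power_add)
      qed
      then show ?thesis unfolding u power_inverse using t0 by (simp add: divide_inverse ac_simps)
    qed
    also have "\<dots> = ev e w" unfolding e_def ev_mult ev_diff ev_power e1 by simp
    finally show ?thesis using subfld_mult[OF T var_ratio[where l = aff_par and j = 1 and i = 3, OF l1] QT] by simp
  qed
  have "w \<in> ?T"
  proof (rule kummer_generator[OF nonzero_of_nat(1) T _ v eT])
    show "w \<notin> range cst" by fact
    fix \<xi> :: 'k assume \<xi>: "\<xi> ^ n = 1" "\<xi> \<noteq> 1"
    show "e \<circ>\<^sub>p [:0, \<xi>:] \<noteq> e"
    proof
      assume e\<xi>: "e \<circ>\<^sub>p [:0, \<xi>:] = e"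
      have "poly e \<xi> = poly (e \<circ>\<^sub>p [:0, \<xi>:]) 1" by (simp add: poly_pcompose)
      then have "poly e \<xi> = poly e 1" unfolding e\<xi> .
      moreover have "poly Q1 \<xi> = 0"
      proof -
        have "\<xi> \<noteq> 0" using \<xi> pos by (auto simp: zero_power)
        then have "inverse \<xi> \<in> mu_n - {1}" using \<xi> by (auto simp: power_inverse)
        moreover have "poly ([:1, - inverse \<xi>:] ^ m) \<xi> = 0" using \<open>\<xi> \<noteq> 0\<close> pos by (simp add: zero_power)
        ultimately show ?thesis unfolding Q1_def poly_prod using finite_mu_n by (intro prod_zero) auto
      qed
      moreover have "poly Q1 1 \<noteq> 0"
        unfolding Q1_def poly_prod using finite_mu_n by (auto simp: prod_zero_iff)
      ultimately show False using pos by (simp add: e_def zero_power)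
    qed
  qed
  then have "inverse (1 - w) \<in> ?T" using subfld_inverse[OF T] subfld_diff[OF T] subfld_01[OF T] by blast
  then show "gen \<in> ?T" using u by (simp add: t_def)
qed

section \<open>The function field of the curve\<close>

definition frac_val :: "('k, 3) mpoly \<times> ('k, 3) mpoly \<Rightarrow> 'k poly fract" where
  "frac_val = (\<lambda>(A, B). mval aff_par A / mval aff_par B)"

text \<open>
  The rational function on the curve with the value \<open>x\<close> along the parametrization.
\<close>

definition rat_cls :: "'k poly fract \<Rightarrow> ('k, 3) rat_fun" where
  "rat_cls x = {ab \<in> fractions C. frac_val ab = x}"

lemma fractions_C_iff:
  "(A, B) \<in> fractions C \<longleftrightarrow> (\<exists>d. homogeneous d A \<and> homogeneous d B) \<and> mval aff_par B \<noteq> 0"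
  unfolding fractions_def mval_eq_0_iff using vanishes_on_C_iff by blast

lemma frac_rel_C_iff:
  "(ab, ab') \<in> frac_rel C \<longleftrightarrow> ab \<in> fractions C \<and> ab' \<in> fractions C \<and> frac_val ab = frac_val ab'"
proof -
  obtain A B A' B' where ab: "ab = (A, B)" "ab' = (A', B')" by (cases ab, cases ab')
  have "(\<forall>P\<in>C. vanishes_at (A * B' - A' * B) P) \<longleftrightarrow> frac_val ab = frac_val ab'"
    if f: "ab \<in> fractions C" "ab' \<in> fractions C"
  proof -
    obtain d d' where d: "homogeneous d A" "homogeneous d B" "mval aff_par B \<noteq> 0"
      "homogeneous d' A'" "homogeneous d' B'" "mval aff_par B' \<noteq> 0"
      using f unfolding ab fractions_C_iff by blast
    have "homogeneous (d + d') (A * B' - A' * B)"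
      using homogeneous_mult[OF d(1,5)] homogeneous_mult[OF d(4,2)]
      by (intro homogeneous_diff) (simp_all add: add.commute)
    from vanishes_on_C_iff[OF this] show ?thesis
      unfolding mval_eq_0_iff[symmetric] mval_simps ab frac_val_def using d(3,6)
      by (simp add: frac_eq_eq)
  qed
  then show ?thesis unfolding frac_rel_def ab by auto
qed

lemma rat_fun_C: "(A, B) \<in> fractions C \<Longrightarrow> rat_fun C A B = rat_cls (frac_val (A, B))"
  unfolding rat_fun_def rat_cls_def by (auto simp: frac_rel_C_iff)

lemma rat_cls_nonempty: "\<exists>A B. (A, B) \<in> rat_cls x"
proof -
  have "x \<in> ratios aff_par" by (simp add: ratios_aff_par)
  then obtain A B where AB: "x = mval aff_par A / mval aff_par B" "\<exists>d. homogeneous d A \<and> homogeneous d B" "mval aff_par B \<noteq> 0"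
    unfolding ratios_def by blast
  then show ?thesis unfolding rat_cls_def by (auto simp: fractions_C_iff frac_val_def)
qed

lemma carrier_function_field: "carrier (function_field C) = range rat_cls"
proof -
  have "frac_rel C `` {ab} = rat_cls (frac_val ab)" if "ab \<in> fractions C" for ab
    using that by (auto simp: frac_rel_C_iff rat_cls_def)
  then have "carrier (function_field C) = (\<lambda>ab. rat_cls (frac_val ab)) ` fractions C"
    unfolding function_field_def quotient_def by auto
  also have "\<dots> = range rat_cls"
  proof -
    have "x \<in> frac_val ` fractions C" for x
      using rat_cls_nonempty[of x] by (auto simp: rat_cls_def)
    then have "frac_val ` fractions C = UNIV" by blast
    then show ?thesis by (metis image_image)
  qed
  finally show ?thesis .
qed

lemma inj_rat_cls: "inj rat_cls"
proof (rule injI)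
  fix x y assume "rat_cls x = rat_cls y"
  then show "x = y" using rat_cls_nonempty[of x] by (auto simp: rat_cls_def)
qed

text \<open>
  Sums and products in the function field are both unions over representatives. Here \<open>N\<close> and \<open>D\<close> stand
  for the numerator and the denominator of the result.
\<close>

lemma rat_cls_combine:
  assumes "\<And>A B A' B'. (A, B) \<in> rat_cls x \<Longrightarrow> (A', B') \<in> rat_cls y \<Longrightarrow>
    (N A B A' B', D A B A' B') \<in> fractions C \<and> frac_val (N A B A' B', D A B A' B') = z"
  shows "(\<Union>(A, B)\<in>rat_cls x. \<Union>(A', B')\<in>rat_cls y. rat_fun C (N A B A' B') (D A B A' B')) = rat_cls z"
proof -
  have "rat_fun C (N A B A' B') (D A B A' B') = rat_cls z"
    if "(A, B) \<in> rat_cls x" "(A', B') \<in> rat_cls y" for A B A' B'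
    using assms[OF that] rat_fun_C by metis
  then have "(\<Union>(A, B)\<in>rat_cls x. \<Union>(A', B')\<in>rat_cls y. rat_fun C (N A B A' B') (D A B A' B')) =
      (\<Union>(A, B)\<in>rat_cls x. \<Union>(A', B')\<in>rat_cls y. rat_cls z)"
    by (intro SUP_cong HOL.refl) (auto split: prod.splits)
  also have "\<dots> = rat_cls z" using rat_cls_nonempty[of x] rat_cls_nonempty[of y] by auto
  finally show ?thesis .
qed

lemma rat_cls_ring_iso: "rat_cls \<in> ring_iso kS (function_field C)"
proof (rule ring_iso_memI)
  fix x y :: "'k poly fract"
  show "rat_cls x \<in> carrier (function_field C)" by (simp add: carrier_function_field)
  have "rat_cls x \<otimes>\<^bsub>function_field C\<^esub> rat_cls y =
    (\<Union>(A, B)\<in>rat_cls x. \<Union>(A', B')\<in>rat_cls y. rat_fun C (A * A') (B * B'))"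
    by (simp add: function_field_def)
  also have "\<dots> = rat_cls (x * y)"
  proof (rule rat_cls_combine)
    fix A B A' B' assume "(A, B) \<in> rat_cls x" "(A', B') \<in> rat_cls y"
    then obtain d d' where d: "homogeneous d A" "homogeneous d B" "mval aff_par B \<noteq> 0" "x = mval aff_par A / mval aff_par B"
      "homogeneous d' A'" "homogeneous d' B'" "mval aff_par B' \<noteq> 0" "y = mval aff_par A' / mval aff_par B'"
      unfolding rat_cls_def mem_Collect_eq fractions_C_iff by (auto simp: frac_val_def)
    show "(A * A', B * B') \<in> fractions C \<and> frac_val (A * A', B * B') = x * y"
      using homogeneous_mult[OF d(1,5)] homogeneous_mult[OF d(2,6)] d(3,7)
      unfolding fractions_C_iff frac_val_def d(4,8) by (auto simp: mval_simps)
  qed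
  finally show "rat_cls (x \<otimes>\<^bsub>kS\<^esub> y) = rat_cls x \<otimes>\<^bsub>function_field C\<^esub> rat_cls y" by simp
  have "rat_cls x \<oplus>\<^bsub>function_field C\<^esub> rat_cls y =
    (\<Union>(A, B)\<in>rat_cls x. \<Union>(A', B')\<in>rat_cls y. rat_fun C (A * B' + A' * B) (B * B'))"
    by (simp add: function_field_def)
  also have "\<dots> = rat_cls (x + y)"
  proof (rule rat_cls_combine)
    fix A B A' B' assume "(A, B) \<in> rat_cls x" "(A', B') \<in> rat_cls y"
    then obtain d d' where d: "homogeneous d A" "homogeneous d B" "mval aff_par B \<noteq> 0" "x = mval aff_par A / mval aff_par B"
      "homogeneous d' A'" "homogeneous d' B'" "mval aff_par B' \<noteq> 0" "y = mval aff_par A' / mval aff_par B'"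
      unfolding rat_cls_def mem_Collect_eq fractions_C_iff by (auto simp: frac_val_def)
    have "homogeneous (d + d') (A * B' + A' * B)"
      using homogeneous_mult[OF d(1,6)] homogeneous_mult[OF d(5,2)]
      by (intro homogeneous_add) (simp_all add: add.commute)
    then show "(A * B' + A' * B, B * B') \<in> fractions C \<and> frac_val (A * B' + A' * B, B * B') = x + y"
      using homogeneous_mult[OF d(2,6)] d(3,7)
      unfolding fractions_C_iff frac_val_def d(4,8) by (auto simp: mval_simps add_frac_eq)
  qed
  finally show "rat_cls (x \<oplus>\<^bsub>kS\<^esub> y) = rat_cls x \<oplus>\<^bsub>function_field C\<^esub> rat_cls y" by simp
next
  have "(1, 1) \<in> fractions C" unfolding fractions_C_iff using homogeneous_1 by (auto simp: mval_simps)
  from rat_fun_C[OF this] show "rat_cls \<one>\<^bsub>kS\<^esub> = \<one>\<^bsub>function_field C\<^esub>"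
    by (simp add: function_field_def frac_val_def mval_simps)
  show "bij_betw rat_cls (carrier kS) (carrier (function_field C))"
    unfolding carrier_function_field using inj_rat_cls by (simp add: bij_betw_def)
qed

lemma field_function_field: "field (function_field C)"
proof -
  have "(0, 1) \<in> fractions C" unfolding fractions_C_iff using homogeneous_1 homogeneous_0 by (auto simp: mval_simps)
  from rat_fun_C[OF this] have "\<zero>\<^bsub>function_field C\<^esub> = rat_cls \<zero>\<^bsub>kS\<^esub>"
    by (simp add: function_field_def frac_val_def mval_simps)
  then have "function_field C = (function_field C)\<lparr>zero := rat_cls \<zero>\<^bsub>kS\<^esub>\<rparr>" by simp
  then show ?thesis
    using field.ring_iso_imp_img_field[OF field_type_algebra rat_cls_ring_iso] by simp
qed

end

section \<open>Projections\<close>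

abbreviation v2 :: "'a::zero \<Rightarrow> 'a \<Rightarrow> 2 \<Rightarrow> 'a" where
  "v2 a b \<equiv> vec_nth (vector [a, b])"

lemma v2_eqI: "x 1 = a \<Longrightarrow> x 2 = b \<Longrightarrow> x = v2 a b"
proof (rule ext)
  fix i assume "x 1 = a" "x 2 = b"
  then show "x i = v2 a b i" using exhaust_2[of i] by auto
qed

lemma v2_poly: "(\<lambda>i. poly (v2 a b i) t) = v2 (poly a t) (poly b t)"
  by (rule v2_eqI) simp_all

lemma vanishes_on_line_iff:
  assumes "homogeneous d (G :: ('k::field, 2) mpoly)"
  shows "(\<forall>P\<in>proj_space. vanishes_at G P) \<longleftrightarrow> (\<forall>v. v \<noteq> 0 \<longrightarrow> mp_eval id (vec_nth v) G = 0)"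
  by (auto simp: proj_space_def vanishes_at_proj_pt[OF assms])

text \<open>
  A nonzero form \<open>G\<close> in two variables that vanishes along \<open>l\<close> would give a nonzero polynomial over \<open>k\<close> with
  the root \<open>l 1 / l 2\<close>, which would then be constant.
\<close>

lemma vanishes_on_line_iff_mval:
  fixes l :: "2 \<Rightarrow> 'k::alg_closed_field poly"
  assumes G: "homogeneous d G" and l2: "l 2 \<noteq> 0" and nc: "to_fract (l 1) / to_fract (l 2) \<notin> range cst"
  shows "(\<forall>P\<in>proj_space. vanishes_at G P) \<longleftrightarrow> mval l G = 0"
  unfolding vanishes_on_line_iff[OF G]
proof
  assume z: "\<forall>v. v \<noteq> 0 \<longrightarrow> mp_eval id (vec_nth v) G = 0"
  have "mp_poly l G = 0"
  proof (rule poly_eq_0_of_cofinite[OF poly_roots_finite[OF l2]])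
    fix s assume "s \<notin> {x. poly (l 2) x = 0}"
    then have "(vector [poly (l 1) s, poly (l 2) s] :: 'k ^ 2) \<noteq> 0" by (auto simp: vec_eq_iff forall_2)
    moreover have "(\<lambda>i. poly (l i) s) = v2 (poly (l 1) s) (poly (l 2) s)" by (rule v2_eqI) simp_all
    ultimately show "poly (mp_poly l G) s = 0" using z by (simp add: poly_mp_poly)
  qed
  then show "mval l G = 0" by (simp add: mval_eq)
next
  assume z: "mval l G = 0"
  define f where "f = to_fract (l 1) / to_fract (l 2)"
  define \<beta> where "\<beta> = mp_poly (v2 [:0, 1:] 1) G"
  have le: "(\<lambda>i. to_fract (l i)) = (\<lambda>i. to_fract (l 2) * v2 f 1 i)"
  proof
    fix i show "to_fract (l i) = to_fract (l 2) * v2 f 1 i"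
      using exhaust_2[of i] l2 by (auto simp: f_def)
  qed
  have "mval l G = to_fract (l 2) ^ d * mp_eval cst (v2 f 1) G"
    unfolding mval_def le by (rule cst_hom.mp_eval_homogeneous[OF G])
  then have "mp_eval cst (v2 f 1) G = 0" using z l2 by simp
  moreover have "ev \<beta> f = mp_eval cst (v2 f 1) G"
  proof -
    have "ev \<beta> f = mp_eval (\<lambda>c. ev [:c:] f) (\<lambda>i. ev (v2 [:0, 1:] 1 i) f) G"
      unfolding \<beta>_def by (rule pc_hom.hom_mp_eval) auto
    moreover have "(\<lambda>i. ev (v2 [:0, 1:] 1 i) f) = v2 f 1" by (rule v2_eqI) simp_all
    moreover have "(\<lambda>c. ev [:c:] f) = cst" by (simp add: fun_eq_iff)
    ultimately show ?thesis by simp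
  qed
  ultimately have "\<beta> = 0" using ev_eq_0_imp[of \<beta> f] nc unfolding f_def by auto
  then have x1: "mp_eval id (v2 x 1) G = 0" for x
    using poly_mp_poly[of "v2 [:0, 1:] 1" G x] by (simp add: \<beta>_def v2_poly)
  have xy: "mp_eval id (v2 x y) G = 0" if "y \<noteq> 0" for x y
  proof -
    have "v2 x y = (\<lambda>i. y * v2 (x / y) 1 i)" using that by (intro v2_eqI[symmetric]) simp_all
    then show ?thesis using id_hom.mp_eval_homogeneous[OF G, of y "v2 (x / y) 1"] x1 by simp
  qed
  have "mp_poly (v2 [:x:] [:0, 1:]) G = 0" for x
    by (rule poly_eq_0_of_cofinite[of "{0}"]) (auto simp: poly_mp_poly v2_poly xy)
  then have x0: "mp_eval id (v2 x 0) G = 0" for x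
    using poly_mp_poly[of "v2 [:x:] [:0, 1:]" G 0] by (simp add: v2_poly)
  show "\<forall>v. v \<noteq> 0 \<longrightarrow> mp_eval id (vec_nth v) G = 0"
  proof (intro allI impI)
    fix v :: "'k ^ 2"
    have "vec_nth v = v2 (vec_nth v 1) (vec_nth v 2)" by (rule v2_eqI) simp_all
    then show "mp_eval id (vec_nth v) G = 0" using xy x0 by (metis (full_types))
  qed
qed

lemma ratios_eq_kgen:
  fixes l :: "2 \<Rightarrow> 'k::field poly"
  assumes l2: "l 2 \<noteq> 0"
  shows "ratios l = kgen (to_fract (l 1) / to_fract (l 2))"
proof
  let ?K = "kgen (to_fract (l 1) / to_fract (l 2))"
  show "ratios l \<subseteq> ?K"
  proof (rule ratios_subset[OF subfld_kgen, of l 2, OF l2])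
    fix i show "to_fract (l i) / to_fract (l 2) \<in> ?K"
      using exhaust_2[of i] l2 kgen_self subfld_01[OF subfld_kgen] by auto
  qed
  show "?K \<subseteq> ratios l"
    by (rule kgen_least[OF subfld_ratios var_ratio[of l 2 1, OF l2]])
qed

text \<open>
  Quotients of two bases of the same two-dimensional space differ by a Moebius transformation.
\<close>

lemma kgen_moebius:
  fixes M1 M2 :: "'k::alg_closed_field poly"
  assumes M: "M2 \<noteq> 0" "to_fract M1 / to_fract M2 \<notin> range cst"
    and l: "l1 = Polynomial.smult \<alpha> M1 + Polynomial.smult \<beta> M2"
      "l2 = Polynomial.smult \<gamma> M1 + Polynomial.smult \<delta> M2"
    and det: "\<alpha> * \<delta> - \<beta> * \<gamma> \<noteq> 0"
  shows "l2 \<noteq> 0" "to_fract l1 / to_fract l2 \<notin> range cst"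
    "kgen (to_fract l1 / to_fract l2) = kgen (to_fract M1 / to_fract M2)"
proof -
  define x where "x = to_fract M1 / to_fract M2"
  have sm: "to_fract (Polynomial.smult c p) = cst c * to_fract p" for c and p :: "'k poly"
    by (simp add: cst_def flip: to_fract_mult)
  have M1: "to_fract M1 = x * to_fract M2" using M by (simp add: x_def)
  have lx: "to_fract l1 = (cst \<alpha> * x + cst \<beta>) * to_fract M2" "to_fract l2 = (cst \<gamma> * x + cst \<delta>) * to_fract M2"
    unfolding l to_fract_add sm M1 by (simp_all add: algebra_simps)
  have lin: "a = 0 \<and> b = 0" if "cst a * x + cst b = 0" for a b
  proof (cases "a = 0")
    case False
    have "cst a * x = - cst b" using that by (simp add: eq_neg_iff_add_eq_0)
    then have "x = - cst b / cst a" using False by (metis nonzero_mult_div_cancel_left cst_simps(8))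
    then have "x = cst (- b / a)" by simp
    then show ?thesis using M(2) unfolding x_def by blast
  qed (use that in simp)
  have d: "cst \<gamma> * x + cst \<delta> \<noteq> 0" using lin[of \<gamma> \<delta>] det by auto
  show l2: "l2 \<noteq> 0" using d M lx(2) by auto
  define f where "f = to_fract l1 / to_fract l2"
  have f: "f = (cst \<alpha> * x + cst \<beta>) / (cst \<gamma> * x + cst \<delta>)"
    unfolding f_def lx using M by simp
  have fx: "f * (cst \<gamma> * x + cst \<delta>) = cst \<alpha> * x + cst \<beta>" unfolding f using d by simp
  have fc: "f \<noteq> cst c" for c
  proof
    assume "f = cst c"
    then have "cst (c * \<gamma> - \<alpha>) * x + cst (c * \<delta> - \<beta>) = 0" using fx by (simp add: algebra_simps)
    then have "\<alpha> = c * \<gamma>" "\<beta> = c * \<delta>" using lin by fastforce+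
    then show False using det by simp
  qed
  then show "to_fract l1 / to_fract l2 \<notin> range cst" by (auto simp: f_def)
  note K = subfld_kgen[of x]
  have "f \<in> kgen x" unfolding f
    by (intro subfld_divide[OF K] subfld_add[OF K] subfld_mult[OF K] subfld_cst[OF K] kgen_self)
  moreover have "x \<in> kgen f"
  proof -
    note K = subfld_kgen[of f]
    have "cst \<alpha> - f * cst \<gamma> \<noteq> 0"
    proof
      assume 0: "cst \<alpha> - f * cst \<gamma> = 0"
      show False
      proof (cases "\<gamma> = 0")
        case True
        then show False using 0 det by simp
      next
        case False
        then have "f = cst (\<alpha> / \<gamma>)" using 0 by (simp add: eq_divide_eq)
        then show False using fc by blast
      qed
    qed
    moreover have "x * (cst \<alpha> - f * cst \<gamma>) = f * cst \<delta> - cst \<beta>" using fx by (simp add: algebra_simps)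
    ultimately have "x = (f * cst \<delta> - cst \<beta>) / (cst \<alpha> - f * cst \<gamma>)" by (simp add: eq_divide_eq)
    also have "\<dots> \<in> kgen f"
      by (intro subfld_divide[OF K] subfld_diff[OF K] subfld_mult[OF K] subfld_cst[OF K] kgen_self)
    finally show ?thesis .
  qed
  ultimately show "kgen (to_fract l1 / to_fract l2) = kgen (to_fract M1 / to_fract M2)"
    unfolding x_def[symmetric] f_def[symmetric] using kgen_mono by blast
qed

context curve_params
begin

text \<open>
  The functions on the line become the quotients of forms in \<open>l 1\<close> and \<open>l 2\<close>.
\<close>

lemma pullback_eq:
  fixes L :: "2 \<Rightarrow> ('k, 3) mpoly"
  assumes L: "\<And>i. homogeneous 1 (L i)"
  defines "l \<equiv> \<lambda>i. mp_poly aff_par (L i)"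
  assumes l2: "l 2 \<noteq> 0" and nc: "to_fract (l 1) / to_fract (l 2) \<notin> range cst"
  shows "pullback C L ` carrier (function_field (proj_space :: ('k, 2) proj_pt set)) =
    rat_cls ` kgen (to_fract (l 1) / to_fract (l 2))"
proof -
  let ?V = "proj_space :: ('k, 2) proj_pt set"
  note van = vanishes_on_line_iff_mval[where l = l, OF _ l2 nc]
  have sub: "mval aff_par (mp_subst L A) = mval l A" for A
    unfolding mval_eq l_def by (simp add: pc_hom.mp_eval_subst)
  have fr: "(A, B) \<in> fractions ?V \<longleftrightarrow> (\<exists>d. homogeneous d A \<and> homogeneous d B) \<and> mval l B \<noteq> 0" for A B
    unfolding fractions_def using van by blast
  have subfr: "(mp_subst L A, mp_subst L B) \<in> fractions C" if "(A, B) \<in> fractions ?V" for A B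
    using that homogeneous_subst[where L = L, OF _ L] unfolding fr fractions_C_iff sub by blast
  have rel: "mval l A / mval l B = mval l A' / mval l B'" if "((A, B), (A', B')) \<in> frac_rel ?V" for A B A' B'
  proof -
    have f: "(A, B) \<in> fractions ?V" "(A', B') \<in> fractions ?V"
      and v: "\<forall>P\<in>?V. vanishes_at (A * B' - A' * B) P" using that by (auto simp: frac_rel_def)
    obtain d d' where d: "homogeneous d A" "homogeneous d B" "mval l B \<noteq> 0"
      "homogeneous d' A'" "homogeneous d' B'" "mval l B' \<noteq> 0"
      using f unfolding fr by blast
    have "homogeneous (d + d') (A * B' - A' * B)"
      using homogeneous_mult[OF d(1,5)] homogeneous_mult[OF d(4,2)]
      by (intro homogeneous_diff) (simp_all add: add.commute)
    from van[OF this] v have "mval l (A * B' - A' * B) = 0" by blast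
    then show ?thesis using d(3,6) by (simp add: mval_simps frac_eq_eq)
  qed
  have refl': "((A, B), (A, B)) \<in> frac_rel ?V" if "(A, B) \<in> fractions ?V" for A B
    using that by (auto simp: frac_rel_def vanishes_at_def)
  have pb: "pullback C L (frac_rel ?V `` {(A0, B0)}) = rat_cls (mval l A0 / mval l B0)"
    if AB0: "(A0, B0) \<in> fractions ?V" for A0 B0
  proof -
    have "rat_fun C (mp_subst L A) (mp_subst L B) = rat_cls (mval l A0 / mval l B0)"
      if "(A, B) \<in> frac_rel ?V `` {(A0, B0)}" for A B
    proof -
      have r: "((A0, B0), (A, B)) \<in> frac_rel ?V" using that by simp
      then have "(A, B) \<in> fractions ?V" by (auto simp: frac_rel_def)
      then show ?thesis using rat_fun_C[OF subfr] rel[OF r] by (simp add: frac_val_def sub)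
    qed
    then have "pullback C L (frac_rel ?V `` {(A0, B0)}) =
        (\<Union>(A, B)\<in>frac_rel ?V `` {(A0, B0)}. rat_cls (mval l A0 / mval l B0))"
      unfolding pullback_def by (intro SUP_cong HOL.refl) (auto split: prod.splits)
    also have "\<dots> = rat_cls (mval l A0 / mval l B0)" using refl'[OF AB0] by auto
    finally show ?thesis .
  qed
  have "pullback C L ` carrier (function_field ?V) =
      (\<lambda>ab. pullback C L (frac_rel ?V `` {ab})) ` fractions ?V"
    unfolding function_field_def quotient_def by auto
  also have "\<dots> = (\<lambda>(A, B). rat_cls (mval l A / mval l B)) ` fractions ?V"
    by (intro image_cong HOL.refl) (auto simp: pb)
  also have "\<dots> = rat_cls ` ratios l"
    unfolding ratios_def image_def using fr by (auto; blast)
  also have "ratios l = kgen (to_fract (l 1) / to_fract (l 2))" by (rule ratios_eq_kgen[where l = l, OF l2])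
  finally show ?thesis .
qed

lemma galois_point_iff:
  assumes "P \<in> proj_space" "projection_subfield C P = rat_cls ` K"
  shows "galois_point C P \<longleftrightarrow> galois_extension kS K"
proof -
  have inv: "inv_into (carrier kS) rat_cls \<in> ring_iso (function_field C) kS"
    by (rule ring_iso_set_sym[OF ring_type_algebra rat_cls_ring_iso])
  have im: "inv_into (carrier kS) rat_cls ` rat_cls ` K = K"
    using inj_rat_cls by (simp add: image_image)
  show ?thesis
    unfolding galois_point_def assms(2)
    using galois_extension_iso[OF rat_cls_ring_iso field_type_algebra field_function_field]
      galois_extension_iso[OF inv field_function_field field_type_algebra, of "rat_cls ` K"]
      assms(1) unfolding im by blast
qed

lemma galois_point_group_iso:
  assumes "projection_subfield C P = rat_cls ` K"
  shows "Gal kS K \<cong> galois_point_group C P"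
  unfolding galois_point_group_def assms
  by (rule Gal_iso[OF rat_cls_ring_iso])
    (auto simp: ring_type_algebra field.is_ring[OF field_function_field])

lemma linear_form_eval:
  assumes "homogeneous 1 (A :: ('k, 3) mpoly)"
  defines "c \<equiv> \<lambda>i. Poly_Mapping.lookup A (Poly_Mapping.single i 1)"
  shows "mp_eval id x A = c 1 * x 1 + c 2 * x 2 + c 3 * x 3"
    "mp_poly y A = Polynomial.smult (c 1) (y 1) + Polynomial.smult (c 2) (y 2) + Polynomial.smult (c 3) (y 3)"
  unfolding id_hom.mp_eval_linear[OF assms(1)] pc_hom.mp_eval_linear[OF assms(1)] sum_3 by (simp_all add: c_def)

lemma projection_locus:
  assumes "is_projection_from L (proj_pt p)"
  shows "\<And>i. homogeneous 1 (L i)" "\<And>i. mp_eval id (vec_nth p) (L i) = 0"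
    "\<And>v. v \<noteq> 0 \<Longrightarrow> mp_eval id (vec_nth v) (L 1) = 0 \<Longrightarrow> mp_eval id (vec_nth v) (L 2) = 0 \<Longrightarrow>
       \<exists>r. v = r *s (p :: 'k ^ 3)"
proof -
  show h: "\<And>i. homogeneous 1 (L i)" using assms by (simp add: is_projection_from_def)
  have z: "(\<Inter>i. zero_locus (L i)) = {proj_pt p}" using assms by (simp add: is_projection_from_def)
  show "mp_eval id (vec_nth p) (L i) = 0" for i
  proof -
    have "proj_pt p \<in> zero_locus (L i)" using z by blast
    then show ?thesis by (simp add: zero_locus_def vanishes_at_proj_pt[OF h])
  qed
  fix v assume v: "v \<noteq> 0" "mp_eval id (vec_nth v) (L 1) = 0" "mp_eval id (vec_nth v) (L 2) = 0"
  have "mp_eval id (vec_nth v) (L i) = 0" for i using exhaust_2[of i] v by auto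
  then have "proj_pt v \<in> (\<Inter>i. zero_locus (L i))"
    using v(1) by (auto simp: zero_locus_def vanishes_at_proj_pt[OF h] proj_space_def)
  then have "proj_pt v = proj_pt p" using z by simp
  then show "\<exists>r. v = r *s p" using proj_pt_eqD[of p v] by auto
qed

lemma is_projection_fromI:
  assumes "p \<noteq> 0" "\<And>i. homogeneous 1 (L i)" "\<And>i. mp_eval id (vec_nth p) (L i) = 0"
    "\<And>v. v \<noteq> 0 \<Longrightarrow> mp_eval id (vec_nth v) (L 1) = 0 \<Longrightarrow> mp_eval id (vec_nth v) (L 2) = 0 \<Longrightarrow>
       \<exists>r. v = r *s (p :: 'k ^ 3)"
  shows "is_projection_from L (proj_pt p)"
  unfolding is_projection_from_def
proof (intro conjI allI equalityI subsetI)
  fix P assume "P \<in> (\<Inter>i. zero_locus (L i))"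
  then have P: "P \<in> zero_locus (L 1)" "P \<in> zero_locus (L 2)" by auto
  then obtain v where v: "v \<noteq> 0" "P = proj_pt v" by (auto simp: zero_locus_def proj_space_def)
  then obtain r where r: "v = r *s p"
    using P assms(4)[OF v(1)] by (auto simp: zero_locus_def vanishes_at_proj_pt[OF assms(2)])
  then have "r \<noteq> 0" using v(1) by auto
  then show "P \<in> {proj_pt p}" using r v(2) proj_pt_scale by auto
next
  fix P assume "P \<in> {proj_pt p}"
  then show "P \<in> (\<Inter>i. zero_locus (L i))"
    using assms(1,3) by (auto simp: zero_locus_def vanishes_at_proj_pt[OF assms(2)] proj_space_def)
qed (rule assms(2))

text \<open>
  The curve lies on no line: evaluate at \<open>0\<close>, at \<open>1\<close> and at some \<open>s\<close> with \<open>s\<^sup>q \<noteq> s\<close>.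
\<close>

lemma aff_par_independent:
  assumes "Polynomial.smult a (aff_par 1) + Polynomial.smult b (aff_par 2) + Polynomial.smult c (aff_par 3) = 0"
  shows "a = 0" "b = 0" "c = 0"
proof -
  have e: "a * s ^ n + b * (s - 1) ^ n + c * (s ^ q - s) = 0" for s
    using arg_cong[OF assms, of "\<lambda>p. poly p s"] by (simp add: poly_aff_par')
  show b: "b = 0" using e[of 0] pos by (simp add: zero_power)
  show a: "a = 0" using e[of 1] pos by (simp add: zero_power)
  have "c * (s ^ q - s) = 0" for s using e[of s] a b by simp
  moreover have "\<exists>s::'k. s ^ q \<noteq> s"
  proof (rule ccontr)
    assume "\<nexists>s::'k. s ^ q \<noteq> s"
    then have "Polynomial.monom 1 q - [:0, 1:] = (0 :: 'k poly)"
      by (intro poly_eq_0_of_cofinite[of "{}"]) (auto simp: poly_monom)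
    then have "Polynomial.monom (1::'k) q = Polynomial.monom 1 1" by (simp add: monom_altdef)
    then show False using q m2 by (auto dest: arg_cong[where f = degree] simp: degree_monom_eq)
  qed
  ultimately show "c = 0" by auto
qed

lemma to_fract_ratio_not_const:
  assumes "\<And>c. M1 \<noteq> Polynomial.smult c M2" "M2 \<noteq> 0"
  shows "to_fract M1 / to_fract M2 \<notin> range (cst :: 'k \<Rightarrow> _)"
proof
  assume "to_fract M1 / to_fract M2 \<in> range (cst :: 'k \<Rightarrow> _)"
  then obtain c where "to_fract M1 / to_fract M2 = to_fract [:c:]" by (auto simp: cst_def)
  then have "to_fract M1 = to_fract ([:c:] * M2)"
    unfolding to_fract_mult using assms(2) by (simp add: field_simps)
  then have "M1 = [:c:] * M2" by (simp only: to_fract_eq_iff)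
  then show False using assms(1)[of c] by simp
qed

text \<open>
  The forms \<open>a Y - b X\<close> and \<open>a Z - c X\<close> are a basis of the linear forms vanishing at \<open>(a:b:c)\<close>. Any choice
  of a projection consists of two independent combinations of them.
\<close>

lemma projection_subfield_finite_point:
  fixes a b c :: 'k
  assumes a: "a \<noteq> 0"
  defines "M1 \<equiv> aff_par 2 - Polynomial.smult (b / a) (aff_par 1)" and "M2 \<equiv> aff_par 3 - Polynomial.smult (c / a) (aff_par 1)"
  shows "projection_subfield C (proj_pt (vector [a, b, c])) = rat_cls ` kgen (to_fract M1 / to_fract M2)"
proof -
  define p :: "'k ^ 3" where "p = vector [a, b, c]"
  have p: "vec_nth p 1 = a" "vec_nth p 2 = b" "vec_nth p 3 = c" by (simp_all add: p_def)
  have p0: "p \<noteq> 0" using a p by auto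
  let ?x = "\<lambda>i c. Poly_Mapping.single (Poly_Mapping.single (i::3) (1::nat)) (c::'k)"
  \<comment> \<open>That some projection exists is needed for the choice made in \<open>projection_from\<close>.\<close>
  define L0 where "L0 = (\<lambda>i::2. if i = 1 then ?x 2 a - ?x 1 b else ?x 3 a - ?x 1 c)"
  have L0e: "mp_eval id v (L0 1) = a * v 2 - b * v 1" "mp_eval id v (L0 2) = a * v 3 - c * v 1" for v
    by (simp_all add: L0_def id_hom.mp_eval_diff id_hom.mp_eval_var del: One_nat_def)
  have "is_projection_from L0 (proj_pt p)"
  proof (rule is_projection_fromI[OF p0])
    show "homogeneous 1 (L0 i)" for i
      unfolding L0_def by (auto intro!: homogeneous_diff homogeneous_var simp del: One_nat_def)
    show "mp_eval id (vec_nth p) (L0 i) = 0" for i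
      using exhaust_2[of i] p by (auto simp: L0e)
    show "\<exists>r. v = r *s p" if "mp_eval id (vec_nth v) (L0 1) = 0" "mp_eval id (vec_nth v) (L0 2) = 0" for v
    proof
      show "v = (vec_nth v 1 / a) *s p"
        using that a p by (intro vec3_eqI) (auto simp: L0e field_simps)
    qed
  qed
  then have L: "is_projection_from (projection_from (proj_pt p)) (proj_pt p)"
    unfolding projection_from_def by (rule someI[where P = "\<lambda>L. is_projection_from L (proj_pt p)"])
  define L where "L = projection_from (proj_pt p)"
  note L = projection_locus[OF L, folded L_def]
  define d where "d = (\<lambda>i j. Poly_Mapping.lookup (L i) (Poly_Mapping.single j (1::nat)))"
  have ev: "mp_eval id x (L i) = d i 1 * x 1 + d i 2 * x 2 + d i 3 * x 3"
      "mp_poly y (L i) = Polynomial.smult (d i 1) (y 1) + Polynomial.smult (d i 2) (y 2) + Polynomial.smult (d i 3) (y 3)" for i x y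
    unfolding linear_form_eval[OF L(1)] d_def by (rule HOL.refl)+
  define l where "l = (\<lambda>i. mp_poly aff_par (L i))"
  have lM: "l i = Polynomial.smult (d i 2) M1 + Polynomial.smult (d i 3) M2" for i
  proof -
    have "d i 1 * a + d i 2 * b + d i 3 * c = 0" using L(2)[of i] unfolding ev(1) p .
    then have "d i 1 = - (d i 2 * (b / a)) - d i 3 * (c / a)"
      using a by (simp add: field_simps eq_neg_iff_add_eq_0)
    then show ?thesis
      unfolding l_def ev(2) M1_def M2_def
      by (simp add: smult_diff_right smult_diff_left)
  qed
  have det: "d 1 2 * d 2 3 - d 1 3 * d 2 2 \<noteq> 0"
  proof
    assume D: "d 1 2 * d 2 3 - d 1 3 * d 2 2 = 0"
    have "\<exists>y z. (y \<noteq> 0 \<or> z \<noteq> 0) \<and> d 1 2 * y + d 1 3 * z = 0 \<and> d 2 2 * y + d 2 3 * z = 0"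
    proof (cases "d 1 2 = 0 \<and> d 1 3 = 0")
      case True
      then show ?thesis
      proof (cases "d 2 2 = 0 \<and> d 2 3 = 0")
        case False
        then show ?thesis using True by (intro exI[of _ "d 2 3"] exI[of _ "- d 2 2"]) (auto simp: mult.commute)
      qed (auto intro: exI[of _ 1])
    next
      case False
      then show ?thesis using D by (intro exI[of _ "d 1 3"] exI[of _ "- d 1 2"]) (auto simp: algebra_simps)
    qed
    then obtain y z where yz: "y \<noteq> 0 \<or> z \<noteq> 0" "d 1 2 * y + d 1 3 * z = 0" "d 2 2 * y + d 2 3 * z = 0" by blast
    have "(vector [0, y, z] :: 'k ^ 3) \<noteq> 0" using yz(1) by (auto simp: vec_eq_iff forall_3)
    from L(3)[OF this] yz(2,3) obtain r where r: "vector [0, y, z] = r *s p" unfolding ev(1) by auto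
    from arg_cong[OF r, of "\<lambda>v. vec_nth v 1"] have "r = 0" using a p by simp
    then have "vector [0, y, z] = (0 :: 'k ^ 3)" using r by simp
    then show False using \<open>(vector [0, y, z] :: 'k ^ 3) \<noteq> 0\<close> by blast
  qed
  have M2: "M2 \<noteq> 0"
  proof
    assume "M2 = 0"
    then have "Polynomial.smult (- (c / a)) (aff_par 1) + Polynomial.smult 0 (aff_par 2) + Polynomial.smult 1 (aff_par 3) = 0"
      by (simp add: M2_def)
    from aff_par_independent(3)[OF this] show False by simp
  qed
  have nc: "to_fract M1 / to_fract M2 \<notin> range cst"
  proof (rule to_fract_ratio_not_const[OF _ M2])
    fix r
    show "M1 \<noteq> Polynomial.smult r M2"
    proof
      assume "M1 = Polynomial.smult r M2"
      then have "Polynomial.smult (r * (c / a) - b / a) (aff_par 1) + Polynomial.smult 1 (aff_par 2) + Polynomial.smult (- r) (aff_par 3) = 0"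
        by (simp add: M1_def M2_def smult_diff_right smult_diff_left algebra_simps)
      from aff_par_independent(2)[OF this] show False by simp
    qed
  qed
  note mb = kgen_moebius[OF M2 nc lM[of 1] lM[of 2] det]
  show ?thesis
    unfolding projection_subfield_def p_def[symmetric] L_def[symmetric]
    using pullback_eq[where L = L, OF L(1) mb(1,2)[unfolded l_def]] mb(3)[unfolded l_def] by simp
qed

text \<open>
  Here \<open>X\<close> and \<open>Z\<close> are a basis.
\<close>

lemma projection_subfield_P1:
  "projection_subfield C (proj_pt (vector [0, 1, 0])) = rat_cls ` kgen (to_fract (aff_par 1) / to_fract (aff_par 3))"
proof -
  define p :: "'k ^ 3" where "p = vector [0, 1, 0]"
  have p: "vec_nth p 1 = 0" "vec_nth p 2 = 1" "vec_nth p 3 = 0" by (simp_all add: p_def)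
  have p0: "p \<noteq> 0" using p by auto
  let ?x = "\<lambda>i c. Poly_Mapping.single (Poly_Mapping.single (i::3) (1::nat)) (c::'k)"
  define L0 where "L0 = (\<lambda>i::2. if i = 1 then ?x 1 1 else ?x 3 1)"
  have L0e: "mp_eval id v (L0 1) = v 1" "mp_eval id v (L0 2) = v 3" for v
    by (simp_all add: L0_def id_hom.mp_eval_var del: One_nat_def)
  have "is_projection_from L0 (proj_pt p)"
  proof (rule is_projection_fromI[OF p0])
    show "homogeneous 1 (L0 i)" for i
      unfolding L0_def by (auto intro!: homogeneous_var simp del: One_nat_def)
    show "mp_eval id (vec_nth p) (L0 i) = 0" for i
      using exhaust_2[of i] p by (auto simp: L0e)
    show "\<exists>r. v = r *s p" if "mp_eval id (vec_nth v) (L0 1) = 0" "mp_eval id (vec_nth v) (L0 2) = 0" for v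
    proof
      show "v = vec_nth v 2 *s p"
        using that p by (intro vec3_eqI) (auto simp: L0e)
    qed
  qed
  then have L: "is_projection_from (projection_from (proj_pt p)) (proj_pt p)"
    unfolding projection_from_def by (rule someI[where P = "\<lambda>L. is_projection_from L (proj_pt p)"])
  define L where "L = projection_from (proj_pt p)"
  note L = projection_locus[OF L, folded L_def]
  define d where "d = (\<lambda>i j. Poly_Mapping.lookup (L i) (Poly_Mapping.single j (1::nat)))"
  have ev: "mp_eval id x (L i) = d i 1 * x 1 + d i 2 * x 2 + d i 3 * x 3"
      "mp_poly y (L i) = Polynomial.smult (d i 1) (y 1) + Polynomial.smult (d i 2) (y 2) + Polynomial.smult (d i 3) (y 3)" for i x y
    unfolding linear_form_eval[OF L(1)] d_def by (rule HOL.refl)+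
  define l where "l = (\<lambda>i. mp_poly aff_par (L i))"
  have lM: "l i = Polynomial.smult (d i 1) (aff_par 1) + Polynomial.smult (d i 3) (aff_par 3)" for i
  proof -
    have "d i 2 = 0" using L(2)[of i] unfolding ev(1) p by simp
    then show ?thesis unfolding l_def ev(2) by simp
  qed
  have det: "d 1 1 * d 2 3 - d 1 3 * d 2 1 \<noteq> 0"
  proof
    assume D: "d 1 1 * d 2 3 - d 1 3 * d 2 1 = 0"
    have "\<exists>y z. (y \<noteq> 0 \<or> z \<noteq> 0) \<and> d 1 1 * y + d 1 3 * z = 0 \<and> d 2 1 * y + d 2 3 * z = 0"
    proof (cases "d 1 1 = 0 \<and> d 1 3 = 0")
      case True
      then show ?thesis
      proof (cases "d 2 1 = 0 \<and> d 2 3 = 0")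
        case False
        then show ?thesis using True by (intro exI[of _ "d 2 3"] exI[of _ "- d 2 1"]) (auto simp: mult.commute)
      qed (auto intro: exI[of _ 1])
    next
      case False
      then show ?thesis using D by (intro exI[of _ "d 1 3"] exI[of _ "- d 1 1"]) (auto simp: algebra_simps)
    qed
    then obtain y z where yz: "y \<noteq> 0 \<or> z \<noteq> 0" "d 1 1 * y + d 1 3 * z = 0" "d 2 1 * y + d 2 3 * z = 0" by blast
    have "(vector [y, 0, z] :: 'k ^ 3) \<noteq> 0" using yz(1) by (auto simp: vec_eq_iff forall_3)
    from L(3)[OF this] yz(2,3) obtain r where r: "vector [y, 0, z] = r *s p" unfolding ev(1) by auto
    from arg_cong[OF r, of "\<lambda>v. vec_nth v 2"] have "r = 0" using p by simp
    then have "vector [y, 0, z] = (0 :: 'k ^ 3)" using r by simp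
    then show False using \<open>(vector [y, 0, z] :: 'k ^ 3) \<noteq> 0\<close> by blast
  qed
  have M2: "aff_par 3 \<noteq> 0" using aff_par_independent(3)[of 0 0 1] by auto
  have nc: "to_fract (aff_par 1) / to_fract (aff_par 3) \<notin> range cst"
  proof (rule to_fract_ratio_not_const[OF _ M2])
    fix r
    show "aff_par 1 \<noteq> Polynomial.smult r (aff_par 3)"
      using aff_par_independent(1)[of 1 0 "- r"] by auto
  qed
  note mb = kgen_moebius[OF M2 nc lM[of 1] lM[of 2] det]
  show ?thesis
    unfolding projection_subfield_def p_def[symmetric] L_def[symmetric]
    using pullback_eq[where L = L, OF L(1) mb(1,2)[unfolded l_def]] mb(3)[unfolded l_def] by simp
qed

end

section \<open>The two Galois points\<close>

lemma k_endo_image_kgen: "k_endo \<sigma> \<Longrightarrow> \<sigma> ` kgen f = kgen (\<sigma> f)"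
proof
  assume \<sigma>: "k_endo \<sigma>"
  show "\<sigma> ` kgen f \<subseteq> kgen (\<sigma> f)"
  proof
    fix y assume "y \<in> \<sigma> ` kgen f"
    then obtain N D where D: "ev D f \<noteq> 0" and y: "y = \<sigma> (ev N f / ev D f)"
      unfolding kgen_def by blast
    have "ev D (\<sigma> f) \<noteq> 0" using D k_endo_eq_0[OF \<sigma>, of "ev D f"] by (simp add: k_endo_ev[OF \<sigma>])
    then show "y \<in> kgen (\<sigma> f)" unfolding y k_endo_divide[OF \<sigma>] k_endo_ev[OF \<sigma>] by (rule kgen_evI)
  qed
  show "kgen (\<sigma> f) \<subseteq> \<sigma> ` kgen f"
  proof
    fix y assume "y \<in> kgen (\<sigma> f)"
    then obtain N D where D: "ev D (\<sigma> f) \<noteq> 0" and y: "y = ev N (\<sigma> f) / ev D (\<sigma> f)"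
      unfolding kgen_def by blast
    have "y = \<sigma> (ev N f / ev D f)" unfolding y k_endo_divide[OF \<sigma>] k_endo_ev[OF \<sigma>] ..
    moreover have "ev D f \<noteq> 0" using D k_endo_eq_0[OF \<sigma>, of "ev D f"] by (simp add: k_endo_ev[OF \<sigma>])
    ultimately show "y \<in> \<sigma> ` kgen f" by (auto intro: kgen_evI)
  qed
qed

lemma kgen_inverse: "kgen (inverse f) = kgen f"
proof
  show "kgen (inverse f) \<subseteq> kgen f"
    by (rule kgen_mono[OF subfld_inverse[OF subfld_kgen kgen_self]])
  have "inverse (inverse f) \<in> kgen (inverse f)" by (rule subfld_inverse[OF subfld_kgen kgen_self])
  then show "kgen f \<subseteq> kgen (inverse f)" by (intro kgen_mono) simp
qed

lemma gen_shift_not_const: "gen + cst c \<notin> range cst"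
proof
  assume "gen + cst c \<in> range cst"
  then obtain d where "gen + cst c = cst d" by auto
  then have "gen = cst d - cst c" by (simp only: eq_diff_eq)
  then have "gen = cst (d - c)" by simp
  then show False by (simp only: gen_not_cst)
qed

text \<open>
  The translation that relates the two Galois points.
\<close>

lemma translation_ring_iso:
  fixes c :: "'k::alg_closed_field"
  shows "subst_gen (gen + cst c) \<in> ring_iso kS kS"
proof -
  have e: "k_endo (subst_gen (gen + cst c))" for c :: 'k
    by (rule k_endo_subst_gen[OF gen_shift_not_const])
  have g: "subst_gen (gen + cst c) gen = gen + cst c" for c :: 'k
    by (rule subst_gen_gen[OF gen_shift_not_const])
  have inv: "subst_gen (gen + cst c) \<circ> subst_gen (gen + cst (- c)) = id" for c :: 'k
  proof (rule k_endo_eqI[OF k_endo_comp[OF e e] k_endo_id])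
    show "(subst_gen (gen + cst c) \<circ> subst_gen (gen + cst (- c))) gen = id gen"
      unfolding o_apply g k_endo_add[OF e] k_endo_cst[OF e] by simp
  qed
  have "bij (subst_gen (gen + cst c))"
    using inv[of c] inv[of "- c"] by (intro o_bij[of "subst_gen (gen + cst (- c))"]) simp_all
  then show ?thesis
    unfolding ring_iso_def
    by (auto intro!: ring_hom_memI simp: k_endo_add[OF e] k_endo_mult[OF e] k_endo_01[OF e])
qed

context curve_params
begin

text \<open>
  The solutions of \<open>x\<^sup>q = x\<close> form a finite field with \<open>q = 2m + 1\<close> elements, whose multiplicative group is
  cyclic.
\<close>

lemma primitive_root_2m:
  "\<exists>a::'k. a ^ (2 * m) = 1 \<and> (\<forall>z. z ^ (2 * m) = 1 \<longrightarrow> (\<exists>i. z = a ^ i)) \<and> inj_on (\<lambda>i. a ^ i) {..<2 * m}"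
proof -
  define S where "S = {x::'k. x ^ q = x}"
  let ?R = "ring_of_type_algebra :: 'k ring"
  interpret R: field ?R by (rule field_type_algebra)
  have nz: "x \<in> S \<longleftrightarrow> x ^ (2 * m) = 1" if "x \<noteq> 0" for x
    using that by (simp add: S_def power_q(2)[of x])
  have S0: "0 \<in> S" using pos by (simp add: S_def zero_power)
  have odd: "(- x) ^ q = - (x ^ q)" for x :: 'k using q by simp
  have closed: "1 \<in> S" "\<And>x. x \<in> S \<Longrightarrow> - x \<in> S" "\<And>x y. x \<in> S \<Longrightarrow> y \<in> S \<Longrightarrow> x * y \<in> S"
      "\<And>x y. x \<in> S \<Longrightarrow> y \<in> S \<Longrightarrow> x + y \<in> S" "\<And>x. x \<in> S \<Longrightarrow> inverse x \<in> S"
    unfolding S_def mem_Collect_eq power_mult_distrib frob odd power_inverse by simp_all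
  have sub: "subfield S ?R"
  proof (rule R.subfieldI')
    show "subring S ?R"
      by (rule R.subringI) (simp_all add: a_inv_type_algebra closed)
    show "inv\<^bsub>?R\<^esub> k \<in> S" if "k \<in> S - {\<zero>\<^bsub>?R\<^esub>}" for k
      using that by (simp add: m_inv_type_algebra closed)
  qed
  let ?S = "?R\<lparr>carrier := S\<rparr>"
  interpret F: field ?S by (rule R.subfield_iff(2)[OF sub])
  have pw: "x [^]\<^bsub>?S\<^esub> (i::nat) = x ^ i" for x i by (induction i) (simp_all add: mult.commute)
  have root_nz: "x \<noteq> 0" if "x ^ (2 * m) = 1" for x :: 'k using that m2 by (auto simp: zero_power)
  have "S = insert 0 {x. x ^ (2 * m) = 1}"
  proof (intro equalityI subsetI)
    fix x assume "x \<in> S"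
    then show "x \<in> insert 0 {x. x ^ (2 * m) = 1}" using nz by (cases "x = 0") auto
  next
    fix x :: 'k assume "x \<in> insert 0 {x. x ^ (2 * m) = 1}"
    then show "x \<in> S" using nz root_nz S0 by blast
  qed
  then have "finite S" using m2 finite_nth_roots_field[of "2 * m" "1::'k"] by simp
  then have "finite (carrier ?S)" by simp
  from F.finite_field_mult_group_has_gen[OF this]
  obtain a where a: "a \<in> S - {0}" "S - {0} = {a ^ i | i. True}" by (auto simp: pw nat_pow_mult_of)
  have units: "S - {0} = {x. x ^ (2 * m) = 1}"
    using nz root_nz by blast
  have a1: "a ^ (2 * m) = 1" using a(1) units by blast
  have gen: "\<exists>i. z = a ^ i" if "z ^ (2 * m) = 1" for z
  proof -
    have "z \<in> S - {0}" using that units by blast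
    then show ?thesis unfolding a(2) by blast
  qed
  have red: "a ^ i = a ^ (i mod (2 * m))" for i
  proof -
    have "a ^ i = (a ^ (2 * m)) ^ (i div (2 * m)) * a ^ (i mod (2 * m))"
      unfolding power_mult[symmetric] power_add[symmetric] mult_div_mod_eq ..
    then show ?thesis using a1 by simp
  qed
  have im: "(\<lambda>i. a ^ i) ` {..<2 * m} = {x. x ^ (2 * m) = 1}"
  proof (intro equalityI subsetI)
    fix z :: 'k assume "z \<in> {x. x ^ (2 * m) = 1}"
    then obtain i where "z = a ^ i" using gen by blast
    then have "z = a ^ (i mod (2 * m))" using red[of i] by (rule HOL.trans)
    moreover have "i mod (2 * m) < 2 * m" using m2 by simp
    ultimately show "z \<in> (\<lambda>i. a ^ i) ` {..<2 * m}" by blast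
  next
    fix z :: 'k assume "z \<in> (\<lambda>i. a ^ i) ` {..<2 * m}"
    then obtain i where z: "z = a ^ i" by blast
    have "z ^ (2 * m) = (a ^ (2 * m)) ^ i" unfolding z power_mult[symmetric] by (simp only: mult.commute)
    then show "z \<in> {x. x ^ (2 * m) = 1}" using a1 by simp
  qed
  have c2: "of_nat (2 * m) \<noteq> (0::'k)"
    using nonzero_of_nat by simp
  have "card {x::'k. x ^ (2 * m) = 1} = 2 * m" by (rule card_nth_roots_alg_closed[OF c2]) simp
  then have "inj_on (\<lambda>i. a ^ i) {..<2 * m}" by (intro eq_card_imp_inj_on) (simp_all add: im)
  then show ?thesis using a1 gen by blast
qed

lemma dihedral_extension:
  "galois_extension kS (kgen (dih_fun m (gen :: 'k poly fract)))"
  "Gal kS (kgen (dih_fun m (gen :: 'k poly fract))) \<cong> dihedral_group (2 * m)"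
proof -
  obtain a :: 'k where a: "a ^ (2 * m) = 1" and gen: "\<And>z. z ^ (2 * m) = 1 \<Longrightarrow> \<exists>i. z = a ^ i"
    and inj: "inj_on (\<lambda>i. a ^ i) {..<2 * m}"
    using primitive_root_2m by blast
  have am: "a ^ m = - 1"
  proof -
    have "a ^ m * a ^ m = 1" using a by (simp only: mult_2 power_add)
    moreover have "a ^ m \<noteq> a ^ 0" using inj_onD[OF inj, of m 0] m2 by auto
    ultimately show ?thesis using square_eq_1_iff[of "a ^ m"] by simp
  qed
  have \<zeta>: "(a ^ 2) ^ m = 1" using a by (simp only: power_mult)
  have prim: "\<exists>i. z = (a ^ 2) ^ i" if z: "z ^ m = 1" for z
  proof -
    have "z ^ (2 * m) = 1" using z by (simp add: mult_2 power_add)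
    then obtain i where i: "z = a ^ i" using gen by blast
    have "z ^ m = (a ^ m) ^ i" unfolding i power_mult[symmetric] by (simp only: mult.commute)
    then have "(- 1 :: 'k) ^ i = 1" using z am by simp
    then have "even i" using nonzero_of_nat(3) by (cases "even i") (auto simp: eq_neg_iff_add_eq_0 neg_eq_iff_add_eq_0)
    then obtain j where "i = 2 * j" by (elim evenE)
    then show ?thesis using i by (auto simp: power_mult)
  qed
  have ord: "i = j" if "i < m" "j < m" "(a ^ 2) ^ i = (a ^ 2) ^ j" for i j
  proof -
    have "a ^ (2 * i) = a ^ (2 * j)" using that(3) by (simp only: power_mult)
    then have "2 * i = 2 * j" using inj_onD[OF inj, of "2 * i" "2 * j"] that(1,2) by simp
    then show ?thesis by simp
  qed
  show "galois_extension kS (kgen (dih_fun m (gen :: 'k poly fract)))"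
    by (rule dih_galois_extension[OF nonzero_of_nat(2,3) \<zeta> am prim ord])
  show "Gal kS (kgen (dih_fun m (gen :: 'k poly fract))) \<cong> dihedral_group (2 * m)"
    by (rule dih_Gal_iso[OF nonzero_of_nat(2,3) \<zeta> am prim ord])
qed

text \<open>
  For \<open>c = 0\<close> this applies to \<open>P\<^sub>1\<close>, for \<open>c = -1\<close> to \<open>P\<^sub>2\<close>.
\<close>

lemma dihedral_galois_point:
  assumes P: "P \<in> proj_space" "projection_subfield C P = rat_cls ` kgen (dih_fun m (gen + cst c))"
  shows "galois_point C P" "galois_point_group C P \<cong> dihedral_group (2 * m)"
proof -
  let ?u = "dih_fun m (gen :: 'k poly fract)" and ?t = "subst_gen (gen + cst c)"
  have e: "k_endo ?t" by (rule k_endo_subst_gen[OF gen_shift_not_const])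
  have im: "?t ` kgen ?u = kgen (dih_fun m (gen + cst c))"
    unfolding k_endo_image_kgen[OF e] dih_fun_def
    by (simp add: k_endo_diff[OF e] k_endo_inverse[OF e] k_endo_power[OF e] subst_gen_gen[OF gen_shift_not_const])
  note T = translation_ring_iso[of c]
  show "galois_point C P"
    unfolding galois_point_iff[OF P] im[symmetric]
    by (rule galois_extension_iso[OF T field_type_algebra field_type_algebra dihedral_extension(1)])
  have 1: "Gal kS (kgen ?u) \<cong> Gal kS (?t ` kgen ?u)"
    by (rule Gal_iso[OF T ring_type_algebra ring_type_algebra]) simp
  have 2: "Gal kS (?t ` kgen ?u) \<cong> galois_point_group C P"
    by (rule galois_point_group_iso[OF P(2)[folded im]])
  have g: "group (Gal kS K)" for K :: "'k poly fract set"
    by (rule group_Gal[OF ring_type_algebra]) simp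
  have "galois_point_group C P \<cong> Gal kS (kgen ?u)"
    by (rule group.iso_sym[OF g iso_trans[OF 1 2]])
  then show "galois_point_group C P \<cong> dihedral_group (2 * m)"
    using dihedral_extension(2) by (rule iso_trans)
qed

lemma dih_fun_quotient:
  assumes "x \<noteq> 0"
  shows "dih_fun m x = (x ^ q - x) / x ^ n"
proof -
  have "x ^ q - x = x ^ n * x ^ m - x" by (simp only: power_q(1))
  moreover have "x / x ^ n = inverse (x ^ m)" using assms by (simp add: n divide_inverse)
  ultimately show ?thesis using assms by (simp add: dih_fun_def diff_divide_distrib)
qed

text \<open>
  The last equation, \<open>s\<^sup>q - s = (s - 1)\<^sup>q - (s - 1)\<close>, is the reason for the symmetry between the two
  points.
\<close>

lemma aff_par_gen:
  "to_fract (aff_par 1) = gen ^ n" "to_fract (aff_par 2) = (gen + cst (- 1)) ^ n"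
  "to_fract (aff_par 3) = gen ^ q - gen" "to_fract (aff_par 3) = (gen + cst (- 1)) ^ q - (gen + cst (- 1))"
proof -
  have to_fract_power: "to_fract (p ^ i) = to_fract p ^ i" for p :: "'k poly" and i by (induction i) auto
  show 1: "to_fract (aff_par 1) = gen ^ n" "to_fract (aff_par 3) = gen ^ q - gen"
    unfolding aff_par_simps gen_def to_fract_diff to_fract_power by (rule HOL.refl)+
  have "[:- 1, 1:] = [:0, 1:] + [:- 1 :: 'k:]" by simp
  then have t: "to_fract [:- 1, 1 :: 'k:] = gen + cst (- 1)" by (simp only: to_fract_add gen_def cst_def)
  show "to_fract (aff_par 2) = (gen + cst (- 1)) ^ n"
    unfolding aff_par_simps to_fract_power t ..
  have "aff_par 3 = [:- 1, 1:] ^ q - [:- 1, 1:]"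
  proof (rule poly_eqI_cofinite[of "{}"])
    fix x :: 'k
    have "(x - 1) ^ q = x ^ q - 1" using frob[of "x - 1" 1] by (simp add: eq_diff_eq)
    then show "poly (aff_par 3) x = poly ([:- 1, 1:] ^ q - [:- 1, 1:]) x" by (simp add: aff_par_simps)
  qed simp
  then show "to_fract (aff_par 3) = (gen + cst (- 1)) ^ q - (gen + cst (- 1))"
    by (simp only: to_fract_diff to_fract_power t)
qed

lemma galois_P1:
  "galois_point C (proj_pt (vector [0, 1, 0]))"
  "galois_point_group C (proj_pt (vector [0, 1, 0])) \<cong> dihedral_group (2 * m)"
proof -
  have "(vector [0, 1, 0] :: 'k ^ 3) \<noteq> 0" by (auto simp: vec_eq_iff forall_3)
  then have P: "proj_pt (vector [0, 1, 0]) \<in> (proj_space :: ('k, 3) proj_pt set)" by (auto simp: proj_space_def)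
  have "to_fract (aff_par 1) / to_fract (aff_par 3) = inverse (dih_fun m (gen + cst 0))"
    unfolding aff_par_gen dih_fun_quotient[OF gen_nz] by (simp add: dih_fun_quotient)
  then have "projection_subfield C (proj_pt (vector [0, 1, 0])) = rat_cls ` kgen (dih_fun m (gen + cst 0))"
    unfolding projection_subfield_P1 by (simp only: kgen_inverse)
  note dihedral_galois_point[OF P this]
  then show "galois_point C (proj_pt (vector [0, 1, 0]))"
    "galois_point_group C (proj_pt (vector [0, 1, 0])) \<cong> dihedral_group (2 * m)" .
qed

lemma galois_P2:
  "galois_point C (proj_pt (vector [1, 0, 0]))"
  "galois_point_group C (proj_pt (vector [1, 0, 0])) \<cong> dihedral_group (2 * m)"
proof -
  have "(vector [1, 0, 0] :: 'k ^ 3) \<noteq> 0" by (auto simp: vec_eq_iff forall_3)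
  then have P: "proj_pt (vector [1, 0, 0]) \<in> (proj_space :: ('k, 3) proj_pt set)" by (auto simp: proj_space_def)
  have nz: "gen + cst (- 1 :: 'k) \<noteq> 0" using gen_shift_not_const[of "- 1 :: 'k"] by (metis cst_simps(1) rangeI)
  have "to_fract (aff_par 2) / to_fract (aff_par 3) = inverse (dih_fun m (gen + cst (- 1)))"
    unfolding aff_par_gen(2,4) dih_fun_quotient[OF nz] inverse_divide ..
  then have "projection_subfield C (proj_pt (vector [1, 0, 0])) = rat_cls ` kgen (dih_fun m (gen + cst (- 1)))"
    using projection_subfield_finite_point[of 1 0 0] by (simp add: kgen_inverse)
  note dihedral_galois_point[OF P this]
  then show "galois_point C (proj_pt (vector [1, 0, 0]))"
    "galois_point_group C (proj_pt (vector [1, 0, 0])) \<cong> dihedral_group (2 * m)" .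
qed

end

section \<open>Tangents\<close>

lemma homogeneous_pderiv:
  assumes "homogeneous d F"
  shows "homogeneous (d - 1) (mp_pderiv i F)"
  unfolding mp_pderiv_def
proof (rule homogeneous_sum)
  fix m assume m: "m \<in> Poly_Mapping.keys F"
  let ?c = "of_nat (Poly_Mapping.lookup m i) * Poly_Mapping.lookup F m"
  show "homogeneous (d - 1) (Poly_Mapping.single (m - Poly_Mapping.single i 1) ?c)"
  proof (cases "Poly_Mapping.lookup m i = 0")
    case False
    show ?thesis
    proof (rule homogeneous_single)
      have d: "d = (\<Sum>j\<in>UNIV. Poly_Mapping.lookup m j)"
        using assms m by (simp add: homogeneous_def)
      have "(\<Sum>j\<in>UNIV. Poly_Mapping.lookup (m - Poly_Mapping.single i 1) j) + 1 =
          (\<Sum>j\<in>UNIV. Poly_Mapping.lookup (m - Poly_Mapping.single i 1) j + (if j = i then 1 else 0))"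
        by (simp add: sum.distrib)
      also have "\<dots> = (\<Sum>j\<in>UNIV. Poly_Mapping.lookup m j)"
        using False by (intro sum.cong) (auto simp: lookup_minus lookup_single when_def)
      finally show "(\<Sum>j\<in>UNIV. Poly_Mapping.lookup (m - Poly_Mapping.single i 1) j) = d - 1"
        using d by simp
    qed
  qed simp
qed

lemma double_root_imp_dvd:
  fixes p :: "'a::idom poly"
  assumes "poly p a = 0" "poly (pderiv p) a = 0"
  shows "[:- a, 1:] ^ 2 dvd p"
proof -
  obtain h where h: "p = [:- a, 1:] * h" using assms(1) by (auto simp: poly_eq_0_iff_dvd elim: dvdE)
  have "poly h a = 0" using assms(2) unfolding h pderiv_mult by (simp add: pderiv_pCons)
  then have "[:- a, 1:] dvd h" by (simp add: poly_eq_0_iff_dvd)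
  then show ?thesis unfolding h power2_eq_square by (rule mult_dvd_mono[OF dvd_refl])
qed

lemma degree_ge_of_double_roots:
  fixes p :: "'a::idom poly"
  assumes p: "p \<noteq> 0" and Z: "\<And>a. a \<in> Z \<Longrightarrow> poly p a = 0" "\<And>a. a \<in> Z \<Longrightarrow> poly (pderiv p) a = 0"
  shows "2 * card Z \<le> degree p"
proof -
  have ord: "2 \<le> order a p" if "a \<in> Z" for a
    using double_root_imp_dvd[OF Z(1,2)[OF that]] p by (simp only: order_divides) simp
  have "2 * card Z = (\<Sum>a\<in>Z. 2)" by simp
  also have "\<dots> \<le> (\<Sum>a\<in>Z. order a p)" by (intro sum_mono ord)
  also have "\<dots> \<le> (\<Sum>a | poly p a = 0. order a p)"
    using Z(1) by (intro sum_mono2 poly_roots_finite[OF p]) auto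
  also have "\<dots> \<le> degree p" by (rule sum_order_le_degree[OF p])
  finally show ?thesis .
qed

lemma common_factor_cases:
  fixes p q :: "'k::alg_closed_field poly"
  assumes "p \<noteq> 0" "q \<noteq> 0"
  obtains g D h where "p = h * g" "q = h * D" "\<And>x. poly g x = 0 \<Longrightarrow> poly D x \<noteq> 0"
proof -
  obtain g D where D: "D \<noteq> 0" and e: "to_fract p / to_fract q = to_fract g / to_fract D"
    and cop: "\<And>x. poly g x = 0 \<Longrightarrow> poly D x \<noteq> 0"
    by (rule fract_reduced[of "to_fract p / to_fract q"]) blast
  have "to_fract p * to_fract D = to_fract g * to_fract q"
    using e D assms(2) by (simp add: frac_eq_eq)
  then have pq: "p * D = g * q" by (simp only: to_fract_mult[symmetric] to_fract_eq_iff)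
  have "g \<noteq> 0" using pq D assms(1) by auto
  moreover have "g dvd p * D" unfolding pq by simp
  ultimately have "g dvd p" using cop by (rule dvd_of_no_common_root)
  then obtain h where h: "p = h * g" by (metis dvdE mult.commute)
  then have "g * q = g * (h * D)" using pq by (metis mult.assoc mult.commute)
  then have "q = h * D" using \<open>g \<noteq> 0\<close> by (metis mult_cancel_left)
  then show ?thesis using h cop that by blast
qed

context curve_params
begin

lemma smooth_point_gradient:
  assumes "smooth_point C (proj_pt v)"
  obtains d G where "homogeneous d G" "\<And>s. mp_eval id (vec_nth (aff_pt s)) G = 0"
    "\<exists>i. mp_eval id (vec_nth v) (mp_pderiv i G) \<noteq> 0"
proof -
  obtain d G i where G: "curve_equation d G C" and i: "\<not> vanishes_at (mp_pderiv i G) (proj_pt v)"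
    using assms by (auto simp: smooth_point_def)
  have hom: "homogeneous d G" and CG: "C = zero_locus G" using G by (simp_all only: curve_equation_def)
  have "vanishes_at G (proj_pt (aff_pt s))" for s
  proof -
    have "proj_pt (aff_pt s) \<in> zero_locus G" unfolding CG[symmetric] by (simp add: C_eq)
    then show ?thesis by (simp add: zero_locus_def)
  qed
  then have "mp_eval id (vec_nth (aff_pt s)) G = 0" for s by (simp add: vanishes_at_proj_pt[OF hom])
  moreover have "mp_eval id (vec_nth v) (mp_pderiv i G) \<noteq> 0"
    using i by (simp add: vanishes_at_proj_pt[OF homogeneous_pderiv[OF hom]])
  ultimately show ?thesis using that[OF hom] by blast
qed

definition line_poly :: "(3 \<Rightarrow> 'k) \<Rightarrow> 'k poly" where
  "line_poly l = Polynomial.smult (l 1) (aff_par 1) + Polynomial.smult (l 2) (aff_par 2) + Polynomial.smult (l 3) (aff_par 3)"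

lemma line_poly_0: "line_poly l = 0 \<Longrightarrow> l i = 0"
  using aff_par_independent[of "l 1" "l 2" "l 3"] exhaust_3[of i] by (auto simp: line_poly_def)

text \<open>
  Let \<open>l\<close> be the gradient of an equation of the curve at the point. It is nonzero by smoothness. At
  every parameter of the point the gradient is a multiple of \<open>l\<close>, so Euler's identity and the chain rule
  give a zero and a vanishing derivative of the pullback of the tangent line.
\<close>

lemma smooth_point_tangent:
  assumes "smooth_point C (proj_pt (aff_pt s0))"
  obtains l where "\<exists>i. l i \<noteq> 0"
    "\<And>s. proj_pt (aff_pt s) = proj_pt (aff_pt s0) \<Longrightarrow> poly (line_poly l) s = 0"
    "\<And>s. proj_pt (aff_pt s) = proj_pt (aff_pt s0) \<Longrightarrow> poly (pderiv (line_poly l)) s = 0"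
proof -
  obtain d G where hom: "homogeneous d G" and z: "\<And>s. mp_eval id (vec_nth (aff_pt s)) G = 0"
    and nz: "\<exists>i. mp_eval id (vec_nth (aff_pt s0)) (mp_pderiv i G) \<noteq> 0"
    by (rule smooth_point_gradient[OF assms]) blast
  define l where "l = (\<lambda>i. mp_eval id (vec_nth (aff_pt s0)) (mp_pderiv i G))"
  have G0: "mp_poly aff_par G = 0"
    by (rule poly_eq_0_of_cofinite[of "{}"]) (simp_all add: poly_mp_poly_aff_par z)
  have g: "\<exists>c. c \<noteq> 0 \<and> (\<forall>i. mp_eval id (vec_nth (aff_pt s)) (mp_pderiv i G) = c * l i)"
    if s: "proj_pt (aff_pt s) = proj_pt (aff_pt s0)" for s
  proof -
    obtain c where c: "c \<noteq> 0" "aff_pt s = c *s aff_pt s0" using proj_pt_eqD[OF s[symmetric]] by blast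
    have "vec_nth (aff_pt s) = (\<lambda>i. c * vec_nth (aff_pt s0) i)"
      unfolding c(2) by (simp add: fun_eq_iff vector_scalar_mult_def)
    then have "mp_eval id (vec_nth (aff_pt s)) (mp_pderiv i G) = c ^ (d - 1) * l i" for i
      using id_hom.mp_eval_homogeneous[OF homogeneous_pderiv[OF hom], of c "vec_nth (aff_pt s0)" i]
      by (simp add: l_def)
    then show ?thesis using c(1) by (intro exI[of _ "c ^ (d - 1)"]) simp
  qed
  show ?thesis
  proof (rule that[of l])
    show "\<exists>i. l i \<noteq> 0" using nz by (simp add: l_def)
    fix s assume "proj_pt (aff_pt s) = proj_pt (aff_pt s0)"
    then obtain c where c: "c \<noteq> 0" "\<And>i. mp_eval id (vec_nth (aff_pt s)) (mp_pderiv i G) = c * l i"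
      using g by blast
    \<comment> \<open>Euler's identity\<close>
    have "(\<Sum>i\<in>UNIV. (c * l i) * vec_nth (aff_pt s) i) = 0"
      using euler_homogeneous[OF hom, of "vec_nth (aff_pt s)"] unfolding c(2) z by simp
    then have "c * poly (line_poly l) s = 0"
      by (simp add: sum_3 line_poly_def poly_aff_par' algebra_simps)
    then show "poly (line_poly l) s = 0" using c(1) by simp
    \<comment> \<open>the chain rule\<close>
    have "(\<Sum>i\<in>UNIV. mp_poly aff_par (mp_pderiv i G) * pderiv (aff_par i)) = 0"
      unfolding pderiv_mp_poly[symmetric] G0 by simp
    then have "poly (\<Sum>i\<in>UNIV. mp_poly aff_par (mp_pderiv i G) * pderiv (aff_par i)) s = 0" by simp
    then have "(\<Sum>i\<in>UNIV. (c * l i) * poly (pderiv (aff_par i)) s) = 0"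
      unfolding poly_sum poly_mult poly_mp_poly_aff_par c(2) .
    then have "c * poly (pderiv (line_poly l)) s = 0"
      by (simp add: sum_3 line_poly_def pderiv_add pderiv_smult algebra_simps)
    then show "poly (pderiv (line_poly l)) s = 0" using c(1) by simp
  qed
qed

lemma pderiv_inf_par:
  defines "T \<equiv> [:0, 1:] :: 'k poly" and "U \<equiv> [:1, - 1:] :: 'k poly"
  shows "pderiv (inf_par 1) = T ^ (m - 1) * [:of_nat m:]"
    "pderiv (inf_par 2) = T ^ (m - 1) * ([:of_nat m:] * U ^ n - [:of_nat n:] * (T * U ^ m))"
    "pderiv (inf_par 3) = T ^ (m - 1) * (- [:of_nat (2 * m):] * T ^ m)"
proof -
  have dT: "pderiv T = 1" "pderiv U = - 1" by (simp_all add: T_def U_def pderiv_pCons one_pCons)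
  have Tm: "T ^ m = T ^ (m - 1) * T" using m2 by (cases m) (simp_all add: mult.commute)
  have T2m: "T ^ (2 * m - 1) = T ^ (m - 1) * T ^ m"
  proof -
    have "2 * m - 1 = (m - 1) + m" using m2 by simp
    then show ?thesis by (simp only: power_add)
  qed
  have n1: "n - 1 = m" using n by simp
  show "pderiv (inf_par 1) = T ^ (m - 1) * [:of_nat m:]"
    unfolding inf_par_simps T_def[symmetric] pderiv_power dT by simp
  show "pderiv (inf_par 2) = T ^ (m - 1) * ([:of_nat m:] * U ^ n - [:of_nat n:] * (T * U ^ m))"
    unfolding inf_par_simps T_def[symmetric] U_def[symmetric] pderiv_mult pderiv_power dT n1
    by (simp add: Tm algebra_simps)
  show "pderiv (inf_par 3) = T ^ (m - 1) * (- [:of_nat (2 * m):] * T ^ m)"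
    unfolding inf_par_simps T_def[symmetric] pderiv_diff pderiv_power dT T2m by simp
qed

text \<open>
  Let \<open>g\<close> be the gradient along the curve in the coordinate \<open>T = 1/s\<close>. The chain rule, divided by
  \<open>T\<^sup>m\<^sup>-\<^sup>1\<close>, is a relation \<open>W = 0\<close>. As \<open>g\<close> has derivative zero at \<open>T = 0\<close>, the terms of
  order zero and one of \<open>W\<close> show that \<open>g 1 + g 2\<close> and \<open>n\<^sup>2 g 2\<close> vanish there. The third component
  vanishes by Euler's identity.
\<close>

lemma not_smooth_Pinf: "\<not> smooth_point C Pinf"
proof
  let ?e = "vector [0, 0, 1] :: 'k ^ 3"
  let ?T = "[:0, 1:] :: 'k poly" and ?U = "[:1, - 1:] :: 'k poly"
  assume "smooth_point C Pinf"
  then obtain d G where hom: "homogeneous d G" and z: "\<And>s. mp_eval id (vec_nth (aff_pt s)) G = 0"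
    and nz: "\<exists>i. mp_eval id (vec_nth ?e) (mp_pderiv i G) \<noteq> 0"
    unfolding Pinf_def by (rule smooth_point_gradient) blast
  have G0: "mp_poly inf_par G = 0" by (rule mp_poly_inf_par_eq_0[OF hom z])
  define g where "g = (\<lambda>i. mp_poly inf_par (mp_pderiv i G))"
  have g_e: "poly (g i) 0 = mp_eval id (vec_nth ?e) (mp_pderiv i G)" for i
    unfolding g_def poly_mp_poly poly_inf_par_0 ..
  have Tm: "poly (?T ^ (m - 1)) 0 = 0" using m2 by (simp add: zero_power)
  have g': "poly (pderiv (g i)) 0 = 0" for i
  proof -
    have "poly (pderiv (inf_par j)) 0 = 0" for j
      using exhaust_3[of j] Tm by (auto simp: pderiv_inf_par)
    then show ?thesis unfolding g_def pderiv_mp_poly by (simp add: poly_sum)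
  qed
  define W where "W = g 1 * [:of_nat m:] + g 2 * ([:of_nat m:] * ?U ^ n - [:of_nat n:] * (?T * ?U ^ m)) +
     g 3 * (- [:of_nat (2 * m):] * ?T ^ m)"
  have "(\<Sum>i\<in>UNIV. g i * pderiv (inf_par i)) = 0"
    using pderiv_mp_poly[of inf_par G] by (simp add: G0 g_def)
  then have "?T ^ (m - 1) * W = 0"
    unfolding sum_3 pderiv_inf_par W_def by (simp only: algebra_simps)
  then have W: "W = 0" by simp
  have "poly W 0 = of_nat m * (poly (g 1) 0 + poly (g 2) 0)"
    unfolding W_def using pos by (simp add: zero_power algebra_simps)
  then have s12: "poly (g 1) 0 + poly (g 2) 0 = 0" using W nonzero_of_nat(2) by simp
  have dU: "pderiv ?U = - 1" "pderiv ?T = 1" by (simp_all add: pderiv_pCons one_pCons)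
  have "poly (pderiv W) 0 = poly (g 2) 0 * (- (of_nat m * of_nat n) - of_nat n)"
    unfolding W_def pderiv_add pderiv_mult pderiv_diff pderiv_power dU poly_add poly_mult g' 
    using pos m2 by (simp add: zero_power pderiv_mult pderiv_power dU pderiv_diff pderiv_pCons)
  also have "- (of_nat m * of_nat n) - of_nat n = - ((of_nat n * of_nat n) :: 'k)"
    by (simp add: n algebra_simps)
  finally have "poly (g 2) 0 = 0" using W nonzero_of_nat(1) by simp
  moreover from this have "poly (g 1) 0 = 0" using s12 by simp
  moreover have "poly (g 3) 0 = 0"
  proof -
    have "mp_eval id (vec_nth ?e) G = 0"
      using G0 poly_mp_poly[of inf_par G 0] unfolding poly_inf_par_0 by simp
    then show ?thesis
      using euler_homogeneous[OF hom, of "vec_nth ?e"] by (simp add: sum_3 g_e)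
  qed
  ultimately have "poly (g i) 0 = 0" for i using exhaust_3[of i] by auto
  then show False using nz by (simp add: g_e)
qed

end

section \<open>No other Galois points\<close>

text \<open>
  The case of a point on the line \<open>x = y\<close> with two parameters \<open>s0\<close> and \<open>s1\<close>, where \<open>A = s\<^sup>m\<close> and
  \<open>B = (s - 1)\<^sup>m\<close>. By the equations of the curve, \<open>A\<close> and \<open>B\<close> are the two roots of \<open>Y\<^sup>2 - u Y - 1\<close> for each
  of the parameters, and \<open>A/B\<close> determines \<open>s\<close>; so passing from \<open>s0\<close> to \<open>s1\<close> interchanges \<open>A\<close> and
  \<open>B\<close>. If a line \<open>l\<close> were tangent at both parameters, then \<open>l1 = l2\<close>, and the remaining two equations have the
  determinant \<open>u\<^sup>2 + 4 = (A - B)\<^sup>2\<close>.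
\<close>

lemma no_common_tangent:
  fixes s0 s1 A B A' B' u l1 l2 l3 :: "'a::field"
  assumes two: "(2::'a) \<noteq> 0" and s: "s0 \<noteq> s1" and nz: "A \<noteq> 0" "A' \<noteq> 0"
    and R: "s0 * A = (s0 - 1) * B" "A * A = u * A + 1" "B * B = u * B + 1" "l1 * A + l2 * B = 2 * l3"
    and R': "s1 * A' = (s1 - 1) * B'" "A' * A' = u * A' + 1" "B' * B' = u * B' + 1" "l1 * A' + l2 * B' = 2 * l3"
    and l: "l1 + l2 + u * l3 = 0"
  shows "l1 = 0" "l2 = 0" "l3 = 0"
proof -
  have neq: "a \<noteq> b" if "t * a = (t - 1) * b" "a \<noteq> 0" for t a b :: 'a
  proof
    assume "a = b"
    then show False using that by (simp add: left_diff_distrib)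
  qed
  note AB = neq[OF R(1) nz(1)] and AB' = neq[OF R'(1) nz(2)]
  have "(A - B) * (A + B - u) = (A * A - u * A) - (B * B - u * B)" by (simp add: algebra_simps)
  also have "\<dots> = 0" unfolding R(2,3) by simp
  finally have u: "u = A + B" using AB by simp
  have "A * B = u * A - A * A" unfolding u by (simp add: algebra_simps)
  then have AB1: "A * B = - 1" unfolding R(2) by simp
  have roots: "x = A \<or> x = B" if x: "x * x = u * x + 1" for x
  proof -
    have "(x - A) * (x - B) = x * x - u * x + A * B" unfolding u by (simp add: algebra_simps)
    also have "\<dots> = 0" unfolding x AB1 by simp
    finally show ?thesis by simp
  qed
  have "\<not> (A' = A \<and> B' = B)"
  proof
    assume "A' = A \<and> B' = B"
    then have "s1 * (A - B) = - B" "s0 * (A - B) = - B" using R(1) R'(1) by (simp_all add: algebra_simps)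
    then have "s1 * (A - B) = s0 * (A - B)" by simp
    then show False using s AB by simp
  qed
  then have sw: "A' = B" "B' = A" using roots[OF R'(2)] roots[OF R'(3)] AB' by auto
  have "(l1 - l2) * (A - B) = (l1 * A + l2 * B) - (l1 * B + l2 * A)" by (simp add: algebra_simps)
  also have "\<dots> = 0" unfolding R(4) R'(4)[unfolded sw] by simp
  finally have l12: "l2 = l1" using AB by simp
  have l3: "2 * l3 = u * l1" unfolding R(4)[symmetric] l12 u by (simp add: algebra_simps)
  have "(A - B) * (A - B) + 4 * (A * B + 1) = 4 + u * u" unfolding u by (simp add: algebra_simps)
  then have D: "4 + u * u = (A - B) * (A - B)" unfolding AB1 by simp
  have "(4 + u * u) * l1 = 4 * l1 + u * (2 * l3)" unfolding l3 by (simp add: algebra_simps)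
  also have "\<dots> = 2 * (l1 + l2 + u * l3)" unfolding l12 by (simp add: algebra_simps)
  also have "\<dots> = 0" unfolding l by simp
  finally show l1: "l1 = 0" unfolding D using AB by simp
  show "l2 = 0" "l3 = 0" using l12 l3 l1 two by simp_all
qed

context curve_params
begin

text \<open>
  There are \<open>n \<ge> 3\<close> roots of unity.
\<close>

lemma two_roots_of_unity_avoiding:
  "\<exists>\<xi>::'k. \<xi> ^ n = 1 \<and> \<xi> \<noteq> 1 \<and> \<xi> \<noteq> c"
proof (rule ccontr)
  assume "\<not> ?thesis"
  then have "mu_n \<subseteq> {1, c}" by auto
  then have "card mu_n \<le> card {1, c}" by (rule card_mono[rotated]) simp
  also have "\<dots> \<le> 2" by (simp add: card_insert_if)
  finally show False unfolding card_mu_n using n m2 by simp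
qed

text \<open>
  The derivative of \<open>s\<^sup>q - s\<close> is \<open>-1\<close>.
\<close>

lemma poly_pderiv_aff_par:
  "poly (pderiv (aff_par 1)) s = of_nat n * s ^ m"
  "poly (pderiv (aff_par 2)) s = of_nat n * (s - 1) ^ m"
  "poly (pderiv (aff_par 3)) s = - 1"
proof -
  have n1: "n - 1 = m" using n by simp
  have d: "pderiv [:0, 1:] = (1 :: 'k poly)" "pderiv [:- 1, 1:] = (1 :: 'k poly)" by (simp_all add: pderiv_pCons)
  show "poly (pderiv (aff_par 1)) s = of_nat n * s ^ m" "poly (pderiv (aff_par 2)) s = of_nat n * (s - 1) ^ m"
    "poly (pderiv (aff_par 3)) s = - 1"
    unfolding aff_par_simps pderiv_diff pderiv_power d n1 q0 by simp_all
qed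

lemma degree_aff_par: "degree (aff_par 1) = n" "degree (aff_par 2) = n" "degree (aff_par 3) = q"
proof -
  show "degree (aff_par 1) = n" "degree (aff_par 2) = n" unfolding aff_par_simps by (simp_all add: Polynomial.degree_linear_power)
  have "degree ([:0, 1:] ^ q :: 'k poly) = q" by (rule Polynomial.degree_linear_power)
  moreover have "degree [:0, 1 :: 'k:] < q" using q m2 by simp
  ultimately show "degree (aff_par 3) = q"
    unfolding aff_par_simps diff_conv_add_uminus by (subst degree_add_eq_left) simp_all
qed

lemma degree_line_poly_le: "degree (line_poly l) \<le> q"
proof -
  have "n \<le> q" using n q by simp
  then show ?thesis
    unfolding line_poly_def by (intro degree_add_le order.trans[OF degree_smult_le]) (simp_all add: degree_aff_par)
qed

text \<open>
  The lines \<open>M1\<close> and \<open>M2\<close> through the point define the projection, and \<open>g/D\<close> is the reduced form of their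
  quotient. If \<open>g\<close> is not constant, the criterion \<open>not_galois_quotient\<close> applies. Otherwise every parameter
  on the line \<open>M1\<close> belongs to the point, and the tangent has double zeros at all of them.
\<close>

lemma not_galois_other:
  assumes s0: "s0 \<noteq> (0::'k)" "s0 \<noteq> 1"
    and smooth: "smooth_point C (proj_pt (aff_pt s0))"
  shows "\<not> galois_point C (proj_pt (aff_pt s0))"
proof
  define a b c where "a = s0 ^ n" and "b = (s0 - 1) ^ n" and "c = s0 ^ q - s0"
  have ab: "a \<noteq> 0" "b \<noteq> 0" using s0 by (simp_all add: a_def b_def)
  have ph0: "aff_pt s0 = vector [a, b, c]" by (rule vec3_eqI) (simp_all add: a_def b_def c_def)
  define r u where "r = b / a" and "u = c / a"
  have r: "r \<noteq> 0" using ab by (simp add: r_def)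
  define M1 M2 where "M1 = aff_par 2 - Polynomial.smult r (aff_par 1)" and "M2 = aff_par 3 - Polynomial.smult u (aff_par 1)"
  have pM: "poly M1 s = (s - 1) ^ n - r * s ^ n" "poly M2 s = (s ^ q - s) - u * s ^ n" for s
    by (simp_all add: M1_def M2_def poly_aff_par')
  have M0: "M1 \<noteq> 0" "M2 \<noteq> 0"
  proof -
    show "M1 \<noteq> 0"
    proof
      assume "M1 = 0"
      then have "Polynomial.smult (- r) (aff_par 1) + Polynomial.smult 1 (aff_par 2) + Polynomial.smult 0 (aff_par 3) = 0"
        by (simp add: M1_def)
      from aff_par_independent(2)[OF this] show False by simp
    qed
    show "M2 \<noteq> 0"
    proof
      assume "M2 = 0"
      then have "Polynomial.smult (- u) (aff_par 1) + Polynomial.smult 0 (aff_par 2) + Polynomial.smult 1 (aff_par 3) = 0"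
        by (simp add: M2_def)
      from aff_par_independent(3)[OF this] show False by simp
    qed
  qed
  have root_nz: "s \<noteq> 0" "s \<noteq> 1" if "poly M1 s = 0" for s
    using that r pos by (auto simp: pM zero_power)
  have sqf: "poly (pderiv M1) s \<noteq> 0" if s: "poly M1 s = 0" for s
  proof
    assume "poly (pderiv M1) s = 0"
    then have "of_nat n * ((s - 1) ^ m - r * s ^ m) = 0"
      by (simp add: M1_def pderiv_diff pderiv_smult poly_pderiv_aff_par algebra_simps)
    then have d: "(s - 1) ^ m = r * s ^ m" using nonzero_of_nat(1) by simp
    have "(s - 1) * (s - 1) ^ m = r * (s * s ^ m)" using s by (simp add: pM n)
    then have "r * s ^ m = 0" unfolding d by (simp add: algebra_simps)
    then show False using r root_nz[OF s] by simp
  qed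
  have dM1: "degree M1 \<le> n"
    unfolding M1_def by (rule degree_diff_le) (simp_all add: degree_aff_par)
  have dM2: "degree M2 = q"
  proof -
    have "n < q" using n q m2 by simp
    then have "degree (- Polynomial.smult u (aff_par 1)) < degree (aff_par 3)"
      using degree_smult_le[of u "aff_par 1"] by (simp add: degree_aff_par)
    then have "degree (aff_par 3 + - Polynomial.smult u (aff_par 1)) = degree (aff_par 3)" by (rule degree_add_eq_left)
    then show ?thesis by (simp add: M2_def degree_aff_par)
  qed
  have same: "proj_pt (aff_pt s) = proj_pt (aff_pt s0)" if s: "poly M1 s = 0" "poly M2 s = 0" for s
  proof -
    have "aff_pt s = (s ^ n / a) *s aff_pt s0"
      unfolding ph0 using s ab by (intro vec3_eqI) (simp_all add: pM r_def u_def field_simps)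
    moreover have "s ^ n / a \<noteq> 0" using root_nz[OF s(1)] ab by simp
    ultimately show ?thesis using proj_pt_scale[of "s ^ n / a" "aff_pt s0"] by simp
  qed
  obtain g D h where M: "M1 = h * g" "M2 = h * D" and cop: "\<And>x. poly g x = 0 \<Longrightarrow> poly D x \<noteq> 0"
    by (rule common_factor_cases[OF M0]) blast
  have nz: "h \<noteq> 0" "g \<noteq> 0" "D \<noteq> 0" using M M0 by auto
  assume gal: "galois_point C (proj_pt (aff_pt s0))"
  have in_ps: "proj_pt (aff_pt s0) \<in> proj_space" using aff_pt_nz by (auto simp: proj_space_def)
  have K: "projection_subfield C (proj_pt (aff_pt s0)) = rat_cls ` kgen (to_fract M1 / to_fract M2)"
    unfolding ph0 M1_def M2_def r_def u_def by (rule projection_subfield_finite_point[OF ab(1)])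
  have "to_fract M1 / to_fract M2 = to_fract g / to_fract D"
    unfolding M to_fract_mult using nz by simp
  then have gal': "galois_extension kS (kgen (to_fract g / to_fract D))"
    using gal unfolding galois_point_iff[OF in_ps K] by simp
  \<comment> \<open>The degree of \<open>D\<close> exceeds that of \<open>g\<close> by at least \<open>q - n = m \<ge> 2\<close>.\<close>
  have g0: "degree g = 0"
  proof (rule ccontr)
    assume "degree g \<noteq> 0"
    then have dg: "degree g \<ge> 1" by simp
    have sq: "poly (pderiv g) x \<noteq> 0" if "poly g x = 0" for x
      using sqf[of x] that unfolding M(1) pderiv_mult by simp
    have dD: "degree D \<ge> degree g + 2"
    proof -
      have "degree h + degree D = q" using dM2 nz unfolding M by (simp add: degree_mult_eq)
      moreover have "degree h + degree g \<le> n" using dM1 nz unfolding M by (simp add: degree_mult_eq)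
      ultimately show ?thesis using n q m2 by linarith
    qed
    show False using not_galois_quotient[OF cop sq dg dD] gal' by blast
  qed
  have common: "poly M2 s = 0" if "poly M1 s = 0" for s
  proof -
    obtain k where "g = [:k:]" using g0 by (rule degree_eq_zeroE)
    then have "poly g s \<noteq> 0" using nz(2) by simp
    then show ?thesis using that by (simp add: M)
  qed
  obtain l where l: "\<exists>i. l i \<noteq> 0"
    and "\<And>s. proj_pt (aff_pt s) = proj_pt (aff_pt s0) \<Longrightarrow> poly (line_poly l) s = 0"
    "\<And>s. proj_pt (aff_pt s) = proj_pt (aff_pt s0) \<Longrightarrow> poly (pderiv (line_poly l)) s = 0"
    by (rule smooth_point_tangent[OF smooth]) blast
  then have tan: "poly (line_poly l) s = 0" "poly (pderiv (line_poly l)) s = 0" if "poly M1 s = 0" for s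
    using same[OF that common[OF that]] by blast+
  have l0: "line_poly l \<noteq> 0" using l line_poly_0 by blast
  \<comment> \<open>For \<open>r \<noteq> 1\<close> the line \<open>M1\<close> has \<open>n\<close> different parameters. For \<open>r = 1\<close> its parameters are
    \<open>1/(1 - \<xi>)\<close> with \<open>\<xi>\<^sup>n = 1\<close> and \<open>\<xi> \<noteq> 1\<close>, and there is one besides \<open>s0\<close>.\<close>
  show False
  proof (cases "r = 1")
    case False
    have "coeff (aff_par 1) n = 1" "coeff (aff_par 2) n = 1"
      unfolding aff_par_simps using lead_coeff_power[of "[:0, 1:] :: 'k poly" n] lead_coeff_power[of "[:- 1, 1:] :: 'k poly" n]
      by (simp_all add: Polynomial.degree_linear_power)
    then have "coeff M1 n \<noteq> 0" using False by (simp add: M1_def)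
    then have "degree M1 = n" using dM1 le_degree[of M1 n] by simp
    then have "card {s. poly M1 s = 0} = n" using card_proots_squarefree[OF M0(1) sqf] by simp
    moreover have "2 * card {s. poly M1 s = 0} \<le> degree (line_poly l)"
      by (rule degree_ge_of_double_roots[OF l0]) (simp_all add: tan)
    ultimately show False using degree_line_poly_le[of l] n q by linarith
  next
    case True
    have rel: "s * s ^ m = (s - 1) * (s - 1) ^ m" "s ^ m * s ^ m = u * s ^ m + 1"
      "(s - 1) ^ m * (s - 1) ^ m = u * (s - 1) ^ m + 1"
      "l 1 * s ^ m + l 2 * (s - 1) ^ m = 2 * l 3" "l 1 + l 2 + u * l 3 = 0"
      if s: "poly M1 s = 0" for s
    proof -
      note nz = root_nz[OF s]
      have e: "(s - 1) ^ n = s ^ n" "s ^ q - s = u * s ^ n"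
        using s common[OF s] True by (simp_all add: pM)
      show 1: "s * s ^ m = (s - 1) * (s - 1) ^ m" using e(1) by (simp add: n)
      have z: "x ^ q - x = x * (x ^ m * x ^ m - 1)" for x :: 'k
        unfolding sq_minus_s by (simp add: mult_2 power_add)
      have "s * (s ^ m * s ^ m - 1) = s * (u * s ^ m)" using e(2) unfolding z by (simp add: n ac_simps)
      then have "s ^ m * s ^ m - 1 = u * s ^ m" using nz by (simp only: mult_cancel_left) simp
      then show "s ^ m * s ^ m = u * s ^ m + 1" by (simp add: diff_eq_eq)
      have "(s - 1) ^ q = s ^ q - 1" using frob[of "s - 1" 1] by (simp add: eq_diff_eq)
      then have "(s - 1) ^ q - (s - 1) = u * s ^ n" using e(2) by simp
      also have "\<dots> = (s - 1) * (u * (s - 1) ^ m)" using 1 by (simp add: n ac_simps)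
      finally have "(s - 1) ^ m * (s - 1) ^ m - 1 = u * (s - 1) ^ m"
        unfolding z using nz by (simp only: mult_cancel_left) simp
      then show "(s - 1) ^ m * (s - 1) ^ m = u * (s - 1) ^ m + 1" by (simp add: diff_eq_eq)
      have "of_nat n * (l 1 * s ^ m + l 2 * (s - 1) ^ m) = l 3"
        using tan(2)[OF s] by (simp add: line_poly_def pderiv_add pderiv_smult poly_pderiv_aff_par algebra_simps)
      then have "(2 * of_nat n) * (l 1 * s ^ m + l 2 * (s - 1) ^ m) = 2 * l 3" by (simp only: mult.assoc)
      then show "l 1 * s ^ m + l 2 * (s - 1) ^ m = 2 * l 3" unfolding two_n by simp
      have "s ^ n * (l 1 + l 2 + u * l 3) = 0"
        using tan(1)[OF s] unfolding line_poly_def by (simp add: poly_aff_par' e algebra_simps)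
      then show "l 1 + l 2 + u * l 3 = 0" using nz by simp
    qed
    have M1s0: "poly M1 s0 = 0" using ab by (simp add: pM r_def flip: a_def b_def)
    obtain \<xi> where \<xi>: "\<xi> ^ n = 1" "\<xi> \<noteq> 1" "\<xi> \<noteq> (s0 - 1) / s0" using two_roots_of_unity_avoiding by blast
    define s1 where "s1 = 1 / (1 - \<xi>)"
    have x1: "1 - \<xi> \<noteq> 0" using \<xi>(2) by simp
    have s1x: "s1 - 1 = \<xi> * s1" using x1 by (simp add: s1_def field_simps)
    have s10: "s1 \<noteq> s0" using \<xi>(3) s1x s0 by (auto simp: eq_divide_eq)
    have M1s1: "poly M1 s1 = 0" unfolding pM s1x using \<xi>(1) True by (simp add: power_mult_distrib)
    note R = rel[OF M1s0] and R' = rel[OF M1s1]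
    note no_common_tangent[OF nonzero_of_nat(3) s10[symmetric] _ _ R(1-4) R'(1-4) R(5)]
    then have "l 1 = 0" "l 2 = 0" "l 3 = 0" using root_nz[OF M1s0] root_nz[OF M1s1] by simp_all
    then have "l i = 0" for i using exhaust_3[of i] by auto
    then show False using l by blast
  qed
qed

lemma inner_galois_points:
  "{P. inner_galois_point C P} = {proj_pt (vector [0, 1, 0]), proj_pt (vector [1, 0, 0])}"
proof (intro equalityI subsetI)
  fix P assume "P \<in> {P. inner_galois_point C P}"
  then have P: "galois_point C P" "smooth_point C P" by (simp_all add: inner_galois_point_def)
  have "P \<in> C" using P(2) by (simp add: smooth_point_def)
  moreover have "P \<noteq> Pinf" using P(2) not_smooth_Pinf by blast
  ultimately obtain s where s: "P = proj_pt (aff_pt s)" by (auto simp: C_eq)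
  then have "s = 0 \<or> s = 1" using P not_galois_other by blast
  then show "P \<in> {proj_pt (vector [0, 1, 0]), proj_pt (vector [1, 0, 0])}"
  proof
    assume "s = 0"
    then have "aff_pt s = ((- 1) ^ n) *s vector [0, 1, 0]" using pos by (intro vec3_eqI) (simp_all add: zero_power)
    then have "P = proj_pt (vector [0, 1, 0])"
      unfolding s using proj_pt_scale[of "(- 1) ^ n :: 'k" "vector [0, 1, 0]"] by simp
    then show ?thesis by simp
  next
    assume "s = 1"
    then have "aff_pt s = vector [1, 0, 0]" using pos by (intro vec3_eqI) (simp_all add: zero_power)
    then show ?thesis unfolding s by simp
  qed
next
  fix P :: "('k, 3) proj_pt" assume "P \<in> {proj_pt (vector [0, 1, 0]), proj_pt (vector [1, 0, 0])}"
  then show "P \<in> {P. inner_galois_point C P}"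
    using galois_P1(1) galois_P2(1) smooth_P1 smooth_P2 by (auto simp: inner_galois_point_def)
qed

lemma P1_neq_P2: "proj_pt (vector [0, 1, 0]) \<noteq> (proj_pt (vector [1, 0, 0]) :: ('k, 3) proj_pt)"
proof
  assume "proj_pt (vector [0, 1, 0]) = (proj_pt (vector [1, 0, 0]) :: ('k, 3) proj_pt)"
  then obtain c :: 'k where "vector [1, 0, 0] = c *s (vector [0, 1, 0] :: 'k ^ 3)"
    using proj_pt_eqD by blast
  from arg_cong[OF this, of "\<lambda>v. vec_nth v 1"] show False by simp
qed

lemma phi2_P1: "phi2 q (proj_pt (vector [0, 1])) = (proj_pt (vector [0, 1, 0]) :: ('k, 3) proj_pt)"
proof -
  have "phi2 q (proj_pt (vector [0, 1])) = proj_pt (((- 1) ^ n) *s (vector [0, 1, 0] :: 'k ^ 3))"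
    unfolding phi2_proj_pt using pos
    by (intro arg_cong[where f = proj_pt] vec3_eqI) (simp_all add: zero_power)
  then show ?thesis by (simp add: proj_pt_scale)
qed

lemma phi2_P2: "phi2 q (proj_pt (vector [1, 1])) = (proj_pt (vector [1, 0, 0]) :: ('k, 3) proj_pt)"
  unfolding phi2_proj_pt using pos
  by (intro arg_cong[where f = proj_pt] vec3_eqI) (simp_all add: zero_power)

end

text \<open>
  A power of an odd characteristic satisfies the conditions on \<open>q\<close>; additivity of \<open>x \<mapsto> x\<^sup>q\<close> is the
  binomial theorem in characteristic \<open>p\<close>.
\<close>

lemma curve_paramsI:
  fixes p q e :: nat
  assumes p: "CHAR('k::alg_closed_field) = p" "p \<ge> 3" and q: "q = p ^ e" "q \<ge> 5"
  shows "curve_params TYPE('k) ((q - 1) div 2) ((q - 1) div 2 + 1) q"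
proof
  have prime: "prime p" using prime_CHAR_semidom[where 'a = 'k] p by simp
  then have "odd p" using p(2) prime_odd_nat by auto
  then have "odd q" unfolding q(1) by simp
  then show "q = 2 * ((q - 1) div 2) + 1" by (elim oddE) simp
  show "(q - 1) div 2 \<ge> 2" using q(2) by simp
  have e: "e > 0" using q by (cases e) auto
  then have "p dvd q" unfolding q(1) by (simp add: dvd_power)
  then show "of_nat q = (0::'k)" using p(1) by (simp add: of_nat_eq_0_iff_char_dvd)
  show "(x + y) ^ q = x ^ q + y ^ q" for x y :: 'k
    unfolding q(1) p(1)[symmetric] by (rule freshmans_dream') (use prime p in simp_all)
qed simp

theorem theorem2:
  fixes p q e :: nat
    and C :: "('k::alg_closed_field, 3) proj_pt set"
    and P1 P2 :: "('k, 3) proj_pt"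
  assumes "CHAR('k) = p" and "p \<ge> 3"
    and "q = p ^ e" and "q \<ge> 5"
    and "C = C2 q"
    and "P1 = proj_pt (vector [0, 1, 0])"
    and "P2 = proj_pt (vector [1, 0, 0])"
  shows "irreducible_plane_curve q C \<and>
    (P1 = phi2 q (proj_pt (vector [0, 1])) \<and>
     inner_galois_point C P1 \<and> galois_point_group C P1 \<cong> dihedral_group (q - 1)) \<and>
    (P2 = phi2 q (proj_pt (vector [1, 1])) \<and>
     inner_galois_point C P2 \<and> galois_point_group C P2 \<cong> dihedral_group (q - 1)) \<and>
    card {P. inner_galois_point C P} = 2"
proof -
  define m where "m = (q - 1) div 2"
  interpret curve_params m "m + 1" q "TYPE('k)"
    unfolding m_def by (rule curve_paramsI[OF assms(1-4)])
  have q1: "q - 1 = 2 * m" using q by simp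
  have "irreducible_plane_curve q (C2 q :: ('k, 3) proj_pt set)"
    unfolding irreducible_plane_curve_def using curve_equation_F by blast
  then show ?thesis
    unfolding assms(5-7) q1 using inner_galois_points galois_P1 galois_P2 smooth_P1 smooth_P2
      phi2_P1 phi2_P2 P1_neq_P2 by (simp add: inner_galois_point_def)
qed

end
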